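(* Let $\Gamma\curvearrowright (X,\mu)$ be an ergodic p.m.p. action of a countable group $\Gamma$ on a standard probability space $(X,\mu)$. Let $\kappa$ be the Koopman representation of $\Gamma$ on $L^2(X\times X)$ associated to the diagonal action $\Gamma\curvearrowright (X\times X,\mu\times\mu)$. Suppose that the restriction of $\kappa$ to the orthogonal complement of the subspace of $\kappa(\Gamma)$-invariant vectors has spectral gap. Assume that there exist a measurable set $D\subset X$ with $\mu(D)=1$, a modular action $\Delta\curvearrowright Y$ of a countable group $\Delta$, and a countable-to-one Borel homomorphism from $\mathcal R(\Gamma\curvearrowright X)_{|D}$ to $\mathcal R(\Delta\curvearrowright Y)$. Then the action $\Gamma\curvearrowright (X,\mu)$ is profinite.
   Context: A p.m.p. action $\Gamma\curvearrowright (X,\mu)$ is a Borel action of a countable group $\Gamma$ on a standard Borel space $X$ preserving the Borel probability measure $\mu$. For a Borel action $\Gamma\curvearrowright X$ of a countable group on a standard Borel space, $\mathcal R(\Gamma\curvearrowright X)=\{(x_1,x_2)\in X\times X : \Gamma\cdot x_1=\Gamma\cdot x_2\}$ is its orbit equivalence relation, and $\mathcal R_{|D}=\mathcal R\cap (D\times D)$ for $D\subset X$. A homomorphism from an equivalence relation $\mathcal R$ on $X$ to an equivalence relation $\mathcal S$ on $Y$ is a map $\alpha:X\to Y$ with $(\alpha\times\alpha)(\mathcal R)\subset\mathcal S$; it is countable-to-one if every point of $Y$ has countable preimage. Borel maps on $D$ are Borel with respect to the relative Borel structure of $D$. A p.m.p. action $\Gamma\curvearrowright (X,\mu)$ is profinite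 if there exists a sequence $\{\mathcal P_n\}$ of finite measurable partitions of $X$ which separates points in $X$, such that each $\mathcal P_n$ is $\Gamma$-invariant (i.e., its pieces are permuted by $\Gamma$); as usual in the measurable setting, null sets are ignored. A Borel action $\Delta\curvearrowright Y$ of a countable group on a standard Borel space is modular if there exists a sequence $\{\mathcal P_n\}$ of countable Borel partitions of $Y$ which separates points in $Y$, such that each $\mathcal P_n$ is $\Delta$-invariant (i.e., its pieces are permuted by $\Delta$). A unitary representation $\pi:\Gamma\to\mathcal U(\mathcal H)$ has spectral gap if there is no sequence of unit vectors $\xi_n\in\mathcal H$ such that $\|\pi(g)(\xi_n)-\xi_n\|\to 0$ for all $g\in\Gamma$. *)

theory Defs
  imports "HOL-Probability.Probability" "HOL-Algebra.Group_Action"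
begin

definition standard_borel_space :: "'a measure \<Rightarrow> bool" where
  "standard_borel_space M \<longleftrightarrow>
     (\<exists>T. topspace T = space M \<and> completely_metrizable_space T \<and> separable_space T \<and>
          sets M = sigma_sets (space M) {U. openin T U})"

text \<open>
  Only the underlying measurable space of \<open>M\<close> matters in \<open>borel_action\<close> and \<open>modular_action\<close>.
  The group is discrete, so that an action is Borel iff each group element acts by a Borel map.
\<close>

definition borel_action ::
    "('g, 'r) monoid_scheme \<Rightarrow> 'a measure \<Rightarrow> ('g \<Rightarrow> 'a \<Rightarrow> 'a) \<Rightarrow> bool" where
  "borel_action G M \<phi> \<longleftrightarrow>
     countable (carrier G) \<and> standard_borel_space M \<and> group_action G (space M) \<phi> \<and>
     (\<forall>g\<in>carrier G. \<phi> g \<in> measurable M M)"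

definition pmp_action ::
    "('g, 'r) monoid_scheme \<Rightarrow> 'a measure \<Rightarrow> ('g \<Rightarrow> 'a \<Rightarrow> 'a) \<Rightarrow> bool" where
  "pmp_action G M \<phi> \<longleftrightarrow>
     borel_action G M \<phi> \<and> prob_space M \<and> (\<forall>g\<in>carrier G. distr M M (\<phi> g) = M)"

definition ergodic_action ::
    "('g, 'r) monoid_scheme \<Rightarrow> 'a measure \<Rightarrow> ('g \<Rightarrow> 'a \<Rightarrow> 'a) \<Rightarrow> bool" where
  "ergodic_action G M \<phi> \<longleftrightarrow>
     (\<forall>A\<in>sets M. (\<forall>g\<in>carrier G. \<phi> g ` A = A) \<longrightarrow> measure M A = 0 \<or> measure M A = 1)"

definition orbit_equiv_rel ::
    "('g, 'r) monoid_scheme \<Rightarrow> 'a set \<Rightarrow> ('g \<Rightarrow> 'a \<Rightarrow> 'a) \<Rightarrow> ('a \<times> 'a) set" where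
  "orbit_equiv_rel G X \<phi> = {(x, y) \<in> X \<times> X. orbit G \<phi> x = orbit G \<phi> y}"

definition restrict_rel :: "('a \<times> 'a) set \<Rightarrow> 'a set \<Rightarrow> ('a \<times> 'a) set" where
  "restrict_rel R D = R \<inter> D \<times> D"

definition rel_homomorphism ::
    "'a set \<Rightarrow> ('a \<times> 'a) set \<Rightarrow> 'b set \<Rightarrow> ('b \<times> 'b) set \<Rightarrow> ('a \<Rightarrow> 'b) \<Rightarrow> bool" where
  "rel_homomorphism X R Y S \<alpha> \<longleftrightarrow> \<alpha> ` X \<subseteq> Y \<and> map_prod \<alpha> \<alpha> ` R \<subseteq> S"

definition countable_to_one :: "'a set \<Rightarrow> 'b set \<Rightarrow> ('a \<Rightarrow> 'b) \<Rightarrow> bool" where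
  "countable_to_one X Y \<alpha> \<longleftrightarrow> (\<forall>y\<in>Y. countable {x \<in> X. \<alpha> x = y})"

definition separating_invariant_partitions ::
    "('g, 'r) monoid_scheme \<Rightarrow> 'a set \<Rightarrow> ('g \<Rightarrow> 'a \<Rightarrow> 'a) \<Rightarrow> (nat \<Rightarrow> 'a set set) \<Rightarrow> bool" where
  "separating_invariant_partitions G X \<phi> P \<longleftrightarrow>
     (\<forall>n. partition_on X (P n)) \<and>
     (\<forall>x\<in>X. \<forall>y\<in>X. x \<noteq> y \<longrightarrow> (\<exists>n. \<exists>A\<in>P n. x \<in> A \<and> y \<notin> A)) \<and>
     (\<forall>n. \<forall>g\<in>carrier G. bij_betw (image (\<phi> g)) (P n) (P n))"

definition modular_action ::
    "('g, 'r) monoid_scheme \<Rightarrow> 'a measure \<Rightarrow> ('g \<Rightarrow> 'a \<Rightarrow> 'a) \<Rightarrow> bool" where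
  "modular_action G M \<phi> \<longleftrightarrow>
     borel_action G M \<phi> \<and>
     (\<exists>P. separating_invariant_partitions G (space M) \<phi> P \<and>
          (\<forall>n. countable (P n) \<and> P n \<subseteq> sets M))"

text \<open>
  Null sets are ignored: the partitions live on a conull set \<open>X0\<close>, which is automatically
  invariant because the pieces of each partition cover \<open>X0\<close> and are permuted.  As the
  group and the sequence of partitions are countable, this is the same as asking
  for measurable partitions of the whole space that are invariant and separate points modulo
  null sets.
\<close>

definition profinite_action ::
    "('g, 'r) monoid_scheme \<Rightarrow> 'a measure \<Rightarrow> ('g \<Rightarrow> 'a \<Rightarrow> 'a) \<Rightarrow> bool" where
  "profinite_action G M \<phi> \<longleftrightarrow>
     pmp_action G M \<phi> \<and>
     (\<exists>X0\<in>sets M. emeasure M X0 = 1 \<and>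
        (\<exists>P. separating_invariant_partitions G X0 \<phi> P \<and>
             (\<forall>n. finite (P n) \<and> P n \<subseteq> sets M)))"

text \<open>
  Elements of \<open>L\<^sup>2\<close> are given by representing functions.  The norm, the inner product, and
  membership in the sets \<open>koopman_invariants\<close> and \<open>l2_orthogonal\<close> below depend only on
  the class of a function modulo almost everywhere equality.
\<close>

definition l2_space :: "'a measure \<Rightarrow> ('a \<Rightarrow> complex) set" where
  "l2_space M = {f \<in> borel_measurable M. integrable M (\<lambda>x. (cmod (f x))\<^sup>2)}"

definition l2_inner :: "'a measure \<Rightarrow> ('a \<Rightarrow> complex) \<Rightarrow> ('a \<Rightarrow> complex) \<Rightarrow> complex" where
  "l2_inner M f h = (LINT x|M. f x * cnj (h x))"

definition l2_norm :: "'a measure \<Rightarrow> ('a \<Rightarrow> complex) \<Rightarrow> real" where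
  "l2_norm M f = sqrt (LINT x|M. (cmod (f x))\<^sup>2)"

definition l2_orthogonal :: "'a measure \<Rightarrow> ('a \<Rightarrow> complex) set \<Rightarrow> ('a \<Rightarrow> complex) set" where
  "l2_orthogonal M V = {f \<in> l2_space M. \<forall>h\<in>V. l2_inner M f h = 0}"

definition koopman ::
    "('g, 'r) monoid_scheme \<Rightarrow> ('g \<Rightarrow> 'a \<Rightarrow> 'a) \<Rightarrow> 'g \<Rightarrow> ('a \<Rightarrow> complex) \<Rightarrow> ('a \<Rightarrow> complex)" where
  "koopman G \<phi> g f = (\<lambda>x. f (\<phi> (inv\<^bsub>G\<^esub> g) x))"

definition koopman_invariants ::
    "('g, 'r) monoid_scheme \<Rightarrow> 'a measure \<Rightarrow> ('g \<Rightarrow> 'a \<Rightarrow> 'a) \<Rightarrow> ('a \<Rightarrow> complex) set" where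
  "koopman_invariants G M \<phi> =
     {f \<in> l2_space M. \<forall>g\<in>carrier G. AE x in M. koopman G \<phi> g f x = f x}"

text \<open>
  Spectral gap of the representation \<open>\<pi>\<close> on \<open>V\<close>, where \<open>nrm\<close> is the (semi)norm of \<open>V\<close>.
\<close>

definition has_spectral_gap ::
    "('g, 'r) monoid_scheme \<Rightarrow> 'v::minus set \<Rightarrow> ('v \<Rightarrow> real) \<Rightarrow> ('g \<Rightarrow> 'v \<Rightarrow> 'v) \<Rightarrow> bool" where
  "has_spectral_gap G V nrm \<pi> \<longleftrightarrow>
     \<not> (\<exists>\<xi>::nat \<Rightarrow> 'v. (\<forall>n. \<xi> n \<in> V \<and> nrm (\<xi> n) = 1) \<and>
          (\<forall>g\<in>carrier G. (\<lambda>n. nrm (\<pi> g (\<xi> n) - \<xi> n)) \<longlonglongrightarrow> 0))"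

definition diagonal_action :: "('g \<Rightarrow> 'a \<Rightarrow> 'a) \<Rightarrow> 'g \<Rightarrow> 'a \<times> 'a \<Rightarrow> 'a \<times> 'a" where
  "diagonal_action \<phi> g = map_prod (\<phi> g) (\<phi> g)"

end

theory Submission
  imports Defs
begin

text \<open>
  The partitions of \<open>Y\<close> pull back to an increasing sequence of codes \<open>b n\<close> on \<open>X\<close>.  On the pieces of a
  countable partition, a group element \<open>g\<close> acts through a single element of \<open>\<Delta>\<close>, so that it maps classes
  of \<open>b n\<close> into classes of \<open>b n\<close>.  Since the fibres of \<open>\<alpha>\<close> are countable, conditional measures on them
  are atomic, and after adding one more natural number to the codes they separate points.  It
  follows that the unit vectors \<open>\<Sum>A. \<mu>(A)\<^sup>-\<^sup>1\<^sup>/\<^sup>2 1\<^bsub>A \<times> A\<^esub>\<close> of \<open>L\<^sup>2(X \<times> X)\<close>, with \<open>A\<close> running through the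
  classes of \<open>b n\<close>, are almost invariant, hence by spectral gap close to invariant vectors \<open>h n\<close>.
  The distance between the sections \<open>h n (x, \<cdot>)\<close> and \<open>h n (y, \<cdot>)\<close> is an invariant pseudometric in
  \<open>x\<close> and \<open>y\<close>.  By ergodicity it has a gap: being close is an equivalence relation whose classes have
  measure bounded below.  So there are finitely many classes, and they approximate those of \<open>b n\<close>.
\<close>

section \<open>Compact sets in standard Borel spaces\<close>

text \<open>The obstacle is that a group element respects the codes only piecewise: the countable
  partition on whose pieces \<open>g\<close> acts through one element of \<Delta> may cut the
  classes of \<open>b n\<close>. Separation of points removes this in the limit, because the class
  of \<open>x\<close> is then filled, on average, by the single piece containing \<open>x\<close>.
  That is why the codes must become injective although \<alpha> is only countable-to-one.

  The inverse square root of \<mu>(A) makes each section a unit vector whatever the size of its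
  class: sections over one class coincide, sections over two classes are orthogonal. Closeness of
  sections therefore recovers the classes, and it still does so after a small perturbation to
  \<open>h n\<close>, whose invariance makes the recovered relation exactly invariant.

  The gap gives closeness only in mean. One class with small mean error suffices, since measures of
  balls are invariant functions and ergodicity carries the bounds from that class to almost every
  point. All new classes are then at least a fixed fraction of that one class, which turns countable
  partitions into finite ones.\<close>

lemma (in finite_measure) measure_UN_le_geometric:
  fixes B :: "nat \<Rightarrow> 'a set"
  assumes "\<And>i. B i \<in> sets M" "\<And>i. measure M (B i) \<le> e * (1/2) ^ Suc i"
  shows "measure M (\<Union>i. B i) \<le> e"
proof -
  have s: "(\<lambda>i. e * (1/2) ^ Suc i) sums e"
    using sums_mult[OF power_half_series, of e] by simp
  have sm: "summable (\<lambda>i. measure M (B i))"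
    by (rule summable_comparison_test'[OF sums_summable[OF s], of 0]) (use assms(2) in auto)
  have "measure M (\<Union>i. B i) \<le> (\<Sum>i. measure M (B i))"
    using assms(1) sm by (intro finite_measure_subadditive_countably) auto
  also have "\<dots> \<le> (\<Sum>i. e * (1/2) ^ Suc i)"
    using assms(2) sm s by (intro suminf_le) (auto simp: sums_iff)
  finally show ?thesis using s by (simp add: sums_iff)
qed

lemma (in finite_measure) measure_diff_partial_union_small:
  fixes A :: "nat \<Rightarrow> 'a set"
  assumes "\<And>i. A i \<in> sets M" "0 < e"
  shows "\<exists>N. measure M ((\<Union>i. A i) - (\<Union>i<N. A i)) < e"
proof -
  let ?C = "\<lambda>N. \<Union>i<N. A i"
  have "incseq ?C" by (auto simp: incseq_def intro: less_le_trans)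
  then have "(\<lambda>N. measure M (?C N)) \<longlonglongrightarrow> measure M (\<Union>N. ?C N)"
    using assms(1) by (intro finite_Lim_measure_incseq) auto
  moreover have "(\<Union>N. ?C N) = (\<Union>i. A i)" by auto
  ultimately have "\<exists>N. dist (measure M (?C N)) (measure M (\<Union>i. A i)) < e"
    using assms(2) by (metis (no_types, lifting) lim_sequentially order_refl)
  then obtain N where N: "dist (measure M (?C N)) (measure M (\<Union>i. A i)) < e" ..
  have "measure M ((\<Union>i. A i) - ?C N) = measure M (\<Union>i. A i) - measure M (?C N)"
    using assms(1) by (intro finite_measure_Diff) auto
  then show ?thesis using N by (intro exI[of _ N]) (auto simp: dist_real_def)
qed

text \<open>The sets approximable from inside together with their complements form a
  \<sigma>-algebra, so the induction carries both. Open sets start it because they are F-sigma in a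
  metrizable space.\<close>

lemma (in finite_measure) closed_inner_regular:
  assumes sets: "sets M = sigma_sets (space M) {U. openin T U}"
    and top: "topspace T = space M" and met: "metrizable_space T"
    and A: "A \<in> sets M" and "0 < e"
  shows "\<exists>F. closedin T F \<and> F \<subseteq> A \<and> measure M (A - F) < e"
proof -
  define Q where "Q A \<longleftrightarrow> (\<forall>e>0. \<exists>F. closedin T F \<and> F \<subseteq> A \<and> measure M (A - F) < e)" for A
  have closed_meas: "F \<in> sets M" if "closedin T F" for F
  proof -
    have "space M - F \<in> sets M"
      using that unfolding sets by (auto simp: closedin_def top)
    then have "space M - (space M - F) \<in> sets M" by (rule sets.compl_sets)
    then show ?thesis using that
      by (metis closedin_subset double_diff order_refl top)
  qed
  have "Q A \<and> Q (space M - A)"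
    using A unfolding sets
  proof (induction rule: sigma_sets.induct)
    case (Basic U)
    then have U: "openin T U" by simp
    obtain C where C: "\<And>n. closedin T (C n)" "\<And>n. C n \<subseteq> C (Suc n)" "\<Union> (range C) = U"
      using open_imp_fsigma_in[OF met U] unfolding fsigma_in_ascending by metis
    have mono: "mono C" using C(2) by (simp add: incseq_SucI)
    have "Q U" unfolding Q_def
    proof (intro allI impI)
      fix e :: real assume "e > 0"
      then obtain N where "measure M ((\<Union>i. C i) - (\<Union>i<N. C i)) < e"
        using measure_diff_partial_union_small[of C e] closed_meas C(1) by auto
      moreover have "closedin T (\<Union>i<N. C i)" by (intro closedin_Union) (auto simp: C)
      ultimately show "\<exists>F. closedin T F \<and> F \<subseteq> U \<and> measure M (U - F) < e"
        using C(3) by (intro exI[of _ "\<Union>i<N. C i"]) auto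
    qed
    moreover have "Q (space M - U)" unfolding Q_def
      using U by (auto intro!: exI[of _ "space M - U"] simp: top[symmetric])
    ultimately show ?case by simp
  next
    case Empty
    have "Q {}" unfolding Q_def by (auto intro!: exI[of _ "{}"])
    moreover have "Q (space M)" unfolding Q_def
      by (auto intro!: exI[of _ "space M"] simp: top[symmetric])
    ultimately show ?case by simp
  next
    case (Compl a)
    moreover have "space M - (space M - a) = a"
      using Compl.hyps sigma_sets_into_sp[of "{U. openin T U}" "space M" a] openin_subset[of T] top by auto
    ultimately show ?case by simp
  next
    case (Union a)
    have am: "a i \<in> sets M" for i unfolding sets by (rule Union)
    have "Q (\<Union>i. a i)" unfolding Q_def
    proof (intro allI impI)
      fix e :: real assume e: "e > 0"
      \<comment> \<open>A countable union of closed sets need not be closed, so the union is cut off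
        first: half of \<open>e\<close> pays for the cut and half for the closed
        approximations.\<close>
      obtain N where N: "measure M ((\<Union>i. a i) - (\<Union>i<N. a i)) < e/2"
        using measure_diff_partial_union_small[of a "e/2"] am e by auto
      have "\<exists>F. closedin T F \<and> F \<subseteq> a i \<and> measure M (a i - F) < e/2 * (1/2) ^ Suc i" for i
      proof -
        have "0 < e/2 * (1/2) ^ Suc i" using e by simp
        then show ?thesis using Union.IH[of i] unfolding Q_def by blast
      qed
      then obtain F where F: "\<And>i. closedin T (F i)" "\<And>i. F i \<subseteq> a i"
          "\<And>i. measure M (a i - F i) < e/2 * (1/2) ^ Suc i" by metis
      have "measure M (\<Union>i. a i - F i) \<le> e/2"
        using am closed_meas F by (intro measure_UN_le_geometric) (auto intro: less_imp_le)
      moreover have "measure M ((\<Union>i. a i) - (\<Union>i<N. F i))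
          \<le> measure M (((\<Union>i. a i) - (\<Union>i<N. a i)) \<union> (\<Union>i. a i - F i))"
        using am closed_meas F by (intro finite_measure_mono) auto
      moreover have "\<dots> \<le> measure M ((\<Union>i. a i) - (\<Union>i<N. a i)) + measure M (\<Union>i. a i - F i)"
        using am closed_meas F by (intro measure_Un_le) auto
      moreover have "closedin T (\<Union>i<N. F i)" by (intro closedin_Union) (auto simp: F)
      ultimately show "\<exists>F. closedin T F \<and> F \<subseteq> (\<Union>i. a i) \<and> measure M ((\<Union>i. a i) - F) < e"
        using N F(2) by (intro exI[of _ "\<Union>i<N. F i"]) fastforce
    qed
    moreover have "Q (space M - (\<Union>i. a i))" unfolding Q_def
    proof (intro allI impI)
      fix e :: real assume e: "e > 0"
      have "\<exists>F. closedin T F \<and> F \<subseteq> space M - a i \<and>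
          measure M ((space M - a i) - F) < e/2 * (1/2) ^ Suc i" for i
      proof -
        have "0 < e/2 * (1/2) ^ Suc i" using e by simp
        then show ?thesis using Union.IH[of i] unfolding Q_def by blast
      qed
      then obtain F where F: "\<And>i. closedin T (F i)" "\<And>i. F i \<subseteq> space M - a i"
          "\<And>i. measure M ((space M - a i) - F i) < e/2 * (1/2) ^ Suc i" by metis
      have "measure M (\<Union>i. (space M - a i) - F i) \<le> e/2"
        using am closed_meas F by (intro measure_UN_le_geometric) (auto intro: less_imp_le)
      moreover have "measure M ((space M - (\<Union>i. a i)) - (\<Inter>i. F i))
          \<le> measure M (\<Union>i. (space M - a i) - F i)"
        using am closed_meas F by (intro finite_measure_mono) auto
      moreover have "closedin T (\<Inter>i. F i)" by (intro closedin_Inter) (auto simp: F)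
      ultimately show "\<exists>F. closedin T F \<and> F \<subseteq> space M - (\<Union>i. a i) \<and>
          measure M (space M - (\<Union>i. a i) - F) < e"
        using e F(2) by (intro exI[of _ "\<Inter>i. F i"]) fastforce
    qed
    ultimately show ?case by simp
  qed
  then show ?thesis using \<open>0 < e\<close> unfolding Q_def by blast
qed

text \<open>\<open>K\<close> is sequentially compact in a topology for which all traces of the sets \<open>B j\<close> on \<open>K\<close> are clopen.\<close>

definition clopen_compact :: "(nat \<Rightarrow> 'a set) \<Rightarrow> 'a set \<Rightarrow> bool" where
  "clopen_compact B K \<longleftrightarrow> (\<forall>s::nat \<Rightarrow> 'a. (\<forall>m. s m \<in> K) \<longrightarrow>
     (\<exists>x\<in>K. \<exists>r. strict_mono r \<and> (\<forall>j. \<forall>\<^sub>F i in sequentially. s (r i) \<in> B j \<longleftrightarrow> x \<in> B j)))"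

text \<open>Ulam's tightness argument combined with Lusin's: a closed totally bounded set is compact
  for a complete metric, and cutting it down to \<open>F j \<union> G j\<close>, closed subsets of
  \<open>B j\<close> and of its complement, makes the trace of \<open>B j\<close> clopen.\<close>

lemma lusin_compact:
  fixes B :: "nat \<Rightarrow> 'a set"
  assumes sb: "standard_borel_space M" and fin: "finite_measure M"
    and B: "\<And>j. B j \<in> sets M" and A: "A \<in> sets M" and e: "0 < e"
  obtains K where "K \<in> sets M" "K \<subseteq> A" "measure M (A - K) < e" "clopen_compact B K"
proof -
  interpret finite_measure M by fact
  obtain T where T: "topspace T = space M" "completely_metrizable_space T" "separable_space T"
      "sets M = sigma_sets (space M) {U. openin T U}"
    using sb unfolding standard_borel_space_def by blast
  obtain X d where X: "Metric_space X d" "Metric_space.mcomplete X d" "T = Metric_space.mtopology X d"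
    using T(2) unfolding completely_metrizable_space_def by blast
  interpret Metric_space X d by fact
  have XM: "X = space M" using T(1) X(3) by simp
  have met: "metrizable_space T" using X(3) metrizable_space_mtopology by simp
  have closed_meas: "F \<in> sets M" if "closedin T F" for F
  proof -
    have "space M - F \<in> sets M"
      using that unfolding T(4) by (auto simp: closedin_def T(1))
    then have "space M - (space M - F) \<in> sets M" by (rule sets.compl_sets)
    then show ?thesis using that
      by (metis closedin_subset double_diff order_refl T(1))
  qed
  obtain Q where Q: "countable Q" "Q \<subseteq> space M" "T closure_of Q = space M"
    using T(3) unfolding separable_space_def T(1) by blast
  show thesis
  proof (cases "space M = {}")
    case True
    then have "A = {}" using A sets.sets_into_space by blast
    then show ?thesis using e by (intro that[of "{}"]) (auto simp: clopen_compact_def)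
  next
    case False
    then have Qne: "Q \<noteq> {}" using Q(3) by (metis closure_of_empty)
    define q where "q = from_nat_into Q"
    have rq: "range q = Q" using Qne Q(1) by (simp add: q_def)
    \<comment> \<open>Four losses: the approximation of \<open>A\<close>, total boundedness, and the
      approximations of the sets \<open>B j\<close> and of their complements.\<close>
    define e' where "e' = e/4"
    have e': "e' > 0" using e by (simp add: e'_def)
        have balls: "(\<Union>i. mcball (q i) (1 / Suc m)) = space M" for m
    proof -
      have "x \<in> (\<Union>i. mcball (q i) (1 / Suc m))" if "x \<in> space M" for x
      proof -
        have "x \<in> T closure_of Q" using that Q(3) by simp
        then have "\<exists>y\<in>Q. y \<in> mball x (1 / Suc m)"
          using X(3) metric_closure_of by (auto simp: )
        then obtain i where "q i \<in> mball x (1 / Suc m)" using rq by (metis imageE)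
        then show ?thesis
          by (intro UN_I[of i]) (auto simp: in_mball in_mcball commute)
      qed
      then show ?thesis using XM mcball_subset_mspace by blast
    qed
    have "\<exists>N. measure M (space M - (\<Union>i<N. mcball (q i) (1 / Suc m))) < e' * (1/2) ^ Suc m" for m
      unfolding balls[of m, symmetric]
      using e' X(3) closed_meas by (intro measure_diff_partial_union_small) auto
    then obtain N where N: "\<And>m. measure M (space M - (\<Union>i<N m. mcball (q i) (1 / Suc m)))
        < e' * (1/2) ^ Suc m" by metis
    have reg: "\<exists>F. closedin T F \<and> F \<subseteq> A \<and> measure M (A - F) < e" if "A \<in> sets M" "e > 0" for A e
      using closed_inner_regular[OF T(4) T(1) met that] .
    obtain F0 where F0: "closedin T F0" "F0 \<subseteq> A" "measure M (A - F0) < e'"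
      using reg[OF A e'] by blast
    have pos: "0 < e' * (1/2) ^ Suc j" for j :: nat using e' by simp
    have "\<exists>F. closedin T F \<and> F \<subseteq> B j \<and> measure M (B j - F) < e' * (1/2) ^ Suc j" for j
      by (rule reg[OF B pos])
    then obtain F where F: "\<And>j. closedin T (F j)" "\<And>j. F j \<subseteq> B j"
        "\<And>j. measure M (B j - F j) < e' * (1/2) ^ Suc j" by metis
    have "\<exists>F. closedin T F \<and> F \<subseteq> space M - B j \<and> measure M ((space M - B j) - F) < e' * (1/2) ^ Suc j" for j
      by (rule reg[OF _ pos]) (use B in simp)
    then obtain G where G: "\<And>j. closedin T (G j)" "\<And>j. G j \<subseteq> space M - B j"
        "\<And>j. measure M ((space M - B j) - G j) < e' * (1/2) ^ Suc j" by metis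
    define L where "L m = (\<Union>i<N m. mcball (q i) (1 / Suc m))" for m
    have L: "closedin T (L m)" for m
      unfolding L_def using X(3) by (intro closedin_Union) auto
    have NL: "measure M (space M - L m) \<le> e' * (1/2) ^ Suc m" for m
      unfolding L_def by (rule less_imp_le[OF N])
    define K where "K = F0 \<inter> (\<Inter>m. L m) \<inter> (\<Inter>j. F j \<union> G j)"
    have Kc: "closedin T K"
      unfolding K_def using F0 L F G by (intro closedin_Int closedin_Inter closedin_Un) auto
    have KX: "K \<subseteq> X" using closedin_subset[OF Kc] T(1) XM by simp
    have "measure M (A - K) \<le> measure M ((A - F0) \<union> (\<Union>m. space M - L m) \<union> (\<Union>j. B j - F j)
            \<union> (\<Union>j. (space M - B j) - G j))"
      using A B F0 L F G closed_meas sets.sets_into_space[OF A]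
      by (intro finite_measure_mono) (auto simp: K_def)
    also have "\<dots> \<le> measure M (A - F0) + measure M (\<Union>m. space M - L m) + measure M (\<Union>j. B j - F j)
            + measure M (\<Union>j. (space M - B j) - G j)"
      using A B F0 L F G closed_meas
      by (intro order_trans[OF measure_Un_le] add_mono order_refl) auto
    also have "\<dots> < e' + e' + e' + e'"
      using A B L F(1) G(1) closed_meas NL less_imp_le[OF F(3)] less_imp_le[OF G(3)]
      by (intro add_less_le_mono F0(3) measure_UN_le_geometric) auto
    finally have small: "measure M (A - K) < e" by (simp add: e'_def)
    have seq: "\<exists>x\<in>K. \<exists>r. strict_mono r \<and> (\<forall>j. \<forall>\<^sub>F i in sequentially. s (r i) \<in> B j \<longleftrightarrow> x \<in> B j)"
      if s: "\<And>m::nat. s m \<in> K" for s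
    proof -
      have "mtotally_bounded K" unfolding mtotally_bounded_def
      proof (intro allI impI)
        fix r :: real assume "r > 0"
        then obtain m where m: "1 / Suc m < r / 2" using nat_approx_posE by (metis half_gt_zero)
        define I where "I = {i. i < N m \<and> K \<inter> mcball (q i) (1 / Suc m) \<noteq> {}}"
        have "\<forall>i\<in>I. \<exists>y. y \<in> K \<inter> mcball (q i) (1 / Suc m)" by (auto simp: I_def)
        then obtain y where y: "\<And>i. i \<in> I \<Longrightarrow> y i \<in> K \<inter> mcball (q i) (1 / Suc m)" by metis
        have "K \<subseteq> (\<Union>x\<in>y ` I. mball x r)"
        proof
          fix x assume x: "x \<in> K"
          then have "x \<in> L m" by (auto simp: K_def)
          then obtain i where i: "i < N m" "x \<in> mcball (q i) (1 / Suc m)" by (auto simp: L_def)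
          then have iI: "i \<in> I" using x by (auto simp: I_def)
          have "d (y i) x \<le> d (y i) (q i) + d (q i) x"
            using y[OF iI] i(2) in_mcball by (intro triangle) blast+
          also have "\<dots> < r" using y[OF iI] i(2) m by (auto simp: in_mcball commute)
          finally have "x \<in> mball (y i) r" using y[OF iI] i(2) by (auto simp: in_mcball in_mball)
          then show "x \<in> (\<Union>x\<in>y ` I. mball x r)" using iI by blast
        qed
        moreover have "finite (y ` I)" "y ` I \<subseteq> K" using y by (auto simp: I_def)
        ultimately show "\<exists>C. finite C \<and> C \<subseteq> K \<and> K \<subseteq> (\<Union>x\<in>C. mball x r)" by blast
      qed
      then obtain r where r: "strict_mono r" "MCauchy (s \<circ> r)"
        using s unfolding mtotally_bounded_sequentially by blast
      then obtain x where x: "limitin T (s \<circ> r) x sequentially"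
        using X(2,3) unfolding mcomplete_def by blast
      have xK: "x \<in> K"
        using limitin_closedin[OF x Kc] s by auto
      \<comment> \<open>A closed set that misses the limit is eventually missed by the sequence.
        Applied to \<open>F j\<close> or \<open>G j\<close>, this decides membership in
        \<open>B j\<close>.\<close>
      have avoid: "\<forall>\<^sub>F i in sequentially. s (r i) \<notin> H" if H: "closedin T H" "x \<notin> H" for H
      proof -
        have "openin T (topspace T - H)" using H(1) by auto
        moreover have "x \<in> topspace T - H" using H(2) xK KX XM T(1) by auto
        ultimately have "\<forall>\<^sub>F i in sequentially. (s \<circ> r) i \<in> topspace T - H"
          using x unfolding limitin_def by blast
        then show ?thesis by (rule eventually_mono) auto
      qed
      have sFG: "s i \<in> F j \<or> s i \<in> G j" "x \<in> F j \<or> x \<in> G j" for i j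
        using s[of i] xK unfolding K_def by blast+
      have "\<forall>\<^sub>F i in sequentially. s (r i) \<in> B j \<longleftrightarrow> x \<in> B j" for j
      proof (cases "x \<in> B j")
        case True
        then have "x \<notin> G j" using G(2) by auto
        from avoid[OF G(1) this] show ?thesis
          by (rule eventually_mono) (use True sFG F(2) in blast)
      next
        case False
        then have "x \<notin> F j" using F(2) by auto
        from avoid[OF F(1) this] show ?thesis
          by (rule eventually_mono) (use False sFG G(2) in blast)
      qed
      then show ?thesis using xK r(1) by blast
    qed
    then have "clopen_compact B K" unfolding clopen_compact_def by blast
    then show ?thesis
      by (intro that[OF closed_meas[OF Kc] _ small]) (use F0(2) in \<open>auto simp: K_def\<close>)
  qed
qed

lemma standard_borel_separating:
  assumes "standard_borel_space M"
  obtains C :: "nat \<Rightarrow> 'a set" where "\<And>k. C k \<in> sets M"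
    "\<And>x y. \<lbrakk>x \<in> space M; y \<in> space M; \<And>k. x \<in> C k \<longleftrightarrow> y \<in> C k\<rbrakk> \<Longrightarrow> x = y"
proof -
  obtain T where T: "topspace T = space M" "completely_metrizable_space T" "separable_space T"
      "sets M = sigma_sets (space M) {U. openin T U}"
    using assms unfolding standard_borel_space_def by blast
  obtain X d where X: "Metric_space X d" "T = Metric_space.mtopology X d"
    using T(2) unfolding completely_metrizable_space_def by blast
  interpret Metric_space X d by fact
  have XM: "X = space M" using T(1) X(2) by simp
  obtain Q where Q: "countable Q" "Q \<subseteq> space M" "T closure_of Q = space M"
    using T(3) unfolding separable_space_def T(1) by blast
  show thesis
  proof (cases "space M = {}")
    case True
    then show ?thesis by (intro that[of "\<lambda>_. {}"]) auto
  next
    case False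
    then have Qne: "Q \<noteq> {}" using Q(3) by (metis closure_of_empty)
    define q where "q = from_nat_into Q"
    have rq: "range q = Q" using Qne Q(1) by (simp add: q_def)
    define C where "C k = (case prod_decode k of (i, m) \<Rightarrow> mball (q i) (1 / Suc m))" for k
    show ?thesis
    proof (rule that[of C])
      show "C k \<in> sets M" for k
        unfolding T(4) C_def using X(2) by (auto split: prod.split)
      fix x y assume xy: "x \<in> space M" "y \<in> space M" "\<And>k. x \<in> C k \<longleftrightarrow> y \<in> C k"
      show "x = y"
      proof (rule ccontr)
        assume "x \<noteq> y"
        then have "d x y > 0" using xy XM by simp
        then obtain m where m: "1 / Suc m < d x y / 2" using nat_approx_posE by (metis half_gt_zero)
        have "x \<in> T closure_of Q" using xy Q(3) by simp
        then have "\<exists>y\<in>Q. y \<in> mball x (1 / Suc m)"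
          using X(2) metric_closure_of by auto
        then obtain i where i: "q i \<in> mball x (1 / Suc m)" using rq by (metis imageE)
        then have "x \<in> C (prod_encode (i, m))" by (auto simp: C_def in_mball commute)
        then have "y \<in> C (prod_encode (i, m))" using xy(3) by blast
        then have "d (q i) y < 1 / Suc m" by (auto simp: C_def in_mball)
        moreover have "d x (q i) < 1 / Suc m" using i by (auto simp: in_mball)
        moreover have "d x y \<le> d x (q i) + d (q i) y"
          using xy XM i in_mball by (intro triangle) blast+
        ultimately show False using m by linarith
      qed
    qed
  qed
qed

section \<open>Countable-to-one maps are injective up to a countable partition\<close>

text \<open>Meaningful for symmetric \<open>R\<close> only: otherwise these sets do not form a \<open>\<sigma>\<close>-algebra.\<close>

definition saturated_sets :: "'a measure \<Rightarrow> ('a \<Rightarrow> 'a \<Rightarrow> bool) \<Rightarrow> 'a measure" where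
  "saturated_sets M R = sigma (space M) {A \<in> sets M. \<forall>x\<in>A. \<forall>y\<in>space M. R x y \<longrightarrow> y \<in> A}"

lemma space_saturated_sets [simp]: "space (saturated_sets M R) = space M"
  unfolding saturated_sets_def using sets.sets_into_space by (intro space_measure_of) auto

lemma sets_saturated_sets:
  assumes "symp_on (space M) R"
  shows "sets (saturated_sets M R) = {A \<in> sets M. \<forall>x\<in>A. \<forall>y\<in>space M. R x y \<longrightarrow> y \<in> A}"
    (is "_ = ?S")
proof -
  have "sigma_algebra (space M) ?S"
  unfolding sigma_algebra_iff2
  proof (intro conjI ballI allI impI)
    show "?S \<subseteq> Pow (space M)" using sets.sets_into_space by auto
    show "\<And>A. A \<in> ?S \<Longrightarrow> space M - A \<in> ?S" using symp_onD[OF assms] by auto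
    show "\<And>A. range A \<subseteq> ?S \<Longrightarrow> (\<Union>i::nat. A i) \<in> ?S" by blast
  qed auto
  then show ?thesis
    unfolding saturated_sets_def by (simp add: sigma_algebra.sets_measure_of_eq)
qed

lemma subalgebra_saturated_sets:
  assumes "symp_on (space M) R"
  shows "subalgebra M (saturated_sets M R)"
  unfolding subalgebra_def using assms by (auto simp: sets_saturated_sets)

text \<open>The preimage of the singleton of \<open>u x\<close> is a saturated set containing
  \<open>x\<close>.\<close>

lemma measurable_saturated_sets_const:
  fixes u :: "'a \<Rightarrow> real"
  assumes "symp_on (space M) R"
    and u: "u \<in> borel_measurable (saturated_sets M R)"
    and xy: "x \<in> space M" "y \<in> space M" "R x y"
  shows "u y = u x"
proof -
  have "u -` {u x} \<inter> space M \<in> sets (saturated_sets M R)"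
    using measurable_sets[OF u, of "{u x}"] by simp
  then have "\<forall>x'\<in>u -` {u x} \<inter> space M. \<forall>y'\<in>space M. R x' y' \<longrightarrow> y' \<in> u -` {u x} \<inter> space M"
    unfolding sets_saturated_sets[OF assms(1)] by blast
  then have "y \<in> u -` {u x} \<inter> space M" using xy by (metis IntI singletonI vimageI)
  then show ?thesis by simp
qed

text \<open>No disintegration is formed: the conditional measures on the fibres are seen only
  through the conditional expectations \<open>g l\<close> of countably many cylinders, whose
  relations hold together at almost every point. Almost everywhere \<open>\<rho> k x\<close>
  decreases in \<open>k\<close> to the mass of the atom at \<open>x\<close>. Once this is positive,
  the points of a fibre can be named by cylinders that isolate them.\<close>

lemma index_injective:
  fixes a :: "nat \<Rightarrow> 'a \<Rightarrow> nat"
  assumes ps: "prob_space M" and sb: "standard_borel_space M"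
    and a [measurable]: "\<And>n. a n \<in> measurable M (count_space UNIV)"
    and refine: "\<And>n x y. a (Suc n) x = a (Suc n) y \<Longrightarrow> a n x = a n y"
    and X0: "AE x in M. x \<in> X0"
    and fibres: "\<And>x. x \<in> X0 \<Longrightarrow> countable {y \<in> X0. \<forall>n. a n y = a n x}"
  obtains i :: "'a \<Rightarrow> nat" and X1 where "i \<in> measurable M (count_space UNIV)"
    "AE x in M. x \<in> X1"
    "\<And>x y. \<lbrakk>x \<in> X1; y \<in> X1; \<And>n. a n x = a n y; i x = i y\<rbrakk> \<Longrightarrow> x = y"
proof -
  interpret prob_space M by fact
  obtain C :: "nat \<Rightarrow> 'a set" where C [measurable]: "\<And>k. C k \<in> sets M"
    and Csep: "\<And>x y. \<lbrakk>x \<in> space M; y \<in> space M; \<And>k. x \<in> C k \<longleftrightarrow> y \<in> C k\<rbrakk> \<Longrightarrow> x = y"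
    using standard_borel_separating[OF sb] by blast
  obtain X0' where X0': "X0' \<in> sets M" "X0' \<subseteq> X0" "AE x in M. x \<in> X0'"
  proof -
    obtain N where "N \<in> null_sets M" "{x \<in> space M. x \<notin> X0} \<subseteq> N" using X0 by (auto elim!: AE_E simp: null_sets_def)
    then show ?thesis
      using AE_not_in[of N M] by (intro that[of "space M - N"]) auto
  qed
  have refine': "a n x = a n y" if "a m x = a m y" "n \<le> m" for n m x y
    using that(2,1) by (induction rule: dec_induct) (auto dest: refine)
  define R where "R x y \<longleftrightarrow> (\<forall>n. a n x = a n y)" for x y
  have Rsym: "symp_on (space M) R" by (auto simp: R_def intro: symp_onI)
  define F where "F = saturated_sets M R"
  interpret finite_measure_subalgebra M F
    by unfold_locales (simp add: F_def subalgebra_saturated_sets[OF Rsym])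
  have F_const: "u y = u x" if "u \<in> borel_measurable F" "x \<in> space M" "y \<in> space M" "R x y"
    for u :: "'a \<Rightarrow> real" and x y
    using measurable_saturated_sets_const[OF Rsym] that unfolding F_def by blast
  \<comment> \<open>Membership pattern for the first \<open>k\<close> separating sets. There are
    countably many patterns, and their cylinders shrink to points as the length grows.\<close>
  define pat where "pat k x = map (\<lambda>j. x \<in> C j) [0..<k]" for k x
  have pat_len [simp]: "length (pat k x) = k" for k x by (simp add: pat_def)
  have pat_meas [measurable]: "pat k \<in> measurable M (count_space UNIV)" for k
  proof (induction k)
    case 0 then show ?case by (simp add: pat_def)
  next
    case (Suc k)
    note Suc [measurable]
    have "(\<lambda>x. (\<lambda>l b. l @ [b]) (pat k x) (x \<in> C k)) \<in> measurable M (count_space UNIV)"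
      by measurable
    then show ?case by (simp add: pat_def)
  qed
  define cyl where "cyl l = {y \<in> space M. pat (length l) y = l}" for l
  have cyl_meas [measurable]: "cyl l \<in> sets M" for l
    unfolding cyl_def by measurable
  define g where "g l = real_cond_exp M F (indicator (cyl l))" for l
  have g_F: "g l \<in> borel_measurable F" for l unfolding g_def by simp
  have g_M [measurable]: "g l \<in> borel_measurable M" for l unfolding g_def by simp
  have int_ind: "integrable M (indicator S :: 'a \<Rightarrow> real)" if "S \<in> sets M" for S
    using that emeasure_finite[of S] by (intro integrable_real_indicator) (auto simp: less_top[symmetric])
  define \<rho> where "\<rho> k x = g (pat k x) x" for k x
  have \<rho>_meas [measurable]: "\<rho> k \<in> borel_measurable M" for k
    unfolding \<rho>_def[abs_def] by (rule measurable_compose_countable[OF g_M pat_meas])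
  have AE_pos: "AE x in M. \<forall>l. 0 \<le> g l x"
    unfolding AE_all_countable g_def by (intro allI real_cond_exp_pos) auto
  have AE_mono: "AE x in M. \<forall>l l'. cyl l \<subseteq> cyl l' \<longrightarrow> g l x \<le> g l' x"
  proof -
    have "AE x in M. cyl l \<subseteq> cyl l' \<longrightarrow> g l x \<le> g l' x" for l l'
    proof (cases "cyl l \<subseteq> cyl l'")
      case True
      then show ?thesis unfolding g_def
        using real_cond_exp_mono[of "indicator (cyl l)" "indicator (cyl l')"] int_ind
        by (auto simp: indicator_def subset_iff)
    qed simp
    then show ?thesis by (simp add: AE_all_countable)
  qed
  have AE_add: "AE x in M. \<forall>l l1 l2. cyl l1 \<subseteq> cyl l \<and> cyl l2 \<subseteq> cyl l \<and> cyl l1 \<inter> cyl l2 = {} \<longrightarrow>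
      g l1 x + g l2 x \<le> g l x"
  proof -
    have "AE x in M. cyl l1 \<subseteq> cyl l \<and> cyl l2 \<subseteq> cyl l \<and> cyl l1 \<inter> cyl l2 = {} \<longrightarrow>
      g l1 x + g l2 x \<le> g l x" for l l1 l2
    proof (cases "cyl l1 \<subseteq> cyl l \<and> cyl l2 \<subseteq> cyl l \<and> cyl l1 \<inter> cyl l2 = {}")
      case True
      have "AE x in M. real_cond_exp M F (\<lambda>x. indicator (cyl l1) x + indicator (cyl l2) x) x \<le> g l x"
        unfolding g_def using True
        by (intro real_cond_exp_mono AE_I2 Bochner_Integration.integrable_add int_ind cyl_meas)
           (auto simp: indicator_def)
      moreover have "AE x in M. real_cond_exp M F (\<lambda>x. indicator (cyl l1) x + indicator (cyl l2) x) x
          = g l1 x + g l2 x"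
        unfolding g_def by (rule real_cond_exp_add[OF int_ind[OF cyl_meas] int_ind[OF cyl_meas]])
      ultimately show ?thesis by auto
    qed auto
    then show ?thesis by (simp add: AE_all_countable)
  qed
  have cyl_mono: "cyl (pat k x) \<subseteq> cyl (pat k' x)" if "k' \<le> k" for k k' x
    using that by (auto simp: cyl_def pat_def)
  text \<open>
    If the atom at \<open>x\<close> of the conditional measure vanished for many \<open>x\<close>, then a countable fibre in a compact
    set would be covered by finitely many cylinders of small conditional measure.
  \<close>
  have AE_atom: "AE x in M. \<exists>e>0. \<forall>k. e \<le> \<rho> k x"
  proof (rule ccontr)
    assume not: "\<not> ?thesis"
    define N where "N = {x \<in> X0'. \<forall>j. \<exists>k. \<rho> k x < 1 / Suc j}"
    have N_meas: "N \<in> sets M" 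
    proof -
      have "N = X0' \<inter> {x \<in> space M. \<forall>j. \<exists>k. \<rho> k x < 1 / Suc j}"
        using sets.sets_into_space[OF X0'(1)] by (auto simp: N_def)
      also have "\<dots> \<in> sets M" using X0'(1) by measurable
      finally show ?thesis .
    qed
    have "measure M N > 0"
    proof (rule ccontr)
      assume "\<not> measure M N > 0"
      then have "N \<in> null_sets M" using N_meas by (auto simp: null_sets_def emeasure_eq_measure zero_less_measure_iff)
      then have "AE x in M. x \<notin> N" by (rule AE_not_in)
      with X0'(3) have "AE x in M. \<exists>e>0. \<forall>k. e \<le> \<rho> k x"
      proof eventually_elim
        case (elim x)
        then obtain j where "\<And>k. \<not> \<rho> k x < 1 / Suc j" by (auto simp: N_def)
        then show ?case by (intro exI[of _ "1 / Suc j"]) (auto simp: not_less)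
      qed
      then show False using not by simp
    qed
    \<comment> \<open>Compactness is wanted for the separating sets and for the classes of the
      codes: a limit in \<open>K\<close> then lies in the right fibre and eventually shares every
      finite pattern with the sequence.\<close>
    define \<B> where "\<B> = range C \<union> (\<lambda>(n, m). {y \<in> space M. a n y = m}) ` UNIV"
    define B where "B = from_nat_into \<B>"
    have rB: "range B = \<B>" unfolding B_def by (intro range_from_nat_into) (auto simp: \<B>_def)
    have B_meas: "B j \<in> sets M" for j
    proof -
      have "B j \<in> \<B>" using rB by blast
      then show ?thesis by (auto simp: \<B>_def)
    qed
    obtain K where K: "K \<in> sets M" "K \<subseteq> N" "measure M (N - K) < measure M N"
      and Kc: "clopen_compact B K"
      by (rule lusin_compact[where B = B, OF sb finite_measure_axioms B_meas N_meas \<open>measure M N > 0\<close>])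
    have Kpos: "measure M K > 0"
      using K finite_measure_Diff[OF N_meas K(1,2)] by simp
    have [measurable]: "K \<in> sets M" by (rule K)
    define gK where "gK = real_cond_exp M F (indicator K)"
    have gK_M [measurable]: "gK \<in> borel_measurable M" unfolding gK_def by simp
    \<comment> \<open>The set where \<open>gK\<close> is at most 0 belongs to \<open>F\<close>, so
      integrating over it bounds the measure of its intersection with \<open>K\<close> by 0.\<close>
    have AE_gK: "AE x in M. x \<in> K \<longrightarrow> gK x > 0"
    proof -
      define Z where "Z = {x \<in> space F. gK x \<le> 0}"
      have ZF: "Z \<in> sets F" unfolding Z_def gK_def by measurable
      have ZM [measurable]: "Z \<in> sets M" using ZF subalg by (auto simp: subalgebra_def)
      have "measure M (K \<inter> Z) = (\<integral>x\<in>Z. indicator K x \<partial>M)"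
        unfolding set_lebesgue_integral_def by (simp add: indicator_inter_arith[symmetric] Int_commute)
      also have "\<dots> = (\<integral>x\<in>Z. gK x \<partial>M)"
        unfolding gK_def using int_ind[OF K(1)] ZF by (rule real_cond_exp_intA)
      also have "\<dots> \<le> 0"
        unfolding set_lebesgue_integral_def
        using Bochner_Integration.integral_nonneg[of M "\<lambda>x. - (indicator Z x *\<^sub>R gK x)"]
        by (simp add: Z_def indicator_def)
      finally have "measure M (K \<inter> Z) = 0" by (simp add: measure_le_0_iff)
      then have "K \<inter> Z \<in> null_sets M" by (simp add: null_sets_def emeasure_eq_measure)
      from AE_not_in[OF this] show ?thesis
        using AE_space by eventually_elim (use subalg in \<open>simp add: Z_def subalgebra_def not_le\<close>)
    qed
    \<comment> \<open>Finite subadditivity of the conditional measure, localised: a class of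
      \<open>a n\<close> belongs to \<open>F\<close>, so only the part of \<open>K\<close> inside
      the class of \<open>x\<close> has to be covered. Finite lists keep the family of covers
      countable.\<close>
    define cov where "cov x \<longleftrightarrow> (\<forall>n m (L::bool list list). a n x = m \<and>
        K \<inter> {y \<in> space M. a n y = m} \<subseteq> (\<Union>l\<in>set L. cyl l) \<longrightarrow> gK x \<le> (\<Sum>l\<in>set L. g l x))" for x
    have AE_cover: "AE x in M. cov x"
    proof -
      have "AE x in M. a n x = m \<and>
        K \<inter> {y \<in> space M. a n y = m} \<subseteq> (\<Union>l\<in>set L. cyl l) \<longrightarrow> gK x \<le> (\<Sum>l\<in>set L. g l x)"
        for n m and L :: "bool list list"
      proof (cases "K \<inter> {y \<in> space M. a n y = m} \<subseteq> (\<Union>l\<in>set L. cyl l)")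
        case True
        define S where "S = {y \<in> space M. a n y = m}"
        have S [measurable]: "S \<in> sets M" unfolding S_def by measurable
        have SF [measurable]: "S \<in> sets F"
          using S unfolding F_def sets_saturated_sets[OF Rsym] by (auto simp: S_def R_def)
        have "indicator S x * indicator K x \<le> (\<Sum>l\<in>set L. indicator (cyl l) x :: real)" for x
        proof (cases "x \<in> K \<inter> S")
          case True
          then obtain l where "l \<in> set L" "x \<in> cyl l"
            using \<open>K \<inter> _ \<subseteq> _\<close> by (auto simp: S_def)
          then have "indicator (cyl l) x \<le> (\<Sum>l\<in>set L. indicator (cyl l) x :: real)"
            by (intro member_le_sum) auto
          then show ?thesis using True \<open>x \<in> cyl l\<close> by simp
        qed (auto simp: sum_nonneg)
        then have "AE x in M. real_cond_exp M F (\<lambda>x. indicator S x * indicator K x) x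
            \<le> real_cond_exp M F (\<lambda>x. \<Sum>l\<in>set L. indicator (cyl l) x) x"
          using int_ind by (intro real_cond_exp_mono) (auto simp: indicator_inter_arith[symmetric])
        moreover have "AE x in M. real_cond_exp M F (\<lambda>x. \<Sum>l\<in>set L. indicator (cyl l) x) x
            = (\<Sum>l\<in>set L. g l x)"
          unfolding g_def using int_ind by (intro real_cond_exp_sum) auto
        moreover have "AE x in M. real_cond_exp M F (\<lambda>x. indicator S x * indicator K x) x
            = indicator S x * gK x"
          unfolding gK_def using int_ind
          by (intro real_cond_exp_mult) (auto simp: indicator_inter_arith[symmetric])
        ultimately show ?thesis using AE_space
          by eventually_elim (auto simp: S_def)
      qed auto
      then show ?thesis unfolding cov_def AE_all_countable by blast
    qed
    have "\<exists>x. x \<in> K \<and> gK x > 0 \<and> (\<forall>l. 0 \<le> g l x) \<and> cov x"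
    proof (rule ccontr)
      assume no: "\<not> ?thesis"
      have "AE x in M. x \<notin> K"
        using AE_gK AE_pos AE_cover by eventually_elim (use no in blast)
      then have "K \<in> null_sets M" using K(1) by (simp add: AE_iff_null_sets)
      then show False using Kpos by (simp add: null_sets_def measure_def)
    qed
    then obtain x where x: "x \<in> K" "gK x > 0" "\<And>l. 0 \<le> g l x" and "cov x" by blast
    have cover: "gK x \<le> (\<Sum>l\<in>set L. g l x)"
      if "K \<inter> {y \<in> space M. a n y = a n x} \<subseteq> (\<Union>l\<in>set L. cyl l)" for n L
      using \<open>cov x\<close> that unfolding cov_def by blast
    have KM: "K \<subseteq> space M" using K(1) by (rule sets.sets_into_space)
    have KX0: "K \<subseteq> X0" using K(2) X0'(2) by (auto simp: N_def)
    define Fx where "Fx = {y \<in> K. \<forall>n. a n y = a n x}"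
    have "countable Fx"
      by (rule countable_subset[OF _ fibres[of x]]) (use x(1) KX0 in \<open>auto simp: Fx_def\<close>)
    moreover have "Fx \<noteq> {}" using x(1) by (auto simp: Fx_def)
    ultimately have xs: "range (from_nat_into Fx) = Fx" by simp
    define xs where "xs = from_nat_into Fx"
    note xs = xs[folded xs_def]
    \<comment> \<open>Points of \<open>N\<close> have cylinders of arbitrarily small conditional
      measure. The geometric budget keeps the total of any finitely many of them below
      \<open>gK x\<close>.\<close>
    have "\<exists>k. \<rho> k (xs j) < gK x * (1/2) ^ Suc j" for j
    proof -
      have "xs j \<in> N" using xs K(2) by (auto simp: Fx_def)
      moreover obtain i where "1 / Suc i < gK x * (1/2) ^ Suc j"
        using nat_approx_posE[of "gK x * (1/2) ^ Suc j"] x(2) by auto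
      ultimately show ?thesis unfolding N_def by (smt (verit) mem_Collect_eq)
    qed
    then obtain k where k: "\<And>j. \<rho> (k j) (xs j) < gK x * (1/2) ^ Suc j" by metis
    define l where "l j = pat (k j) (xs j)" for j
    have xsK: "xs j \<in> K" "R x (xs j)" for j
    proof -
      have "xs j \<in> Fx" using xs by blast
      then show "xs j \<in> K" "R x (xs j)" by (simp_all add: Fx_def R_def)
    qed
    have gl: "g (l j) x < gK x * (1/2) ^ Suc j" for j
    proof -
      have "g (l j) (xs j) = g (l j) x"
        using KM x(1) xsK by (intro F_const[OF g_F]) auto
      then show ?thesis using k[of j] by (simp add: \<rho>_def l_def)
    qed
    \<comment> \<open>Otherwise points \<open>s m\<close> of \<open>K\<close>, in the class of
      \<open>x\<close> for \<open>a m\<close>, escape the first \<open>m\<close> cylinders. Their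
      limit lies in the fibre of \<open>x\<close>, hence is some \<open>xs j\<close>, and the
      cylinder of \<open>xs j\<close> eventually catches them.\<close>
    have "\<exists>m. K \<inter> {y \<in> space M. a m y = a m x} \<subseteq> (\<Union>j<m. cyl (l j))"
    proof (rule ccontr)
      assume "\<not> ?thesis"
      then have "\<forall>m. \<exists>y. y \<in> K \<and> a m y = a m x \<and> (\<forall>j<m. y \<notin> cyl (l j))" by blast
      then obtain s where s: "\<And>m. s m \<in> K" "\<And>m. a m (s m) = a m x"
          "\<And>m j. j < m \<Longrightarrow> s m \<notin> cyl (l j)"
        by metis
      obtain z r where z: "z \<in> K" "strict_mono r"
        "\<And>j. \<forall>\<^sub>F i in sequentially. s (r i) \<in> B j \<longleftrightarrow> z \<in> B j"
        using Kc s(1) unfolding clopen_compact_def by metis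
      have zB: "\<forall>\<^sub>F i in sequentially. s (r i) \<in> H \<longleftrightarrow> z \<in> H" if "H \<in> \<B>" for H
        using z(3) that rB by (metis imageE)
      have large: "\<forall>\<^sub>F i in sequentially. n \<le> r i" for n
        using filterlim_subseq[OF z(2)] by (simp add: filterlim_at_top)
      have "a n z = a n x" for n
      proof -
        have "{y \<in> space M. a n y = a n x} \<in> \<B>" by (auto simp: \<B>_def)
        from zB[OF this] large[of n] have "\<forall>\<^sub>F i in sequentially. a n z = a n x"
        proof eventually_elim
          case (elim i)
          moreover have "a n (s (r i)) = a n x" using refine'[OF s(2) elim(2)] .
          ultimately show ?case using s(1)[of "r i"] KM by auto
        qed
        then show ?thesis by simp
      qed
      then have "z \<in> range xs" using z(1) unfolding xs by (simp add: Fx_def)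
      then obtain j where j: "z = xs j" by blast
      have "\<forall>\<^sub>F i in sequentially. \<forall>h<k j. s (r i) \<in> C h \<longleftrightarrow> z \<in> C h"
      proof -
        have "\<forall>\<^sub>F i in sequentially. \<forall>h\<in>{..<k j}. s (r i) \<in> C h \<longleftrightarrow> z \<in> C h"
          by (intro eventually_ball_finite ballI zB) (auto simp: \<B>_def)
        then show ?thesis by (rule eventually_mono) simp
      qed
      with large[of "Suc j"] have "\<forall>\<^sub>F i in sequentially. False"
      proof eventually_elim
        case (elim i)
        have "s (r i) \<in> space M" using s(1) KM by blast
        moreover have "pat (k j) (s (r i)) = pat (k j) (xs j)"
          using elim(2) unfolding pat_def j by (intro map_cong) auto
        ultimately have "s (r i) \<in> cyl (l j)" unfolding cyl_def l_def by simp
        then show False using s(3)[of j "r i"] elim(1) by simp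
      qed
      then show False by simp
    qed
    then obtain m where "K \<inter> {y \<in> space M. a m y = a m x} \<subseteq> (\<Union>j<m. cyl (l j))" ..
    then have "K \<inter> {y \<in> space M. a m y = a m x} \<subseteq> (\<Union>c\<in>set (map l [0..<m]). cyl c)"
      by (simp add: atLeast0LessThan)
    then have "gK x \<le> (\<Sum>c\<in>set (map l [0..<m]). g c x)" by (rule cover)
    also have "\<dots> = (\<Sum>c\<in>l ` {..<m}. g c x)" by (simp add: atLeast0LessThan)
    also have "\<dots> \<le> (\<Sum>j<m. ((\<lambda>c. g c x) \<circ> l) j)"
      by (intro sum_image_le) (simp_all add: x(3))
    also have "\<dots> = (\<Sum>j<m. g (l j) x)" by simp
    also have "\<dots> \<le> (\<Sum>j<m. gK x * (1/2) ^ Suc j)"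
      using gl by (intro sum_mono) (auto intro: less_imp_le)
    also have "\<dots> = gK x * (1 - (1/2) ^ m)"
    proof -
      have "(\<Sum>j<m. gK x * (1/2) ^ Suc j) = gK x * (1 - (1/2) ^ m)"
        by (induction m) (auto simp: algebra_simps)
      then show ?thesis .
    qed
    also have "\<dots> < gK x" using x(2) by (simp add: algebra_simps)
    finally show False by simp
  qed
  text \<open>
    A cylinder whose conditional measure is less than twice the atom at each of two points of a fibre
    contains only one of them.
  \<close>
  define k0 where "k0 x = (LEAST k. \<forall>k'. \<rho> k x < 2 * \<rho> k' x)" for x
  have k0_meas [measurable]: "k0 \<in> measurable M (count_space UNIV)"
    unfolding k0_def[abs_def] by measurable
  define i where "i x = to_nat (pat (k0 x) x)" for x
  have i_meas: "i \<in> measurable M (count_space UNIV)"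
  proof -
    have "(\<lambda>x. pat (k0 x) x) \<in> measurable M (count_space UNIV)"
      by (rule measurable_compose_countable[OF pat_meas k0_meas])
    then show ?thesis unfolding i_def[abs_def] by measurable
  qed
  \<comment> \<open>The first condition says that \<open>LEAST\<close> in \<open>k0\<close> really
    finds a value, so its arbitrary value at other points is harmless.\<close>
  define X1 where "X1 = {x \<in> space M. (\<forall>k'. \<rho> (k0 x) x < 2 * \<rho> k' x) \<and>
     (\<forall>l l1 l2. cyl l1 \<subseteq> cyl l \<and> cyl l2 \<subseteq> cyl l \<and> cyl l1 \<inter> cyl l2 = {} \<longrightarrow> g l1 x + g l2 x \<le> g l x)}"
  show thesis
  proof (rule that[OF i_meas])
    show "AE x in M. x \<in> X1"
      using AE_atom AE_mono AE_add AE_space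
    proof eventually_elim
      case (elim x)
      then obtain e where e: "e > 0" "\<And>k. e \<le> \<rho> k x" by blast
      have "\<exists>k. \<forall>k'. \<rho> k x < 2 * \<rho> k' x"
      proof -
        define I where "I = (INF k. \<rho> k x)"
        have bdd: "bdd_below (range (\<lambda>k. \<rho> k x))" using e(2) by (intro bdd_belowI[of _ e]) auto
        have "e \<le> I" unfolding I_def using e(2) by (intro cINF_greatest) auto
        then have "I < 2 * I" using e(1) by simp
        then obtain k where "\<rho> k x < 2 * I"
          unfolding I_def using cINF_less_iff[OF _ bdd] by auto
        moreover have "I \<le> \<rho> k' x" for k' unfolding I_def using bdd by (intro cINF_lower) auto
        ultimately show ?thesis by (meson less_le_trans mult_left_mono zero_le_numeral)
      qed
      then have "\<forall>k'. \<rho> (k0 x) x < 2 * \<rho> k' x" unfolding k0_def by (rule LeastI_ex)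
      then show ?case using elim by (auto simp: X1_def)
    qed
    fix x y assume x: "x \<in> X1" and y: "y \<in> X1" and R: "\<And>n. a n x = a n y" and i: "i x = i y"
    show "x = y"
    proof (rule ccontr)
      assume "x \<noteq> y"
      have xM: "x \<in> space M" "y \<in> space M" using x y by (auto simp: X1_def)
      obtain j where j: "(x \<in> C j) \<noteq> (y \<in> C j)" using Csep[OF xM] \<open>x \<noteq> y\<close> by blast
      have p: "pat (k0 x) x = pat (k0 y) y" using i by (simp add: i_def)
      then have k: "k0 x = k0 y" using pat_len by metis
      \<comment> \<open>Deep enough for the patterns to record \<open>C j\<close>, whence
        \<open>Suc j\<close>, and for both cylinders to lie in the common one of depth
        \<open>k0 x\<close>. They are disjoint, yet each carries more than half of its conditional
        measure.\<close>
      define n where "n = max (k0 x) (Suc j)"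
      have "j < n" "k0 x \<le> n" by (auto simp: n_def)
      then have "pat n x ! j \<noteq> pat n y ! j" using j by (simp add: pat_def)
      then have "pat n x \<noteq> pat n y" by metis
      then have disj: "cyl (pat n x) \<inter> cyl (pat n y) = {}" by (auto simp: cyl_def)
      have sub: "cyl (pat n x) \<subseteq> cyl (pat (k0 x) x)" "cyl (pat n y) \<subseteq> cyl (pat (k0 x) x)"
        using cyl_mono[OF \<open>k0 x \<le> n\<close>, of x] cyl_mono[OF \<open>k0 x \<le> n\<close>, of y] p k by auto
      have "\<And>l l1 l2. \<lbrakk>cyl l1 \<subseteq> cyl l; cyl l2 \<subseteq> cyl l; cyl l1 \<inter> cyl l2 = {}\<rbrakk> \<Longrightarrow> g l1 x + g l2 x \<le> g l x"
        using x unfolding X1_def by blast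
      from this[OF sub disj] have "g (pat n x) x + g (pat n y) x \<le> g (pat (k0 x) x) x" .
      moreover have "g (pat n y) x = \<rho> n y"
        using F_const[OF g_F xM] R by (simp add: \<rho>_def R_def)
      moreover have "\<rho> (k0 y) y = \<rho> (k0 x) x"
        using F_const[OF g_F xM] R p by (simp add: \<rho>_def R_def)
      moreover have "\<rho> (k0 x) x < 2 * \<rho> n x" "\<rho> (k0 y) y < 2 * \<rho> n y"
        using x y by (auto simp: X1_def)
      ultimately show False by (simp add: \<rho>_def)
    qed
  qed
qed

section \<open>Classes of a code\<close>

lemma (in finite_measure) nn_integral_code:
  fixes b :: "'a \<Rightarrow> nat" and u :: "nat \<Rightarrow> ennreal"
  assumes [measurable]: "b \<in> measurable M (count_space UNIV)"
  shows "(\<integral>\<^sup>+x. u (b x) \<partial>M) = (\<Sum>m. u m * emeasure M {x\<in>space M. b x = m})"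
proof -
  let ?A = "\<lambda>m. {x\<in>space M. b x = m}"
  have disj: "disjoint_family ?A" by (auto simp: disjoint_family_on_def)
  have "(\<integral>\<^sup>+x. u (b x) \<partial>M) = (\<integral>\<^sup>+x. (\<Sum>m. u m * indicator (?A m) x) \<partial>M)"
    by (intro nn_integral_cong) (simp add: suminf_cmult_indicator[OF disj])
  also have "\<dots> = (\<Sum>m. u m * emeasure M (?A m))"
    by (subst nn_integral_suminf) (auto simp: nn_integral_cmult_indicator)
  finally show ?thesis .
qed

lemma emeasure_code:
  fixes b :: "'a \<Rightarrow> nat"
  assumes [measurable]: "b \<in> measurable M (count_space UNIV)" "K \<in> sets M"
  shows "emeasure M K = (\<Sum>m. emeasure M (K \<inter> {x\<in>space M. b x = m}))"
proof -
  have "(\<Union>m. K \<inter> {x\<in>space M. b x = m}) = K" using sets.sets_into_space[OF assms(2)] by auto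
  moreover have "disjoint_family (\<lambda>m. K \<inter> {x\<in>space M. b x = m})" by (auto simp: disjoint_family_on_def)
  moreover have "range (\<lambda>m. K \<inter> {x\<in>space M. b x = m}) \<subseteq> sets M" by auto
  ultimately show ?thesis using suminf_emeasure[of "\<lambda>m. K \<inter> {x\<in>space M. b x = m}" M] by simp
qed

definition class_measure :: "'a measure \<Rightarrow> ('a \<Rightarrow> nat) \<Rightarrow> 'a \<Rightarrow> real" where
  "class_measure M b x = measure M {y\<in>space M. b y = b x}"

lemma class_measure_measurable [measurable]:
  assumes [measurable]: "b \<in> measurable M (count_space UNIV)"
  shows "class_measure M b \<in> borel_measurable M"
proof -
  have "(\<lambda>x. (\<lambda>m. measure M {y\<in>space M. b y = m}) (b x)) \<in> borel_measurable M" by measurable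
  then show ?thesis by (simp add: class_measure_def[abs_def])
qed

lemma (in prob_space) AE_class_measure_pos:
  assumes [measurable]: "b \<in> measurable M (count_space UNIV)"
  shows "AE x in M. class_measure M b x > 0"
proof -
  have "AE x in M. \<forall>m. measure M {y\<in>space M. b y = m} = 0 \<longrightarrow> b x \<noteq> m"
  proof (unfold AE_all_countable, intro allI)
    fix m
    show "AE x in M. measure M {y\<in>space M. b y = m} = 0 \<longrightarrow> b x \<noteq> m"
    proof (cases "measure M {y\<in>space M. b y = m} = 0")
      case True
      then have "{y\<in>space M. b y = m} \<in> null_sets M" by (simp add: null_sets_def emeasure_eq_measure)
      from AE_not_in[OF this] show ?thesis using AE_space by eventually_elim auto
    qed simp
  qed
  then show ?thesis
    by eventually_elim (auto simp: class_measure_def zero_less_measure_iff)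
qed

text \<open>The conditional probability, inside the \<open>b\<close>-class of \<open>x\<close>, of
  having the \<open>W\<close>-value of \<open>x\<close>; on null classes the quotient is 0.\<close>

definition class_ratio :: "'a measure \<Rightarrow> ('a \<Rightarrow> nat) \<Rightarrow> ('a \<Rightarrow> nat) \<Rightarrow> 'a \<Rightarrow> real" where
  "class_ratio M b W x = measure M {y\<in>space M. b y = b x \<and> W y = W x} / class_measure M b x"

lemma class_ratio_measurable [measurable]:
  assumes [measurable]: "b \<in> measurable M (count_space UNIV)" "W \<in> measurable M (count_space UNIV)"
  shows "class_ratio M b W \<in> borel_measurable M"
proof -
  have "(\<lambda>x. (\<lambda>m j. measure M {y\<in>space M. b y = m \<and> W y = j} / measure M {y\<in>space M. b y = m}) (b x) (W x))
     \<in> borel_measurable M"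
    by measurable
  then show ?thesis by (simp add: class_ratio_def[abs_def] class_measure_def)
qed

lemma (in prob_space) class_ratio_bounds:
  assumes [measurable]: "b \<in> measurable M (count_space UNIV)"
  shows "0 \<le> class_ratio M b W x" "class_ratio M b W x \<le> 1"
proof -
  show "0 \<le> class_ratio M b W x" by (simp add: class_ratio_def class_measure_def)
  have "measure M {y\<in>space M. b y = b x \<and> W y = W x} \<le> class_measure M b x"
    unfolding class_measure_def by (intro finite_measure_mono) auto
  then show "class_ratio M b W x \<le> 1"
    unfolding class_ratio_def by (intro divide_le_eq_1[THEN iffD2]) (auto simp: class_measure_def less_le)
qed

lemma (in prob_space) class_ratio_integrable [simp]:
  assumes [measurable]: "b \<in> measurable M (count_space UNIV)" "W \<in> measurable M (count_space UNIV)"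
  shows "integrable M (class_ratio M b W)"
  by (rule integrable_const_bound[of _ 1]) (auto simp: class_ratio_bounds)

text \<open>On a large compact set, two points in the same class of a fine code have the same \<open>W\<close>-value.\<close>

lemma (in prob_space) class_ratio_tendsto:
  fixes b :: "nat \<Rightarrow> 'a \<Rightarrow> nat" and W :: "'a \<Rightarrow> nat"
  assumes sb: "standard_borel_space M"
    and b [measurable]: "\<And>n. b n \<in> measurable M (count_space UNIV)"
    and refine: "\<And>n x y. b (Suc n) x = b (Suc n) y \<Longrightarrow> b n x = b n y"
    and X1: "AE x in M. x \<in> X1"
    and inj: "\<And>x y. \<lbrakk>x \<in> X1; y \<in> X1; \<And>n. b n x = b n y\<rbrakk> \<Longrightarrow> x = y"
    and W [measurable]: "W \<in> measurable M (count_space UNIV)"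
  shows "(\<lambda>n. \<integral>x. class_ratio M (b n) W x \<partial>M) \<longlonglongrightarrow> 1"
proof (rule LIMSEQ_I)
  fix e :: real assume e: "0 < e"
  obtain X1' where X1': "X1' \<in> sets M" "X1' \<subseteq> X1" "measure M X1' = 1"
  proof -
    obtain N where N: "N \<in> null_sets M" "{x \<in> space M. x \<notin> X1} \<subseteq> N"
      using X1 by (auto elim!: AE_E simp: null_sets_def)
    then have "measure M (space M - N) = 1"
      using prob_compl[of N] by (auto simp: null_sets_def measure_def)
    then show ?thesis using N by (intro that[of "space M - N"]) auto
  qed
  have refine': "b n x = b n y" if "b m x = b m y" "n \<le> m" for n m x y
    using that(2,1) by (induction rule: dec_induct) (auto dest: refine)
  define \<B> where "\<B> = range (\<lambda>m. {y \<in> space M. W y = m}) \<union> (\<lambda>(n, m). {y \<in> space M. b n y = m}) ` UNIV"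
  define B where "B = from_nat_into \<B>"
  have rB: "range B = \<B>" unfolding B_def by (intro range_from_nat_into) (auto simp: \<B>_def)
  have B_meas: "B j \<in> sets M" for j
  proof -
    have "B j \<in> \<B>" using rB by blast
    then show ?thesis by (auto simp: \<B>_def)
  qed
  obtain K where K: "K \<in> sets M" "K \<subseteq> X1'" "measure M (X1' - K) < e / 2"
    and Kc: "clopen_compact B K"
    by (rule lusin_compact[where B = B, OF sb finite_measure_axioms B_meas X1'(1), of "e/2"]) (use e in auto)
  have KM: "K \<subseteq> space M" using K(1) by (rule sets.sets_into_space)
  note [measurable] = K(1)
  have Kbig: "measure M K > 1 - e / 2"
    using K finite_measure_Diff[OF X1'(1) K(1,2)] X1'(3) by simp
  \<comment> \<open>Otherwise pairs with equal codes at level \<open>m\<close> but different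
    \<open>W\<close>-values converge, along a common subsequence, to two points with all codes
    equal. Injectivity merges the limits, and then the \<open>W\<close>-values along the subsequence
    agree in the end.\<close>
  have "\<exists>n0. \<forall>x\<in>K. \<forall>y\<in>K. b n0 x = b n0 y \<longrightarrow> W x = W y"
  proof (rule ccontr)
    assume "\<not> ?thesis"
    then have "\<forall>m. \<exists>x y. x \<in> K \<and> y \<in> K \<and> b m x = b m y \<and> W x \<noteq> W y" by blast
    then obtain s t where st: "\<And>m. s m \<in> K" "\<And>m. t m \<in> K" "\<And>m. b m (s m) = b m (t m)"
      "\<And>m. W (s m) \<noteq> W (t m)" by metis
    obtain x r where x: "x \<in> K" "strict_mono r"
        "\<And>j. \<forall>\<^sub>F i in sequentially. s (r i) \<in> B j \<longleftrightarrow> x \<in> B j"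
      using Kc st(1) unfolding clopen_compact_def by metis
    have "\<forall>m. (t \<circ> r) m \<in> K" using st(2) by simp
    then obtain y r' where y: "y \<in> K" "strict_mono r'"
        "\<And>j. \<forall>\<^sub>F i in sequentially. (t \<circ> r) (r' i) \<in> B j \<longleftrightarrow> y \<in> B j"
      using Kc unfolding clopen_compact_def by metis
    have xB: "\<forall>\<^sub>F i in sequentially. s (r (r' i)) \<in> H \<longleftrightarrow> x \<in> H" if "H \<in> \<B>" for H
    proof -
      obtain j where "H = B j" using \<open>H \<in> \<B>\<close> rB by blast
      then show ?thesis using eventually_subseq[OF y(2) x(3)[of j]] by simp
    qed
    have yB: "\<forall>\<^sub>F i in sequentially. t (r (r' i)) \<in> H \<longleftrightarrow> y \<in> H" if "H \<in> \<B>" for H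
    proof -
      obtain j where "H = B j" using \<open>H \<in> \<B>\<close> rB by blast
      then show ?thesis using y(3)[of j] by simp
    qed
    have large: "\<forall>\<^sub>F i in sequentially. n \<le> r (r' i)" for n
      using filterlim_subseq[OF strict_mono_o[OF x(2) y(2)]] by (simp add: filterlim_at_top)
    have sM: "s m \<in> space M" "t m \<in> space M" for m using st(1,2) KM by blast+
    have "b n x = b n y" for n
    proof -
      have "{z \<in> space M. b n z = b n x} \<in> \<B>" by (auto simp: \<B>_def)
      from xB[OF this] yB[OF this] large[of n] have "\<forall>\<^sub>F i in sequentially. b n x = b n y"
      proof eventually_elim
        case (elim i)
        have "b n (s (r (r' i))) = b n (t (r (r' i)))" using refine'[OF st(3) elim(3)] .
        moreover have "x \<in> space M" "y \<in> space M" using x(1) y(1) KM by blast+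
        ultimately show ?case using elim(1,2) sM by simp
      qed
      then show ?thesis by simp
    qed
    then have "x = y" using x(1) y(1) K(2) X1'(2) by (intro inj) auto
    have "{z \<in> space M. W z = W x} \<in> \<B>" by (auto simp: \<B>_def)
    from xB[OF this] yB[OF this] have "\<forall>\<^sub>F i in sequentially. False"
    proof eventually_elim
      case (elim i)
      moreover have "x \<in> space M" using x(1) KM by blast
      ultimately show ?case using sM st(4)[of "r (r' i)"] \<open>x = y\<close> by simp
    qed
    then show False by simp
  qed
  then obtain n0 where n0: "\<And>x y. \<lbrakk>x \<in> K; y \<in> K; b n0 x = b n0 y\<rbrakk> \<Longrightarrow> W x = W y" by blast
  have "norm ((\<integral>x. class_ratio M (b n) W x \<partial>M) - 1) < e" if n: "n0 \<le> n" for n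
  proof -
    \<comment> \<open>The share of \<open>K\<close> in the class of \<open>x\<close>. Summing over
      the classes shows that its mean is the measure of \<open>K\<close>.\<close>
    define q where "q x = measure M (K \<inter> {y\<in>space M. b n y = b n x}) / class_measure M (b n) x" for x
    have q_meas [measurable]: "q \<in> borel_measurable M"
      unfolding q_def[abs_def] class_measure_def
      by (rule measurable_compose[OF b[of n],
            where g = "\<lambda>m. measure M (K \<inter> {y\<in>space M. b n y = m}) / measure M {y\<in>space M. b n y = m}"])
         simp
    have q0: "0 \<le> q x" for x by (simp add: q_def class_measure_def)
    have q1: "q x \<le> 1" for x
    proof -
      have "measure M (K \<inter> {y\<in>space M. b n y = b n x}) \<le> class_measure M (b n) x"
        unfolding class_measure_def by (intro finite_measure_mono) auto
      then show ?thesis unfolding q_def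
        by (intro divide_le_eq_1[THEN iffD2]) (auto simp: class_measure_def less_le)
    qed
    have q_int: "integrable M q" by (rule integrable_const_bound[of _ 1]) (auto simp: q0 q1)
    have K_int: "integrable M (indicat_real K)"
      by (intro integrable_real_indicator) (auto simp: emeasure_eq_measure)
    have "ennreal (\<integral>x. q x \<partial>M) = (\<integral>\<^sup>+x. ennreal (q x) \<partial>M)"
      using q_int q0 by (simp add: nn_integral_eq_integral)
    also have "\<dots> = (\<integral>\<^sup>+x. (\<lambda>m. ennreal (measure M (K \<inter> {y\<in>space M. b n y = m}) / measure M {y\<in>space M. b n y = m})) (b n x) \<partial>M)"
      by (simp add: q_def class_measure_def)
    also have "\<dots> = (\<Sum>m. ennreal (measure M (K \<inter> {y\<in>space M. b n y = m}) / measure M {y\<in>space M. b n y = m})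
        * emeasure M {x\<in>space M. b n x = m})"
      by (rule nn_integral_code[OF b])
    also have "\<dots> = (\<Sum>m. emeasure M (K \<inter> {y\<in>space M. b n y = m}))"
    proof (intro suminf_cong)
      fix m
      have le: "measure M (K \<inter> {y\<in>space M. b n y = m}) \<le> measure M {x\<in>space M. b n x = m}"
        by (intro finite_measure_mono) auto
      show "ennreal (measure M (K \<inter> {y\<in>space M. b n y = m}) / measure M {y\<in>space M. b n y = m})
        * emeasure M {x\<in>space M. b n x = m} = emeasure M (K \<inter> {y\<in>space M. b n y = m})"
        using le measure_nonneg[of M "K \<inter> {y\<in>space M. b n y = m}"]
        by (cases "measure M {x\<in>space M. b n x = m} = 0")
           (auto simp: emeasure_eq_measure ennreal_mult'[symmetric])
    qed
    also have "\<dots> = emeasure M K" by (rule emeasure_code[symmetric]) auto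
    finally have "(\<integral>x. q x \<partial>M) = measure M K"
      using q0 by (simp add: emeasure_eq_measure integral_nonneg)
    \<comment> \<open>On \<open>K\<close> the class ratio is at least \<open>q\<close>, and off
      \<open>K\<close> the left integrand is at most 0. The left integral is twice the measure of
      \<open>K\<close> minus 1, which is why \<open>K\<close> may miss only
      \<open>e / 2\<close>.\<close>
    moreover have "(\<integral>x. indicator K x + q x - 1 \<partial>M) \<le> (\<integral>x. class_ratio M (b n) W x \<partial>M)"
    proof (rule integral_mono)
      show "integrable M (\<lambda>x. indicator K x + q x - 1)" using q_int K_int by simp
      fix x assume "x \<in> space M"
      show "indicator K x + q x - 1 \<le> class_ratio M (b n) W x"
      proof (cases "x \<in> K")
        case True
        have "measure M (K \<inter> {y\<in>space M. b n y = b n x}) \<le> measure M {y\<in>space M. b n y = b n x \<and> W y = W x}"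
        proof (rule finite_measure_mono)
          show "K \<inter> {y\<in>space M. b n y = b n x} \<subseteq> {y\<in>space M. b n y = b n x \<and> W y = W x}"
          proof safe
            fix y assume "y \<in> K" "b n y = b n x"
            then show "W y = W x" using n0[OF _ True refine'[OF _ n]] by simp
          qed
        qed measurable
        then have "q x \<le> class_ratio M (b n) W x"
          unfolding q_def class_ratio_def by (intro divide_right_mono) (auto simp: class_measure_def)
        then show ?thesis using True by simp
      next
        case False
        then show ?thesis using q1[of x] class_ratio_bounds(1)[of "b n" W x] by simp
      qed
    qed simp
    moreover have "(\<integral>x. indicator K x + q x - 1 \<partial>M) = measure M K + (\<integral>x. q x \<partial>M) - 1"
      using q_int K_int by (simp add: prob_space)
    moreover have "(\<integral>x. class_ratio M (b n) W x \<partial>M) \<le> (\<integral>x. 1 \<partial>M)"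
      by (intro integral_mono) (auto simp: class_ratio_bounds)
    ultimately show ?thesis using Kbig by (simp add: prob_space)
  qed
  then show "\<exists>n0. \<forall>n\<ge>n0. norm ((\<integral>x. class_ratio M (b n) W x \<partial>M) - 1) < e" by blast
qed

section \<open>Measure-preserving actions and spectral gap\<close>

text \<open>Free of any topology on \<open>M\<close>, so that the diagonal action on the product
  becomes another instance, the one to which the spectral gap argument is applied.\<close>

locale mp_action = prob_space M + group G
  for M :: "'a measure" and G :: "('g, 'r) monoid_scheme" (structure) +
  fixes \<phi> :: "'g \<Rightarrow> 'a \<Rightarrow> 'a"
  assumes countable_carrier: "countable (carrier G)"
    and act_measurable: "g \<in> carrier G \<Longrightarrow> \<phi> g \<in> M \<rightarrow>\<^sub>M M"
    and act_distr: "g \<in> carrier G \<Longrightarrow> distr M M (\<phi> g) = M"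
    and act_inv: "\<lbrakk>g \<in> carrier G; x \<in> space M\<rbrakk> \<Longrightarrow> \<phi> (inv g) (\<phi> g x) = x"
    and act_mult: "\<lbrakk>g \<in> carrier G; h \<in> carrier G; x \<in> space M\<rbrakk> \<Longrightarrow> \<phi> g (\<phi> h x) = \<phi> (g \<otimes> h) x"
    and act_one: "x \<in> space M \<Longrightarrow> \<phi> \<one> x = x"
begin

lemma act_space: "\<lbrakk>g \<in> carrier G; x \<in> space M\<rbrakk> \<Longrightarrow> \<phi> g x \<in> space M"
  using act_measurable measurable_space by metis

lemma act_inv': "\<lbrakk>g \<in> carrier G; x \<in> space M\<rbrakk> \<Longrightarrow> \<phi> g (\<phi> (inv g) x) = x"
  using act_inv[of "inv g" x] by simp

lemma nn_integral_act:
  assumes "g \<in> carrier G" "f \<in> borel_measurable M"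
  shows "(\<integral>\<^sup>+x. f (\<phi> g x) \<partial>M) = (\<integral>\<^sup>+x. f x \<partial>M)"
  using nn_integral_distr[OF act_measurable[OF assms(1)], of f] assms act_distr by simp

lemma integral_act:
  fixes f :: "'a \<Rightarrow> real"
  assumes "g \<in> carrier G" "f \<in> borel_measurable M"
  shows "(\<integral>x. f (\<phi> g x) \<partial>M) = (\<integral>x. f x \<partial>M)"
  using integral_distr[OF act_measurable[OF assms(1)], of f] assms act_distr by simp

lemma integrable_act:
  fixes f :: "'a \<Rightarrow> real"
  assumes "g \<in> carrier G" "integrable M f"
  shows "integrable M (\<lambda>x. f (\<phi> g x))"
  using integrable_distr[OF act_measurable[OF assms(1)], of f] assms act_distr by simp

lemma measure_act:
  assumes "g \<in> carrier G" "A \<in> sets M"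
  shows "measure M {x \<in> space M. \<phi> g x \<in> A} = measure M A"
proof -
  have "measure M A = measure (distr M M (\<phi> g)) A" using act_distr[OF assms(1)] by simp
  also have "\<dots> = measure M (\<phi> g -` A \<inter> space M)"
    using act_measurable[OF assms(1)] assms(2) by (rule measure_distr)
  finally show ?thesis by (simp add: vimage_def Int_def conj_commute)
qed

lemma AE_act:
  assumes "AE x in M. P x"
  shows "AE x in M. \<forall>g\<in>carrier G. P (\<phi> g x)"
  unfolding AE_ball_countable[OF countable_carrier]
proof
  fix g assume g: "g \<in> carrier G"
  have "AE x in distr M M (\<phi> g). P x" by (subst act_distr[OF g]) (rule assms)
  then show "AE x in M. P (\<phi> g x)" by (rule AE_distrD[OF act_measurable[OF g]])
qed

text \<open>Discarding the preimages of a null set under all group elements costs a null set, the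
  group being countable. The unit gives \<open>P\<close>, closure under products gives
  invariance.\<close>

lemma invariant_conull_subset:
  assumes "AE x in M. P x"
  obtains X where "X \<in> sets M" "AE x in M. x \<in> X" "\<And>x. x \<in> X \<Longrightarrow> P x"
    "\<And>g x. \<lbrakk>g \<in> carrier G; x \<in> X\<rbrakk> \<Longrightarrow> \<phi> g x \<in> X"
proof -
  obtain N where N: "N \<in> null_sets M" "{x \<in> space M. \<not> P x} \<subseteq> N"
    using assms by (auto elim!: AE_E simp: null_sets_def)
  define X where "X = {x \<in> space M. \<forall>g\<in>carrier G. \<phi> g x \<in> space M - N}"
  show thesis
  proof (rule that[of X])
    have "{x \<in> space M. \<phi> g x \<in> space M - N} \<in> sets M" if "g \<in> carrier G" for g
    proof -
      have "\<phi> g -` (space M - N) \<inter> space M \<in> sets M"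
        using N(1) by (intro measurable_sets[OF act_measurable[OF that]]) auto
      then show ?thesis by (simp add: vimage_def Int_def conj_commute)
    qed
    then show "X \<in> sets M" unfolding X_def
      by (rule sets.sets_Collect_countable_All'[OF _ countable_carrier])
    have "AE x in M. x \<in> space M - N" using AE_not_in[OF N(1)] AE_space by eventually_elim simp
    from AE_act[OF this] show "AE x in M. x \<in> X"
      using AE_space by eventually_elim (simp add: X_def)
    show "P x" if "x \<in> X" for x
    proof -
      have "\<phi> \<one> x \<in> space M - N" "x \<in> space M" using that by (auto simp: X_def)
      then show ?thesis using N(2) act_one by auto
    qed
    show "\<phi> g x \<in> X" if "g \<in> carrier G" "x \<in> X" for g x
      using that by (auto simp: X_def act_mult act_space)
  qed
qed

section \<open>Strictly invariant functions and the projection onto them\<close>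

definition orbit_rel :: "'a \<Rightarrow> 'a \<Rightarrow> bool" where
  "orbit_rel x y \<longleftrightarrow> (\<exists>g\<in>carrier G. y = \<phi> g x)"

lemma symp_orbit_rel: "symp_on (space M) orbit_rel"
  by (rule symp_onI) (metis orbit_rel_def act_inv inv_closed)

abbreviation invariant_algebra :: "'a measure" where
  "invariant_algebra \<equiv> saturated_sets M orbit_rel"

lemma finite_measure_subalgebra_invariant: "finite_measure_subalgebra M invariant_algebra"
  by unfold_locales (rule subalgebra_saturated_sets[OF symp_orbit_rel])

lemma invariant_algebra_measurable_invariant:
  fixes u :: "'a \<Rightarrow> real"
  assumes "u \<in> borel_measurable invariant_algebra" "g \<in> carrier G" "x \<in> space M"
  shows "u (\<phi> g x) = u x"
  using measurable_saturated_sets_const[OF symp_orbit_rel assms(1)] assms(2,3) act_space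
  by (auto simp: orbit_rel_def)

text \<open>Vectors in \<open>koopman_invariants\<close> are invariant only almost everywhere. The
  defect is confined to the complement of an invariant conull set, and the value 0 there keeps the
  function strictly invariant.\<close>

lemma invariant_AE_eq_measurable:
  fixes u :: "'a \<Rightarrow> real"
  assumes u: "u \<in> borel_measurable M" and inv: "\<And>g. g \<in> carrier G \<Longrightarrow> AE x in M. u (\<phi> g x) = u x"
  obtains v where "v \<in> borel_measurable invariant_algebra" "AE x in M. v x = u x"
proof -
  have "AE x in M. \<forall>g\<in>carrier G. u (\<phi> g x) = u x"
    unfolding AE_ball_countable[OF countable_carrier] using inv by blast
  from invariant_conull_subset[OF this] obtain X where X: "X \<in> sets M" "AE x in M. x \<in> X"
      "\<And>x. x \<in> X \<Longrightarrow> \<forall>g\<in>carrier G. u (\<phi> g x) = u x"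
      "\<And>g x. \<lbrakk>g \<in> carrier G; x \<in> X\<rbrakk> \<Longrightarrow> \<phi> g x \<in> X" by metis
  define v where "v x = (if x \<in> X then u x else 0)" for x
  have XM: "X \<subseteq> space M" using X(1) by (rule sets.sets_into_space)
  have iff: "\<phi> g x \<in> X \<longleftrightarrow> x \<in> X" if "g \<in> carrier G" "x \<in> space M" for g x
    using X(4)[of g x] X(4)[of "inv g" "\<phi> g x"] that act_inv by auto
  have v_inv: "v (\<phi> g x) = v x" if "g \<in> carrier G" "x \<in> space M" for g x
    using iff[OF that] X(3)[of x] that by (auto simp: v_def)
  have vM [measurable]: "v \<in> borel_measurable M"
    unfolding v_def[abs_def] using u X(1) by measurable
  have "v \<in> borel_measurable invariant_algebra"
  proof (rule measurableI)
    fix S :: "real set" assume "S \<in> sets borel"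
    then have "v -` S \<inter> space M \<in> sets M" by measurable
    then show "v -` S \<inter> space invariant_algebra \<in> sets invariant_algebra"
      unfolding sets_saturated_sets[OF symp_orbit_rel] using v_inv act_space
      by (auto simp: orbit_rel_def)
  qed simp
  moreover have "AE x in M. v x = u x" using X(2) by eventually_elim (simp add: v_def)
  ultimately show thesis by (rule that)
qed

text \<open>Conditional expectation on the invariant algebra serves as the projection onto the
  invariant vectors; it yields representatives invariant at every point, as needed later for
  sections of \<open>H n\<close>. Since \<open>H n\<close> is invariant, a group element moves
  \<open>F n - H n\<close> exactly as much as \<open>F n\<close>, so normalised residuals bounded
  away from 0 would violate the gap.\<close>

lemma spectral_gap_approx:
  fixes F :: "nat \<Rightarrow> 'a \<Rightarrow> real"
  assumes gap: "has_spectral_gap G (l2_orthogonal M (koopman_invariants G M \<phi>)) (l2_norm M) (koopman G \<phi>)"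
    and F [measurable]: "\<And>n. F n \<in> borel_measurable M"
    and F2: "\<And>n. integrable M (\<lambda>x. (F n x)\<^sup>2)"
    and almost: "\<And>g. g \<in> carrier G \<Longrightarrow> (\<lambda>n. \<integral>x. (F n (\<phi> g x) - F n x)\<^sup>2 \<partial>M) \<longlonglongrightarrow> 0"
  obtains H :: "nat \<Rightarrow> 'a \<Rightarrow> real" where
    "\<And>n. H n \<in> borel_measurable M"
    "\<And>n g x. \<lbrakk>g \<in> carrier G; x \<in> space M\<rbrakk> \<Longrightarrow> H n (\<phi> g x) = H n x"
    "\<And>n. integrable M (\<lambda>x. (F n x - H n x)\<^sup>2)"
    "(\<lambda>n. \<integral>x. (F n x - H n x)\<^sup>2 \<partial>M) \<longlonglongrightarrow> 0"
proof -
  interpret I: finite_measure_subalgebra M invariant_algebra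
    by (rule finite_measure_subalgebra_invariant)
  define H where "H n = real_cond_exp M invariant_algebra (F n)" for n
  have H_I: "H n \<in> borel_measurable invariant_algebra" for n by (simp add: H_def)
  have H_M [measurable]: "H n \<in> borel_measurable M" for n by (simp add: H_def)
  have H_inv: "H n (\<phi> g x) = H n x" if "g \<in> carrier G" "x \<in> space M" for n g x
    using invariant_algebra_measurable_invariant[OF H_I that] .
  have F_int: "integrable M (F n)" for n
    by (rule square_integrable_imp_integrable[OF F F2])
  have prod_int: "integrable M (\<lambda>x. u x * v x)"
    if [measurable]: "u \<in> borel_measurable M" "v \<in> borel_measurable M"
      and "integrable M (\<lambda>x. (u x)\<^sup>2)" "integrable M (\<lambda>x. (v x)\<^sup>2)" for u v :: "'a \<Rightarrow> real"
  proof (rule Bochner_Integration.integrable_bound)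
    show "integrable M (\<lambda>x. (u x)\<^sup>2 + (v x)\<^sup>2)" using that by simp
    have "\<bar>u x * v x\<bar> \<le> (u x)\<^sup>2 + (v x)\<^sup>2" for x
    proof -
      have "2 * (\<bar>u x\<bar> * \<bar>v x\<bar>) \<le> (u x)\<^sup>2 + (v x)\<^sup>2"
        using sum_squares_bound[of "\<bar>u x\<bar>" "\<bar>v x\<bar>"] by simp
      moreover have "0 \<le> \<bar>u x\<bar> * \<bar>v x\<bar>" by simp
      ultimately show ?thesis unfolding abs_mult by linarith
    qed
    then show "AE x in M. norm (u x * v x) \<le> norm ((u x)\<^sup>2 + (v x)\<^sup>2)" by auto
  qed measurable
  have diff_sq_int: "integrable M (\<lambda>x. (u x - v x)\<^sup>2)"
    if [measurable]: "u \<in> borel_measurable M" "v \<in> borel_measurable M"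
      and "integrable M (\<lambda>x. (u x)\<^sup>2)" "integrable M (\<lambda>x. (v x)\<^sup>2)" for u v :: "'a \<Rightarrow> real"
    using prod_int[OF that] that(3,4) by (simp add: power2_diff mult.assoc)
  have H2: "integrable M (\<lambda>x. (H n x)\<^sup>2)" for n
  proof (rule Bochner_Integration.integrable_bound)
    show "integrable M (real_cond_exp M invariant_algebra (\<lambda>x. (F n x)\<^sup>2))"
      using F2 by (rule I.real_cond_exp_int)
    have "AE x in M. (H n x)\<^sup>2 \<le> real_cond_exp M invariant_algebra (\<lambda>x. (F n x)\<^sup>2) x"
      unfolding H_def using F_int F2
      by (intro I.real_cond_exp_jensens_inequality(2)[where I = UNIV and X = "F n" and q = "\<lambda>x. x\<^sup>2"])
         (auto intro: convex_power_even[of 2, simplified])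
    then show "AE x in M. norm ((H n x)\<^sup>2) \<le> norm (real_cond_exp M invariant_algebra (\<lambda>x. (F n x)\<^sup>2) x)"
      by eventually_elim simp
  qed measurable
  have D_int: "integrable M (\<lambda>x. (F n x - H n x)\<^sup>2)" for n
    using diff_sq_int[OF F H_M F2 H2] .
  have orth_real: "(\<integral>x. (F n x - H n x) * u x \<partial>M) = 0"
    if u: "u \<in> borel_measurable M" "\<And>g. g \<in> carrier G \<Longrightarrow> AE x in M. u (\<phi> g x) = u x"
      "integrable M (\<lambda>x. (u x)\<^sup>2)" for n and u :: "'a \<Rightarrow> real"
  proof -
    obtain v where v: "v \<in> borel_measurable invariant_algebra" "AE x in M. v x = u x"
      using invariant_AE_eq_measurable[OF u(1,2)] by metis
    have [measurable]: "v \<in> borel_measurable M" "u \<in> borel_measurable M"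
      using measurable_from_subalg[OF I.subalg v(1)] u(1) by auto
    have v2: "integrable M (\<lambda>x. (v x)\<^sup>2)"
      by (rule integrable_cong_AE_imp[OF u(3)]) (use v(2) in auto)
    have int: "integrable M (\<lambda>x. v x * F n x)" "integrable M (\<lambda>x. v x * H n x)"
      by (intro prod_int v2 F2 H2; simp)+
    have "(\<integral>x. (F n x - H n x) * u x \<partial>M) = (\<integral>x. v x * F n x - v x * H n x \<partial>M)"
      by (rule integral_cong_AE) (use v(2) in \<open>auto simp: algebra_simps\<close>)
    also have "\<dots> = 0"
      using I.real_cond_exp_intg(2)[OF int(1) v(1) F] int by (simp add: H_def)
    finally show ?thesis .
  qed
  have orth: "(\<lambda>x. complex_of_real (c * (F n x - H n x))) \<in> l2_orthogonal M (koopman_invariants G M \<phi>)" for n c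
  proof -
    have "(\<lambda>x. complex_of_real (c * (F n x - H n x))) \<in> l2_space M"
      using D_int[of n] by (auto simp: l2_space_def norm_mult power_mult_distrib simp flip: of_real_diff)
    moreover have "l2_inner M (\<lambda>x. complex_of_real (c * (F n x - H n x))) h = 0"
      if h: "h \<in> koopman_invariants G M \<phi>" for h
    proof -
      have hM [measurable]: "h \<in> borel_measurable M" and h2: "integrable M (\<lambda>x. (cmod (h x))\<^sup>2)"
        and hinv: "\<And>g. g \<in> carrier G \<Longrightarrow> AE x in M. koopman G \<phi> g h x = h x"
        using h by (auto simp: koopman_invariants_def l2_space_def)
      have hinv': "AE x in M. h (\<phi> g x) = h x" if "g \<in> carrier G" for g
        using hinv[of "inv g"] that by (simp add: koopman_def)
      have Re2: "integrable M (\<lambda>x. (Re (h x))\<^sup>2)" "integrable M (\<lambda>x. (Im (h x))\<^sup>2)"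
        by (rule Bochner_Integration.integrable_bound[OF h2], measurable, auto simp: cmod_power2)+
      \<comment> \<open>Invariant vectors are complex-valued; their real and imaginary parts are
        invariant separately, which leads back to \<open>orth_real\<close>.\<close>
      have Re0: "(\<integral>x. (F n x - H n x) * Re (h x) \<partial>M) = 0"
      proof (rule orth_real)
        show "AE x in M. Re (h (\<phi> g x)) = Re (h x)" if "g \<in> carrier G" for g
          using hinv'[OF that] by eventually_elim simp
      qed (use Re2 in auto)
      have Im0: "(\<integral>x. (F n x - H n x) * Im (h x) \<partial>M) = 0"
      proof (rule orth_real)
        show "AE x in M. Im (h (\<phi> g x)) = Im (h x)" if "g \<in> carrier G" for g
          using hinv'[OF that] by eventually_elim simp
      qed (use Re2 in auto)
      have int: "integrable M (\<lambda>x. (F n x - H n x) * Re (h x))" "integrable M (\<lambda>x. (F n x - H n x) * Im (h x))"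
        by (intro prod_int D_int Re2; simp)+
      have "l2_inner M (\<lambda>x. complex_of_real (c * (F n x - H n x))) h
        = (\<integral>x. complex_of_real c * (complex_of_real ((F n x - H n x) * Re (h x)) -
                \<i> * complex_of_real ((F n x - H n x) * Im (h x))) \<partial>M)"
        unfolding l2_inner_def
        by (intro Bochner_Integration.integral_cong refl) (auto simp: complex_eq_iff algebra_simps)
      also have "\<dots> = complex_of_real c * (complex_of_real (\<integral>x. (F n x - H n x) * Re (h x) \<partial>M) -
                \<i> * complex_of_real (\<integral>x. (F n x - H n x) * Im (h x) \<partial>M))"
        using int by (simp del: of_real_mult of_real_diff)
      finally show ?thesis using Re0 Im0 by simp
    qed
    ultimately show ?thesis by (simp add: l2_orthogonal_def)
  qed
  define d where "d n = (\<integral>x. (F n x - H n x)\<^sup>2 \<partial>M)" for n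
  have "d \<longlonglongrightarrow> 0"
  proof (rule ccontr)
    assume "\<not> d \<longlonglongrightarrow> 0"
    moreover have d0: "0 \<le> d n" for n by (simp add: d_def)
    ultimately obtain \<delta> where \<delta>: "\<delta> > 0" "\<forall>N. \<exists>n\<ge>N. \<delta> \<le> d n"
      unfolding lim_sequentially dist_real_def by (auto simp: not_less)
    \<comment> \<open>Only \<open>N \<le> r N\<close> is arranged, not monotonicity; this already
      gives convergence along \<open>r\<close>.\<close>
    then obtain r where r: "\<And>N. N \<le> r N" "\<And>N. \<delta> \<le> d (r N)" by metis
    have rlim: "filterlim r at_top sequentially"
      by (rule filterlim_at_top_mono[OF filterlim_ident]) (use r(1) in auto)
    define \<xi> where "\<xi> k = (\<lambda>x. complex_of_real (1 / sqrt (d (r k)) * (F (r k) x - H (r k) x)))" for k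
    have dpos: "0 < d (r k)" for k using r(2)[of k] \<delta>(1) by linarith
    have "l2_norm M (\<xi> k) = 1" for k
    proof -
      have "(\<lambda>x. (cmod (\<xi> k x))\<^sup>2) = (\<lambda>x. (1 / d (r k)) * (F (r k) x - H (r k) x)\<^sup>2)"
        using dpos[of k] unfolding \<xi>_def norm_of_real
        by (simp add: power_mult_distrib power_divide)
      then show ?thesis using dpos[of k] unfolding l2_norm_def by (simp add: d_def[symmetric])
    qed
    moreover have "\<xi> k \<in> l2_orthogonal M (koopman_invariants G M \<phi>)" for k
      unfolding \<xi>_def by (rule orth)
    moreover have "(\<lambda>k. l2_norm M (koopman G \<phi> g (\<xi> k) - \<xi> k)) \<longlonglongrightarrow> 0" if g: "g \<in> carrier G" for g
    proof -
      define a where "a n = (\<integral>x. (F n (\<phi> (inv g) x) - F n x)\<^sup>2 \<partial>M)" for n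
      have a0: "0 \<le> a n" for n by (simp add: a_def)
      have "a \<longlonglongrightarrow> 0" using almost[of "inv g"] g by (simp add: a_def[abs_def])
      then have "(\<lambda>k. a (r k)) \<longlonglongrightarrow> 0" using rlim by (rule filterlim_compose)
      then have "(\<lambda>k. sqrt (a (r k) / \<delta>)) \<longlonglongrightarrow> sqrt (0 / \<delta>)"
        by (intro tendsto_intros) (use \<delta>(1) in auto)
      then have lim: "(\<lambda>k. sqrt (a (r k) / \<delta>)) \<longlonglongrightarrow> 0" by simp
      have eq: "l2_norm M (koopman G \<phi> g (\<xi> k) - \<xi> k) = sqrt (a (r k) / d (r k))" for k
      proof -
        have "(\<integral>x. (cmod ((koopman G \<phi> g (\<xi> k) - \<xi> k) x))\<^sup>2 \<partial>M)
            = (\<integral>x. 1 / d (r k) * (F (r k) (\<phi> (inv g) x) - F (r k) x)\<^sup>2 \<partial>M)"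
        proof (rule Bochner_Integration.integral_cong)
          fix x assume x: "x \<in> space M"
          have "(koopman G \<phi> g (\<xi> k) - \<xi> k) x
              = complex_of_real (1 / sqrt (d (r k)) * (F (r k) (\<phi> (inv g) x) - F (r k) x))"
            using H_inv[of "inv g" x "r k"] g x
            by (simp add: koopman_def \<xi>_def right_diff_distrib diff_divide_distrib)
          then show "(cmod ((koopman G \<phi> g (\<xi> k) - \<xi> k) x))\<^sup>2
             = 1 / d (r k) * (F (r k) (\<phi> (inv g) x) - F (r k) x)\<^sup>2"
            using dpos[of k] by (simp only: norm_of_real) (simp add: power_divide)
        qed simp
        then show ?thesis unfolding l2_norm_def by (simp add: a_def)
      qed
      show ?thesis
      proof (rule tendsto_sandwich[OF _ _ tendsto_const lim])
        show "\<forall>\<^sub>F k in sequentially. 0 \<le> l2_norm M (koopman G \<phi> g (\<xi> k) - \<xi> k)"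
          using a0 d0 by (simp add: eq)
        show "\<forall>\<^sub>F k in sequentially. l2_norm M (koopman G \<phi> g (\<xi> k) - \<xi> k) \<le> sqrt (a (r k) / \<delta>)"
          using r(2) a0 \<delta>(1) by (intro always_eventually allI) (auto simp: eq intro!: divide_left_mono mult_pos_pos dpos)
      qed
    qed
    ultimately show False using gap unfolding has_spectral_gap_def by blast
  qed
  then show thesis using H_M H_inv D_int by (intro that[of H]) (auto simp: d_def[abs_def])
qed

end

section \<open>Almost invariant kernels\<close>

text \<open>Scaled so that every section over a class of positive measure has norm 1. Sections over
  null classes vanish, since \<open>1 / sqrt 0\<close> is 0.\<close>

definition pair_kernel :: "'a measure \<Rightarrow> ('a \<Rightarrow> nat) \<Rightarrow> 'a \<times> 'a \<Rightarrow> real" where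
  "pair_kernel M b z = (if b (fst z) = b (snd z) then 1 / sqrt (class_measure M b (fst z)) else 0)"

lemma pair_kernel_measurable [measurable]:
  assumes [measurable]: "b \<in> measurable M (count_space UNIV)"
  shows "pair_kernel M b \<in> borel_measurable (M \<Otimes>\<^sub>M M)"
proof -
  have [measurable]: "(\<lambda>x. real (b x)) \<in> borel_measurable M" by measurable
  have "pair_kernel M b = (\<lambda>z. if real (b (fst z)) = real (b (snd z))
      then 1 / sqrt (class_measure M b (fst z)) else 0)"
    by (simp add: pair_kernel_def fun_eq_iff)
  also have "\<dots> \<in> borel_measurable (M \<Otimes>\<^sub>M M)" by measurable
  finally show ?thesis .
qed

lemma class_measure_nonneg [simp]: "0 \<le> class_measure M b x"
  by (simp add: class_measure_def)

lemma pair_kernel_nonneg: "0 \<le> pair_kernel M b z"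
  by (simp add: pair_kernel_def)

lemma (in prob_space) nn_integral_pair_kernel_sq:
  assumes [measurable]: "b \<in> measurable M (count_space UNIV)"
  shows "class_measure M b x > 0 \<Longrightarrow> x \<in> space M \<Longrightarrow> (\<integral>\<^sup>+y. ennreal ((pair_kernel M b (x, y))\<^sup>2) \<partial>M) = 1"
    and "(\<integral>\<^sup>+z. ennreal ((pair_kernel M b z)\<^sup>2) \<partial>(M \<Otimes>\<^sub>M M)) = 1"
proof -
  show *: "(\<integral>\<^sup>+y. ennreal ((pair_kernel M b (x, y))\<^sup>2) \<partial>M) = 1"
    if p: "class_measure M b x > 0" and x: "x \<in> space M" for x
  proof -
    let ?A = "{y \<in> space M. b y = b x}"
    have "(\<integral>\<^sup>+y. ennreal ((pair_kernel M b (x, y))\<^sup>2) \<partial>M)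
        = (\<integral>\<^sup>+y. ennreal (1 / class_measure M b x) * indicator ?A y \<partial>M)"
      using p by (intro nn_integral_cong) (auto simp: pair_kernel_def power_divide indicator_def)
    also have "\<dots> = ennreal (1 / class_measure M b x) * emeasure M ?A"
      by (rule nn_integral_cmult_indicator) measurable
    also have "\<dots> = ennreal (1 / class_measure M b x * class_measure M b x)"
      using p by (subst ennreal_mult) (auto simp: emeasure_eq_measure class_measure_def)
    finally show ?thesis using p by simp
  qed
  have "(\<integral>\<^sup>+z. ennreal ((pair_kernel M b z)\<^sup>2) \<partial>(M \<Otimes>\<^sub>M M))
      = (\<integral>\<^sup>+x. \<integral>\<^sup>+y. ennreal ((pair_kernel M b (x, y))\<^sup>2) \<partial>M \<partial>M)"
    by (rule nn_integral_fst[symmetric]) measurable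
  also have "\<dots> = (\<integral>\<^sup>+x. 1 \<partial>M)"
    by (rule nn_integral_cong_AE) (use AE_class_measure_pos[OF assms] AE_space in \<open>eventually_elim, simp add: *\<close>)
  also have "\<dots> = 1" by (simp add: emeasure_space_1)
  finally show "(\<integral>\<^sup>+z. ennreal ((pair_kernel M b z)\<^sup>2) \<partial>(M \<Otimes>\<^sub>M M)) = 1" .
qed

lemma (in prob_space) pair_kernel_sq_integral:
  assumes [measurable]: "b \<in> measurable M (count_space UNIV)"
  shows "integrable (M \<Otimes>\<^sub>M M) (\<lambda>z. (pair_kernel M b z)\<^sup>2)"
    and "(\<integral>z. (pair_kernel M b z)\<^sup>2 \<partial>(M \<Otimes>\<^sub>M M)) = 1"
proof -
  show "integrable (M \<Otimes>\<^sub>M M) (\<lambda>z. (pair_kernel M b z)\<^sup>2)"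
    by (rule integrableI_nonneg) (auto simp: nn_integral_pair_kernel_sq(2)[OF assms])
  show "(\<integral>z. (pair_kernel M b z)\<^sup>2 \<partial>(M \<Otimes>\<^sub>M M)) = 1"
    by (subst integral_eq_nn_integral) (auto simp: nn_integral_pair_kernel_sq(2)[OF assms])
qed

text \<open>The geometric mean of \<open>p\<close> and \<open>p'\<close> is at most the larger of
  them, and the quotient of \<open>q\<close> by the smaller is at most 1. In the application
  \<open>p\<close> and \<open>p'\<close> are the measures of two classes and \<open>q\<close> that
  of a part common to both, up to translation.\<close>

lemma ratio_product_bound:
  fixes p p' q :: real
  assumes "0 < p" "0 < p'" "0 \<le> q" "q \<le> p" "q \<le> p'"
  shows "q / p + q / p' - 1 \<le> q * (1 / sqrt p * (1 / sqrt p'))"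
proof -
  have *: "q / p + q / p' - 1 \<le> q * (1 / sqrt p * (1 / sqrt p'))"
    if "0 < p" "p \<le> p'" "0 \<le> q" "q \<le> p" for p p' q :: real
  proof -
    have "sqrt p * sqrt p' \<le> sqrt p' * sqrt p'" using that by (intro mult_right_mono) auto
    then have "1 / p' \<le> 1 / (sqrt p * sqrt p')" using that by (intro divide_left_mono) auto
    then have "q * (1 / p') \<le> q * (1 / (sqrt p * sqrt p'))" using that by (intro mult_left_mono)
    moreover have "q / p \<le> 1" using that by simp
    ultimately show ?thesis by simp
  qed
  show ?thesis
  proof (cases "p \<le> p'")
    case True
    then show ?thesis using *[of p p' q] assms by simp
  next
    case False
    then have "q / p' + q / p - 1 \<le> q * (1 / sqrt p' * (1 / sqrt p))"
      using *[of p' p q] assms by simp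
    then show ?thesis by (simp add: mult.commute add.commute)
  qed
qed

context mp_action begin

lemma mp_action_diagonal: "mp_action (M \<Otimes>\<^sub>M M) G (diagonal_action \<phi>)"
proof -
  interpret P: pair_prob_space M M by unfold_locales
  interpret Q: prob_space "M \<Otimes>\<^sub>M M" by (rule P.prob_space_axioms)
  have meas: "diagonal_action \<phi> g \<in> M \<Otimes>\<^sub>M M \<rightarrow>\<^sub>M M \<Otimes>\<^sub>M M" if "g \<in> carrier G" for g
  proof -
    note [measurable] = act_measurable[OF that]
    show ?thesis unfolding diagonal_action_def map_prod_def by measurable
  qed
  show ?thesis
  proof unfold_locales
    show "countable (carrier G)" by (rule countable_carrier)
    fix g assume g: "g \<in> carrier G"
    show "diagonal_action \<phi> g \<in> M \<Otimes>\<^sub>M M \<rightarrow>\<^sub>M M \<Otimes>\<^sub>M M" by (rule meas[OF g])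
    have "distr M M (\<phi> g) \<Otimes>\<^sub>M distr M M (\<phi> g)
        = distr (M \<Otimes>\<^sub>M M) (M \<Otimes>\<^sub>M M) (\<lambda>(x, y). (\<phi> g x, \<phi> g y))"
      by (intro pair_measure_distr act_measurable g)
         (simp add: act_distr[OF g] sigma_finite_measure_axioms)
    then show "distr (M \<Otimes>\<^sub>M M) (M \<Otimes>\<^sub>M M) (diagonal_action \<phi> g) = M \<Otimes>\<^sub>M M"
      by (simp add: act_distr[OF g] diagonal_action_def map_prod_def)
  qed (auto simp: diagonal_action_def space_pair_measure act_inv act_mult act_one)
qed

text \<open>Over \<open>x\<close>, the two kernels are supported on the class of \<open>x\<close>
  and on the preimage of the class of \<open>\<phi> g x\<close>, and constant there. By
  \<open>eq\<close> both sets contain the part of the class of \<open>x\<close> with the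
  \<open>W\<close>-value of \<open>x\<close>, of measure \<open>q x\<close>, which bounds the inner
  product of the sections from below. Both kernels have norm 1, so this bounds their
  distance.\<close>

lemma pair_kernel_almost_invariant_bound:
  assumes b [measurable]: "b \<in> measurable M (count_space UNIV)"
    and W [measurable]: "W \<in> measurable M (count_space UNIV)"
    and g: "g \<in> carrier G"
    and eq: "\<And>x y. \<lbrakk>x \<in> space M; y \<in> space M; W x = W y\<rbrakk> \<Longrightarrow> b x = b y \<longleftrightarrow> b (\<phi> g x) = b (\<phi> g y)"
  shows "(\<integral>z. (pair_kernel M b (diagonal_action \<phi> g z) - pair_kernel M b z)\<^sup>2 \<partial>(M \<Otimes>\<^sub>M M))
    \<le> 4 - 2 * ((\<integral>x. class_ratio M b W x \<partial>M) + (\<integral>x. class_ratio M b (\<lambda>y. W (\<phi> (inv g) y)) x \<partial>M))"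
proof -
  interpret P: pair_prob_space M M by unfold_locales
  interpret D: mp_action "M \<Otimes>\<^sub>M M" G "diagonal_action \<phi>" by (rule mp_action_diagonal)
  note [measurable] = act_measurable[OF g] act_measurable[OF inv_closed[OF g]] D.act_measurable[OF g]
  define k where "k = pair_kernel M b"
  define k' where "k' z = k (diagonal_action \<phi> g z)" for z
  have [measurable]: "k \<in> borel_measurable (M \<Otimes>\<^sub>M M)" "k' \<in> borel_measurable (M \<Otimes>\<^sub>M M)"
    unfolding k_def k'_def[abs_def] by measurable
  have k2: "integrable (M \<Otimes>\<^sub>M M) (\<lambda>z. (k z)\<^sup>2)" "(\<integral>z. (k z)\<^sup>2 \<partial>(M \<Otimes>\<^sub>M M)) = 1"
    unfolding k_def by (rule pair_kernel_sq_integral[OF b])+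
  have k'2: "integrable (M \<Otimes>\<^sub>M M) (\<lambda>z. (k' z)\<^sup>2)" "(\<integral>z. (k' z)\<^sup>2 \<partial>(M \<Otimes>\<^sub>M M)) = 1"
    unfolding k'_def using D.integrable_act[OF g k2(1)] D.integral_act[OF g, of "\<lambda>z. (k z)\<^sup>2"] k2(2) by auto
  have k0: "0 \<le> k z" "0 \<le> k' z" for z by (simp_all add: k_def k'_def pair_kernel_nonneg)
  have kk': "integrable (M \<Otimes>\<^sub>M M) (\<lambda>z. k z * k' z)"
  proof (rule Bochner_Integration.integrable_bound)
    show "integrable (M \<Otimes>\<^sub>M M) (\<lambda>z. (k z)\<^sup>2 + (k' z)\<^sup>2)" using k2 k'2 by simp
    have "k z * k' z \<le> (k z)\<^sup>2 + (k' z)\<^sup>2" for z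
    proof -
      have "2 * (k z * k' z) \<le> (k z)\<^sup>2 + (k' z)\<^sup>2"
        using sum_squares_bound[of "k z" "k' z"] by simp
      moreover have "0 \<le> k z * k' z" using k0 by simp
      ultimately show ?thesis by linarith
    qed
    then show "AE z in M \<Otimes>\<^sub>M M. norm (k z * k' z) \<le> norm ((k z)\<^sup>2 + (k' z)\<^sup>2)"
      using k0 by auto
  qed measurable
  define W' where "W' = (\<lambda>y. W (\<phi> (inv g) y))"
  have [measurable]: "W' \<in> measurable M (count_space UNIV)" unfolding W'_def by measurable
  define q where "q x = measure M {y\<in>space M. b y = b x \<and> W y = W x}" for x
  \<comment> \<open>With \<open>W\<close> transported by the inverse of \<open>g\<close>, the number
    \<open>q x\<close> is also the measure of a \<open>W'\<close>-piece inside the class of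
    \<open>\<phi> g x\<close>; both directions of \<open>eq\<close> enter.\<close>
  have q': "class_ratio M b W' (\<phi> g x) = q x / class_measure M b (\<phi> g x)"
    and q'_le: "q x \<le> class_measure M b (\<phi> g x)" if x: "x \<in> space M" for x
  proof -
    let ?A = "{y\<in>space M. b y = b (\<phi> g x) \<and> W' y = W' (\<phi> g x)}"
    have "{y \<in> space M. \<phi> g y \<in> ?A} = {y\<in>space M. b y = b x \<and> W y = W x}"
      using eq x g by (auto simp: W'_def act_inv act_space)
    moreover have "measure M {y \<in> space M. \<phi> g y \<in> ?A} = measure M ?A"
      by (rule measure_act[OF g]) measurable
    ultimately have *: "measure M ?A = q x" by (simp add: q_def)
    then show "class_ratio M b W' (\<phi> g x) = q x / class_measure M b (\<phi> g x)"
      by (simp add: class_ratio_def)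
    show "q x \<le> class_measure M b (\<phi> g x)"
      unfolding *[symmetric] class_measure_def by (intro finite_measure_mono) auto
  qed
  have q_le: "q x \<le> class_measure M b x" for x
    unfolding q_def class_measure_def by (intro finite_measure_mono) auto
  have pos: "AE x in M. class_measure M b (\<phi> g x) > 0"
    using AE_act[OF AE_class_measure_pos[OF b]] by eventually_elim (use g in blast)
  have "(\<integral>x. class_ratio M b W x + class_ratio M b W' (\<phi> g x) - 1 \<partial>M)
      \<le> (\<integral>x. (\<integral>y. k (x, y) * k' (x, y) \<partial>M) \<partial>M)"
  proof (rule integral_mono_AE)
    show "integrable M (\<lambda>x. class_ratio M b W x + class_ratio M b W' (\<phi> g x) - 1)"
      using integrable_act[OF g, of "class_ratio M b W'"] by simp
    show "integrable M (\<lambda>x. \<integral>y. k (x, y) * k' (x, y) \<partial>M)"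
      using P.integrable_fst'[OF kk'] .
    show "AE x in M. class_ratio M b W x + class_ratio M b W' (\<phi> g x) - 1 \<le> (\<integral>y. k (x, y) * k' (x, y) \<partial>M)"
      using P.AE_integrable_fst'[OF kk'] AE_class_measure_pos[OF b] pos AE_space
    proof eventually_elim
      case (elim x)
      note x = elim(4)
      let ?A = "{y\<in>space M. b y = b x \<and> W y = W x}"
      let ?c = "1 / sqrt (class_measure M b x) * (1 / sqrt (class_measure M b (\<phi> g x)))"
      have "class_ratio M b W x + class_ratio M b W' (\<phi> g x) - 1
          = q x / class_measure M b x + q x / class_measure M b (\<phi> g x) - 1"
        using q'[OF x] by (simp add: class_ratio_def q_def)
      also have "\<dots> \<le> q x * ?c"
        using elim q_le q'_le[OF x] by (intro ratio_product_bound) (auto simp: q_def)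
      also have "\<dots> = (\<integral>y. indicator ?A y * ?c \<partial>M)"
        by (simp add: q_def)
      also have "\<dots> \<le> (\<integral>y. k (x, y) * k' (x, y) \<partial>M)"
      proof (rule integral_mono)
        show "integrable M (\<lambda>y. indicator ?A y * ?c)"
          by (intro integrable_mult_left integrable_real_indicator) (auto simp: emeasure_eq_measure)
        show "integrable M (\<lambda>y. k (x, y) * k' (x, y))" by (rule elim(1))
        fix y assume y: "y \<in> space M"
        show "indicator ?A y * ?c \<le> k (x, y) * k' (x, y)"
        proof (cases "y \<in> ?A")
          case True
          then have "b (\<phi> g x) = b (\<phi> g y)" using eq[OF x y] by auto
          then show ?thesis using True by (simp add: k_def k'_def pair_kernel_def diagonal_action_def)
        qed (use k0 in simp)
      qed
      finally show ?case .
    qed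
  qed
  also have "\<dots> = (\<integral>z. k z * k' z \<partial>(M \<Otimes>\<^sub>M M))" by (rule P.integral_fst'[OF kk'])
  finally have "(\<integral>x. class_ratio M b W x \<partial>M) + (\<integral>x. class_ratio M b W' x \<partial>M) - 1 \<le> (\<integral>z. k z * k' z \<partial>(M \<Otimes>\<^sub>M M))"
    using integrable_act[OF g, of "class_ratio M b W'"] integral_act[OF g, of "class_ratio M b W'"]
    by (simp add: prob_space)
  moreover have "(\<integral>z. (k' z - k z)\<^sup>2 \<partial>(M \<Otimes>\<^sub>M M)) = 2 - 2 * (\<integral>z. k z * k' z \<partial>(M \<Otimes>\<^sub>M M))"
  proof -
    have "(\<integral>z. (k' z - k z)\<^sup>2 \<partial>(M \<Otimes>\<^sub>M M)) = (\<integral>z. (k' z)\<^sup>2 + (k z)\<^sup>2 - 2 * (k z * k' z) \<partial>(M \<Otimes>\<^sub>M M))"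
      by (simp add: power2_diff algebra_simps)
    also have "\<dots> = 2 - 2 * (\<integral>z. k z * k' z \<partial>(M \<Otimes>\<^sub>M M))"
      using k2 k'2 kk' by simp
    finally show ?thesis .
  qed
  ultimately show ?thesis unfolding k'_def k_def W'_def by simp
qed

lemma pair_kernel_almost_invariant:
  fixes b :: "nat \<Rightarrow> 'a \<Rightarrow> nat" and W :: "'a \<Rightarrow> nat"
  assumes sb: "standard_borel_space M"
    and b [measurable]: "\<And>n. b n \<in> measurable M (count_space UNIV)"
    and refine: "\<And>n x y. b (Suc n) x = b (Suc n) y \<Longrightarrow> b n x = b n y"
    and X1: "AE x in M. x \<in> X1"
    and inj: "\<And>x y. \<lbrakk>x \<in> X1; y \<in> X1; \<And>n. b n x = b n y\<rbrakk> \<Longrightarrow> x = y"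
    and W [measurable]: "W \<in> measurable M (count_space UNIV)"
    and g: "g \<in> carrier G"
    and eq: "\<And>n x y. \<lbrakk>x \<in> space M; y \<in> space M; W x = W y\<rbrakk> \<Longrightarrow> b n x = b n y \<longleftrightarrow> b n (\<phi> g x) = b n (\<phi> g y)"
  shows "(\<lambda>n. \<integral>z. (pair_kernel M (b n) (diagonal_action \<phi> g z) - pair_kernel M (b n) z)\<^sup>2 \<partial>(M \<Otimes>\<^sub>M M)) \<longlonglongrightarrow> 0"
proof -
  note [measurable] = act_measurable[OF inv_closed[OF g]]
  let ?R = "\<lambda>W n. \<integral>x. class_ratio M (b n) W x \<partial>M"
  have "?R W \<longlonglongrightarrow> 1"
    by (rule class_ratio_tendsto[OF sb b refine X1 inj W])
  moreover have "?R (\<lambda>y. W (\<phi> (inv g) y)) \<longlonglongrightarrow> 1"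
    by (rule class_ratio_tendsto[OF sb b refine X1 inj]) auto
  ultimately have "(\<lambda>n. 4 - 2 * (?R W n + ?R (\<lambda>y. W (\<phi> (inv g) y)) n)) \<longlonglongrightarrow> 4 - 2 * (1 + 1)"
    by (intro tendsto_intros)
  then have lim: "(\<lambda>n. 4 - 2 * (?R W n + ?R (\<lambda>y. W (\<phi> (inv g) y)) n)) \<longlonglongrightarrow> 0" by simp
  show ?thesis
  proof (rule tendsto_sandwich[OF _ _ tendsto_const lim]; intro always_eventually allI)
    fix n
    show "(\<integral>z. (pair_kernel M (b n) (diagonal_action \<phi> g z) - pair_kernel M (b n) z)\<^sup>2 \<partial>(M \<Otimes>\<^sub>M M))
      \<le> 4 - 2 * (?R W n + ?R (\<lambda>y. W (\<phi> (inv g) y)) n)"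
      by (rule pair_kernel_almost_invariant_bound[OF b W g eq])
  qed simp
qed

end

section \<open>The invariant pseudometric\<close>

text \<open>Values in \<open>ennreal\<close> spare a separate treatment of exceptional points, over
  which a section need not be square integrable.\<close>

definition sq_dist :: "'a measure \<Rightarrow> ('a \<Rightarrow> real) \<Rightarrow> ('a \<Rightarrow> real) \<Rightarrow> ennreal" where
  "sq_dist M u v = (\<integral>\<^sup>+z. ennreal ((u z - v z)\<^sup>2) \<partial>M)"

lemma sq_dist_commute: "sq_dist M u v = sq_dist M v u"
  by (simp add: sq_dist_def power2_commute)

lemma sq_dist_triangle:
  assumes [measurable]: "u \<in> borel_measurable M" "v \<in> borel_measurable M" "w \<in> borel_measurable M"
  shows "sq_dist M u w \<le> 2 * sq_dist M u v + 2 * sq_dist M v w"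
proof -
  have "(u z - w z)\<^sup>2 \<le> 2 * (u z - v z)\<^sup>2 + 2 * (v z - w z)\<^sup>2" for z
    using sum_squares_bound[of "u z - v z" "v z - w z"] by (simp add: power2_eq_square algebra_simps)
  then have "sq_dist M u w \<le> (\<integral>\<^sup>+z. 2 * ennreal ((u z - v z)\<^sup>2) + 2 * ennreal ((v z - w z)\<^sup>2) \<partial>M)"
    unfolding sq_dist_def
    by (intro nn_integral_mono) (simp add: ennreal_plus[symmetric] ennreal_mult''[symmetric] ennreal_numeral[symmetric] del: ennreal_plus ennreal_numeral)
  also have "\<dots> = 2 * sq_dist M u v + 2 * sq_dist M v w"
    by (simp add: sq_dist_def nn_integral_add nn_integral_cmult)
  finally show ?thesis .
qed

definition kernel_dist :: "'a measure \<Rightarrow> ('a \<times> 'a \<Rightarrow> real) \<Rightarrow> 'a \<Rightarrow> 'a \<Rightarrow> ennreal" where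
  "kernel_dist M h x y = sq_dist M (\<lambda>z. h (x, z)) (\<lambda>z. h (y, z))"

definition kernel_error :: "'a measure \<Rightarrow> ('a \<Rightarrow> nat) \<Rightarrow> ('a \<times> 'a \<Rightarrow> real) \<Rightarrow> 'a \<Rightarrow> ennreal" where
  "kernel_error M b h x = sq_dist M (\<lambda>z. pair_kernel M b (x, z)) (\<lambda>z. h (x, z))"

text \<open>
  The radii \<open>1/250\<close> and \<open>2/125\<close> are \<open>4 \<eta>\<close> and \<open>16 \<eta>\<close>, where \<open>\<eta> = 1/1000\<close> bounds the error \<open>kernel_error\<close> at good points;
  squared distances satisfy the triangle inequality only with a factor 2.
\<close>

definition regular_point :: "'a measure \<Rightarrow> ('a \<times> 'a \<Rightarrow> real) \<Rightarrow> real \<Rightarrow> 'a \<Rightarrow> bool" where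
  "regular_point M h c x \<longleftrightarrow>
     c \<le> measure M {y \<in> space M. kernel_dist M h x y \<le> ennreal (2/125)} \<and>
     c \<le> measure M {y \<in> space M. kernel_dist M h x y \<le> ennreal (1/250)} \<and>
     (\<forall>y\<in>space M. \<forall>z\<in>space M.
        c \<le> measure M {w \<in> space M. kernel_dist M h z w \<le> ennreal (1/250)} \<and>
        kernel_dist M h x y \<le> ennreal (2/125) \<and> kernel_dist M h y z \<le> ennreal (2/125) \<longrightarrow>
        kernel_dist M h x z \<le> ennreal (2/125))"

lemma regular_point_trans:
  assumes "regular_point M h c x" "regular_point M h c z" "y \<in> space M" "z \<in> space M"
    and "kernel_dist M h x y \<le> ennreal (2/125)" "kernel_dist M h y z \<le> ennreal (2/125)"
  shows "kernel_dist M h x z \<le> ennreal (2/125)"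
  using assms unfolding regular_point_def by blast

context prob_space begin

lemma kernel_dist_measurable [measurable]:
  assumes [measurable]: "h \<in> borel_measurable (M \<Otimes>\<^sub>M M)"
  shows "(\<lambda>p. kernel_dist M h (fst p) (snd p)) \<in> borel_measurable (M \<Otimes>\<^sub>M M)"
  unfolding kernel_dist_def sq_dist_def by measurable

lemma kernel_error_measurable [measurable]:
  assumes [measurable]: "b \<in> measurable M (count_space UNIV)" "h \<in> borel_measurable (M \<Otimes>\<^sub>M M)"
  shows "kernel_error M b h \<in> borel_measurable M"
  unfolding kernel_error_def[abs_def] sq_dist_def by measurable

lemma kernel_dist_triangle:
  assumes [measurable]: "h \<in> borel_measurable (M \<Otimes>\<^sub>M M)" and "x \<in> space M" "y \<in> space M" "z \<in> space M"
  shows "kernel_dist M h x z \<le> 2 * kernel_dist M h x y + 2 * kernel_dist M h y z"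
  unfolding kernel_dist_def
  using assms by (intro sq_dist_triangle) (auto intro: measurable_compose[OF measurable_Pair1'])

lemma kernel_dist_commute: "kernel_dist M h x y = kernel_dist M h y x"
  unfolding kernel_dist_def by (rule sq_dist_commute)

lemma kernel_dist_refl [simp]: "kernel_dist M h x x = 0"
  by (simp add: kernel_dist_def sq_dist_def)

text \<open>Both points have the same section of the pair kernel, which serves as the intermediate
  point.\<close>

lemma kernel_dist_same_class:
  assumes [measurable]: "b \<in> measurable M (count_space UNIV)" "h \<in> borel_measurable (M \<Otimes>\<^sub>M M)"
    and xy: "x \<in> space M" "y \<in> space M" "b x = b y"
  shows "kernel_dist M h x y \<le> 2 * kernel_error M b h x + 2 * kernel_error M b h y"
proof -
  have "class_measure M b x = class_measure M b y" using xy by (simp add: class_measure_def)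
  then have "(\<lambda>z. pair_kernel M b (x, z)) = (\<lambda>z. pair_kernel M b (y, z))"
    using xy by (auto simp: pair_kernel_def fun_eq_iff)
  then have "kernel_error M b h y = sq_dist M (\<lambda>z. pair_kernel M b (x, z)) (\<lambda>z. h (y, z))"
    by (simp add: kernel_error_def)
  moreover have "kernel_dist M h x y \<le> 2 * sq_dist M (\<lambda>z. h (x, z)) (\<lambda>z. pair_kernel M b (x, z))
      + 2 * sq_dist M (\<lambda>z. pair_kernel M b (x, z)) (\<lambda>z. h (y, z))"
    unfolding kernel_dist_def
    using xy by (intro sq_dist_triangle) (auto intro: measurable_compose[OF measurable_Pair1'])
  ultimately show ?thesis by (simp add: kernel_error_def sq_dist_commute)
qed

text \<open>Sections of the pair kernel over two classes have disjoint supports, so their squared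
  distance is at least 1, the squared norm of the first. The factors 4, 4 and 2 come from passing
  through the sections of \<open>h\<close> at \<open>x\<close> and at \<open>y\<close> by repeated
  triangle inequalities.\<close>

lemma kernel_dist_different_class:
  assumes [measurable]: "b \<in> measurable M (count_space UNIV)" "h \<in> borel_measurable (M \<Otimes>\<^sub>M M)"
    and xy: "x \<in> space M" "y \<in> space M" "b x \<noteq> b y" and pos: "class_measure M b x > 0"
  shows "1 \<le> 4 * kernel_error M b h x + 4 * kernel_dist M h x y + 2 * kernel_error M b h y"
proof -
  let ?k = "\<lambda>x z. pair_kernel M b (x, z)" and ?h = "\<lambda>x z. h (x, z)"
  have [measurable]: "?k v \<in> borel_measurable M" "?h v \<in> borel_measurable M" if "v \<in> space M" for v
    using that by (auto intro: measurable_compose[OF measurable_Pair1'])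
  have "1 = (\<integral>\<^sup>+z. ennreal ((?k x z)\<^sup>2) \<partial>M)"
    using nn_integral_pair_kernel_sq(1)[OF assms(1) pos xy(1)] by simp
  also have "\<dots> \<le> sq_dist M (?k x) (?k y)"
    unfolding sq_dist_def using xy by (intro nn_integral_mono ennreal_leI) (auto simp: pair_kernel_def)
  also have "\<dots> \<le> 2 * sq_dist M (?k x) (?h y) + 2 * sq_dist M (?h y) (?k y)"
    using xy by (intro sq_dist_triangle) auto
  also have "\<dots> \<le> 2 * (2 * sq_dist M (?k x) (?h x) + 2 * sq_dist M (?h x) (?h y)) + 2 * sq_dist M (?h y) (?k y)"
    using xy by (intro add_mono mult_left_mono sq_dist_triangle order_refl) auto
  finally show ?thesis
    by (simp add: kernel_error_def kernel_dist_def sq_dist_commute[of M "?h y" "?k y"] distrib_left mult.assoc[symmetric])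
qed

end

section \<open>From errors in mean to uniform sizes of balls\<close>

context mp_action begin

lemma ergodic_AE:
  assumes erg: "ergodic_action G M \<phi>"
    and A: "A \<in> sets M" "measure M A > 0" "\<And>g x. \<lbrakk>g \<in> carrier G; x \<in> A\<rbrakk> \<Longrightarrow> \<phi> g x \<in> A"
  shows "AE x in M. x \<in> A"
proof -
  have AM: "A \<subseteq> space M" using A(1) by (rule sets.sets_into_space)
  have "\<forall>g\<in>carrier G. \<phi> g ` A = A"
  proof (intro ballI equalityI subsetI)
    fix g x assume g: "g \<in> carrier G" and "x \<in> A"
    then have "\<phi> (inv g) x \<in> A" "x = \<phi> g (\<phi> (inv g) x)" using A(3) g AM act_inv' by auto
    then show "x \<in> \<phi> g ` A" by blast
  qed (use A(3) in auto)
  then have "measure M A = 0 \<or> measure M A = 1"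
    using bspec[OF erg[unfolded ergodic_action_def] A(1)] by (rule mp[rotated])
  then have "measure M A = 1" using A(2) by linarith
  then show ?thesis using A(1) by (simp add: prob_eq_1)
qed

text \<open>Moving the integration variable by \<open>\<phi> g\<close> does not change the integral;
  after that, invariance of \<open>h\<close> applies in both coordinates.\<close>

lemma kernel_dist_act:
  assumes [measurable]: "h \<in> borel_measurable (M \<Otimes>\<^sub>M M)"
    and inv: "\<And>g x y. \<lbrakk>g \<in> carrier G; x \<in> space M; y \<in> space M\<rbrakk> \<Longrightarrow> h (\<phi> g x, \<phi> g y) = h (x, y)"
    and g: "g \<in> carrier G" and xy: "x \<in> space M" "y \<in> space M"
  shows "kernel_dist M h (\<phi> g x) (\<phi> g y) = kernel_dist M h x y"
proof -
  have [measurable]: "(\<lambda>z. h (v, z)) \<in> borel_measurable M" if "v \<in> space M" for v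
    using that by (auto intro: measurable_compose[OF measurable_Pair1'])
  have "kernel_dist M h (\<phi> g x) (\<phi> g y)
      = (\<integral>\<^sup>+z. ennreal ((h (\<phi> g x, \<phi> g z) - h (\<phi> g y, \<phi> g z))\<^sup>2) \<partial>M)"
    unfolding kernel_dist_def sq_dist_def
    using xy g act_space by (intro nn_integral_act[symmetric]) auto
  also have "\<dots> = kernel_dist M h x y"
    unfolding kernel_dist_def sq_dist_def using xy g by (intro nn_integral_cong) (simp add: inv)
  finally show ?thesis .
qed

text \<open>
  By ergodicity, it is enough to find one class \<open>A\<close> of \<open>b\<close> and many points \<open>x\<close> of \<open>A\<close> for which the
  small ball around \<open>x\<close> is almost as large as \<open>A\<close>, whereas the large one is not much larger than \<open>A\<close>:
  then the same bounds hold around almost every point, so that two small balls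
  with close centres meet, which makes closeness transitive.
\<close>

lemma kernel_equivalence:
  fixes h :: "'a \<times> 'a \<Rightarrow> real" and b :: "'a \<Rightarrow> nat"
  assumes erg: "ergodic_action G M \<phi>"
    and b [measurable]: "b \<in> measurable M (count_space UNIV)"
    and h [measurable]: "h \<in> borel_measurable (M \<Otimes>\<^sub>M M)"
    and inv: "\<And>g x y. \<lbrakk>g \<in> carrier G; x \<in> space M; y \<in> space M\<rbrakk> \<Longrightarrow> h (\<phi> g x, \<phi> g y) = h (x, y)"
    and close: "sq_dist (M \<Otimes>\<^sub>M M) (pair_kernel M b) h \<le> ennreal (1/40000)"
  obtains c where "c > 0"
    "AE x in M. regular_point M h c x"
proof -
  interpret P: pair_prob_space M M by unfold_locales
  let ?k = "pair_kernel M b"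
  let ?D = "kernel_dist M h"
  have sec [measurable]: "(\<lambda>z. f (v, z)) \<in> borel_measurable M"
    if "f \<in> borel_measurable (M \<Otimes>\<^sub>M M)" "v \<in> space M" for v and f :: "'a \<times> 'a \<Rightarrow> real"
    using that by (auto intro: measurable_compose[OF measurable_Pair1'])
  \<comment> \<open>Row errors control the section over a given point. Column errors count the
    points outside a class \<open>A\<close> whose sections come close to those over
    \<open>A\<close>. Their sum \<open>E\<close> selects one class that is good for both.\<close>
  define col where "col z = (\<integral>\<^sup>+y. ennreal ((?k (y, z) - h (y, z))\<^sup>2) \<partial>M)" for z
  have col_meas [measurable]: "col \<in> borel_measurable M"
    unfolding col_def[abs_def] by measurable
  have row_meas [measurable]: "kernel_error M b h \<in> borel_measurable M" by measurable
  have row_int: "(\<integral>\<^sup>+x. kernel_error M b h x \<partial>M) = sq_dist (M \<Otimes>\<^sub>M M) ?k h"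
    unfolding kernel_error_def sq_dist_def by (rule nn_integral_fst) measurable
  have col_int: "(\<integral>\<^sup>+z. col z \<partial>M) = sq_dist (M \<Otimes>\<^sub>M M) ?k h"
    unfolding col_def sq_dist_def by (rule P.nn_integral_snd) measurable
  define E where "E x = kernel_error M b h x + col x" for x
  have E_meas [measurable]: "E \<in> borel_measurable M" unfolding E_def[abs_def] by measurable
  have "(\<integral>\<^sup>+x. E x \<partial>M) \<le> ennreal (1/40000) + ennreal (1/40000)"
    unfolding E_def using close by (simp add: nn_integral_add row_int col_int add_mono)
  then have E_int: "(\<integral>\<^sup>+x. E x \<partial>M) \<le> ennreal (1/20000)"
    by (simp add: ennreal_plus[symmetric] del: ennreal_plus)
  define cls where "cls m = {x \<in> space M. b x = m}" for m
  have cls_meas [measurable]: "cls m \<in> sets M" for m unfolding cls_def by measurable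
  \<comment> \<open>The mean of \<open>E\<close> is at most half of 1/10000, so its conditional mean
    cannot exceed 1/10000 on every class of positive measure.\<close>
  have "\<exists>m. measure M (cls m) > 0 \<and> (\<integral>\<^sup>+x. E x * indicator (cls m) x \<partial>M) \<le> ennreal (1/10000 * measure M (cls m))"
  proof (rule ccontr)
    assume no: "\<not> ?thesis"
    have *: "ennreal (1/10000) * emeasure M (cls m) \<le> (\<integral>\<^sup>+x. E x * indicator (cls m) x \<partial>M)" for m
    proof (cases "measure M (cls m) > 0")
      case True
      then show ?thesis using no by (auto simp: not_le emeasure_eq_measure ennreal_mult'[symmetric] intro: less_imp_le)
    next
      case False
      then have "emeasure M (cls m) = 0" by (simp add: emeasure_eq_measure zero_less_measure_iff)
      then show ?thesis by simp
    qed
    have "ennreal (1/10000) = ennreal (1/10000) * emeasure M (space M)" by (simp add: emeasure_space_1)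
    also have "\<dots> = (\<Sum>m. ennreal (1/10000) * emeasure M (cls m))"
      using emeasure_code[OF b sets.top] by (simp add: cls_def Int_absorb1 Collect_conj_eq Int_assoc[symmetric])
    also have "\<dots> \<le> (\<Sum>m. \<integral>\<^sup>+x. E x * indicator (cls m) x \<partial>M)"
      by (intro suminf_le * summableI)
    also have "\<dots> = (\<Sum>m. emeasure (density M E) (space M \<inter> {x\<in>space (density M E). b x = m}))"
      by (intro suminf_cong) (simp add: emeasure_density cls_def[symmetric] Int_absorb1 sets.sets_into_space[OF cls_meas])
    also have "\<dots> = emeasure (density M E) (space M)"
      by (rule emeasure_code[symmetric]) auto
    also have "\<dots> = (\<integral>\<^sup>+x. E x \<partial>M)"
      by (simp add: emeasure_density cong: nn_integral_cong)
    also have "\<dots> \<le> ennreal (1/20000)" by (rule E_int)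
    finally show False by simp
  qed
  then obtain m where m: "measure M (cls m) > 0"
    "(\<integral>\<^sup>+x. E x * indicator (cls m) x \<partial>M) \<le> ennreal (1/10000 * measure M (cls m))" by blast
  define A where "A = cls m"
  define a where "a = measure M A"
  have a: "a > 0" using m(1) by (simp add: a_def A_def)
  have A [measurable]: "A \<in> sets M" unfolding A_def by measurable
  have A_b: "b x = m" "x \<in> space M" if "x \<in> A" for x using that by (auto simp: A_def cls_def)
  have A_class: "class_measure M b x = a" if "x \<in> A" for x
    using A_b[OF that] by (simp add: class_measure_def a_def A_def cls_def)
  have row_A: "(\<integral>\<^sup>+x. kernel_error M b h x * indicator A x \<partial>M) \<le> ennreal (1/10000 * a)"
    and col_A: "(\<integral>\<^sup>+x. col x * indicator A x \<partial>M) \<le> ennreal (1/10000 * a)"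
    unfolding a_def A_def
    by (rule order_trans[OF nn_integral_mono m(2)], simp add: E_def mult_right_mono)+
  \<comment> \<open>By Markov's inequality at most a tenth of \<open>A\<close> is lost, 1/10000
    being a tenth of 1/1000.\<close>
  define S where "S = {x \<in> A. kernel_error M b h x \<le> ennreal (1/1000)}"
  have S [measurable]: "S \<in> sets M"
  proof -
    have "S = A \<inter> {x \<in> space M. kernel_error M b h x \<le> ennreal (1/1000)}" using A_b by (auto simp: S_def)
    also have "\<dots> \<in> sets M" by measurable
    finally show ?thesis .
  qed
  have S_large: "9/10 * a \<le> measure M S"
  proof -
    have "ennreal (1/1000) * emeasure M (A - S) = (\<integral>\<^sup>+x. ennreal (1/1000) * indicator (A - S) x \<partial>M)"
      by (rule nn_integral_cmult_indicator[symmetric]) measurable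
    also have "\<dots> \<le> (\<integral>\<^sup>+x. kernel_error M b h x * indicator A x \<partial>M)"
      by (intro nn_integral_mono) (auto simp: S_def indicator_def intro: less_imp_le)
    finally have "ennreal (1/1000) * emeasure M (A - S) \<le> ennreal (1/10000 * a)"
      using row_A by (rule order_trans)
    then have "1/1000 * measure M (A - S) \<le> 1/10000 * a"
      using a by (simp add: emeasure_eq_measure ennreal_mult'[symmetric])
    moreover have "measure M (A - S) = a - measure M S"
      unfolding a_def by (intro finite_measure_Diff) (auto simp: S_def)
    ultimately show ?thesis by simp
  qed
  define ball where "ball t x = {y \<in> space M. ?D x y \<le> ennreal t}" for t x
  have ball_meas [measurable]: "ball t x \<in> sets M" if "x \<in> space M" for t x
  proof -
    have "(\<lambda>y. ?D x y) = (\<lambda>p. ?D (fst p) (snd p)) \<circ> Pair x" by auto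
    also have "\<dots> \<in> borel_measurable M"
      using that by (intro measurable_comp[OF measurable_Pair1'] kernel_dist_measurable) auto
    finally show ?thesis unfolding ball_def by measurable
  qed
  have ball_act: "measure M (ball t (\<phi> g x)) = measure M (ball t x)" if g: "g \<in> carrier G" and x: "x \<in> space M" for g x t
  proof -
    have "measure M (ball t (\<phi> g x)) = measure M {y \<in> space M. \<phi> g y \<in> ball t (\<phi> g x)}"
      using g x act_space by (intro measure_act[symmetric] ball_meas)
    also have "{y \<in> space M. \<phi> g y \<in> ball t (\<phi> g x)} = ball t x"
      using g x act_space kernel_dist_act[OF h inv g x] by (auto simp: ball_def)
    finally show ?thesis .
  qed
  have ball_fun_meas [measurable]: "(\<lambda>x. measure M (ball t x)) \<in> borel_measurable M" for t
    unfolding ball_def by measurable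
  have small: "9/10 * a \<le> measure M (ball (1/250) x)" if x: "x \<in> S" for x
  proof -
    have "S \<subseteq> ball (1/250) x"
    proof
      fix y assume y: "y \<in> S"
      have xy: "x \<in> space M" "y \<in> space M" "b x = b y" using x y A_b by (auto simp: S_def)
      have "?D x y \<le> 2 * kernel_error M b h x + 2 * kernel_error M b h y"
        by (rule kernel_dist_same_class[OF b h xy])
      also have "\<dots> \<le> 2 * ennreal (1/1000) + 2 * ennreal (1/1000)"
        using x y by (intro add_mono mult_left_mono) (auto simp: S_def)
      also have "\<dots> = ennreal (1/250)"
        by (simp add: ennreal_plus[symmetric] ennreal_mult''[symmetric] ennreal_numeral[symmetric]
            del: ennreal_plus ennreal_numeral)
      finally show "y \<in> ball (1/250) x" using xy by (simp add: ball_def)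
    qed
    then have "measure M S \<le> measure M (ball (1/250) x)"
      using x A_b by (intro finite_measure_mono ball_meas) (auto simp: S_def)
    then show ?thesis using S_large by linarith
  qed
  have large: "measure M (ball (17/125) x) \<le> 11/10 * a" if x: "x \<in> S" for x
  proof -
    have xM: "x \<in> space M" and xA: "x \<in> A" using x A_b by (auto simp: S_def)
    note [measurable] = ball_meas[OF xM]
    let ?B = "ball (17/125) x - A"
    \<comment> \<open>The section of the kernel over \<open>y\<close> vanishes on \<open>A\<close>,
      where the unit section over \<open>x\<close> lives. The error at \<open>x\<close> and the
      distance to \<open>y\<close> explain at most 3/1000 + 51/125 of the squared norm 1; the rest,
      divided by 3, must be an error of \<open>y\<close> over \<open>A\<close>.\<close>
    have far: "ennreal (1/10) \<le> (\<integral>\<^sup>+z. ennreal ((?k (y, z) - h (y, z))\<^sup>2) * indicator A z \<partial>M)" (is "_ \<le> ?I")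
      if y: "y \<in> ?B" for y
    proof -
      have yM: "y \<in> space M" using y by (auto simp: ball_def)
      note [measurable] = sec[OF h xM] sec[OF h yM] sec[OF pair_kernel_measurable[OF b] xM]
        sec[OF pair_kernel_measurable[OF b] yM]
      have "b y \<noteq> m" using y yM by (auto simp: A_def cls_def)
      then have k0: "?k (y, z) = 0" if "z \<in> A" for z using A_b[OF that] by (simp add: pair_kernel_def)
      have kx0: "?k (x, z) = 0" if "z \<notin> A" "z \<in> space M" for z
        using that A_b[OF xA] by (auto simp: pair_kernel_def A_def cls_def)
      have pt: "(?k (x, z))\<^sup>2 \<le> 3 * (?k (x, z) - h (x, z))\<^sup>2 + 3 * (h (x, z) - h (y, z))\<^sup>2
          + 3 * ((?k (y, z) - h (y, z))\<^sup>2 * indicator A z)" if z: "z \<in> space M" for z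
      proof (cases "z \<in> A")
        case True
        define p q r where "p = ?k (x, z) - h (x, z)" and "q = h (x, z) - h (y, z)" and "r = h (y, z)"
        have "(p + q + r)\<^sup>2 \<le> 3 * p\<^sup>2 + 3 * q\<^sup>2 + 3 * r\<^sup>2"
          using sum_squares_bound[of p q] sum_squares_bound[of q r] sum_squares_bound[of p r]
          by (simp add: power2_eq_square algebra_simps)
        then show ?thesis using True k0[OF True] by (simp add: p_def q_def r_def)
      qed (use z kx0 in simp)
      have "1 = (\<integral>\<^sup>+z. ennreal ((?k (x, z))\<^sup>2) \<partial>M)"
        using nn_integral_pair_kernel_sq(1)[OF b _ xM] A_class[OF xA] a by simp
      also have "\<dots> \<le> (\<integral>\<^sup>+z. 3 * ennreal ((?k (x, z) - h (x, z))\<^sup>2) + 3 * ennreal ((h (x, z) - h (y, z))\<^sup>2)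
          + 3 * (ennreal ((?k (y, z) - h (y, z))\<^sup>2) * indicator A z) \<partial>M)"
      proof (rule nn_integral_mono)
        fix z assume "z \<in> space M"
        then have "ennreal ((?k (x, z))\<^sup>2) \<le> ennreal (3 * (?k (x, z) - h (x, z))\<^sup>2 + 3 * (h (x, z) - h (y, z))\<^sup>2
          + 3 * ((?k (y, z) - h (y, z))\<^sup>2 * indicator A z))"
          by (intro ennreal_leI pt)
        also have "\<dots> = 3 * ennreal ((?k (x, z) - h (x, z))\<^sup>2) + 3 * ennreal ((h (x, z) - h (y, z))\<^sup>2)
          + 3 * (ennreal ((?k (y, z) - h (y, z))\<^sup>2) * indicator A z)"
          by (cases "z \<in> A") (simp_all add: ennreal_mult'')
        finally show "ennreal ((?k (x, z))\<^sup>2) \<le> \<dots>" .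
      qed
      also have "\<dots> = 3 * kernel_error M b h x + 3 * ?D x y + 3 * ?I"
        by (simp add: nn_integral_add nn_integral_cmult kernel_error_def kernel_dist_def sq_dist_def)
      also have "\<dots> \<le> 3 * ennreal (1/1000) + 3 * ennreal (17/125) + 3 * ?I"
        using x y by (intro add_mono mult_left_mono order_refl) (auto simp: S_def ball_def)
      finally have le: "1 \<le> 3 * ennreal (1/1000) + 3 * ennreal (17/125) + 3 * ?I" .
      show ?thesis
      proof (cases ?I)
        case (real i)
        have e3: "3 * ennreal t = ennreal (3 * t)" if "0 \<le> t" for t
          using that by (simp add: ennreal_mult'')
        have "3 * ennreal (1/1000) + 3 * ennreal (17/125) + 3 * ?I
            = ennreal (3 * (1/1000)) + ennreal (3 * (17/125)) + ennreal (3 * i)"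
          using real(1) unfolding real(2) by (intro arg_cong2[where f = "(+)"] e3) auto
        also have "\<dots> = ennreal (3 * (1/1000) + 3 * (17/125) + 3 * i)"
          using real(1) by (simp add: ennreal_plus[symmetric] del: ennreal_plus)
        finally have "ennreal 1 \<le> ennreal (3 * (1/1000) + 3 * (17/125) + 3 * i)"
          using le by (simp only: ennreal_1)
        then have "1 \<le> 3 * (1/1000) + 3 * (17/125) + 3 * i" using real(1) by (subst (asm) ennreal_le_iff) auto
        then show ?thesis using real by (auto intro!: ennreal_leI)
      qed simp
    qed
    \<comment> \<open>Exchanging the integrals turns these errors into column errors over
      \<open>A\<close>, whose total is at most \<open>a\<close>/10000. Hence \<open>?B\<close> has
      measure at most \<open>a\<close>/1000, less than the tenth of \<open>a\<close> that is
      allowed.\<close>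
    have "ennreal (1/10) * emeasure M ?B = (\<integral>\<^sup>+y. ennreal (1/10) * indicator ?B y \<partial>M)"
      by (rule nn_integral_cmult_indicator[symmetric]) measurable
    also have "\<dots> \<le> (\<integral>\<^sup>+y. \<integral>\<^sup>+z. ennreal ((?k (y, z) - h (y, z))\<^sup>2) * indicator A z \<partial>M \<partial>M)"
      using far by (intro nn_integral_mono) (auto simp: indicator_def)
    also have "\<dots> = (\<integral>\<^sup>+z. \<integral>\<^sup>+y. ennreal ((?k (y, z) - h (y, z))\<^sup>2) * indicator A z \<partial>M \<partial>M)"
      by (rule P.Fubini'[symmetric]) measurable
    also have "\<dots> = (\<integral>\<^sup>+z. col z * indicator A z \<partial>M)"
    proof (rule nn_integral_cong)
      fix z assume z: "z \<in> space M"
      have "(\<lambda>y. ennreal ((?k (y, z) - h (y, z))\<^sup>2)) \<in> borel_measurable M"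
        using z by (intro measurable_compose[OF measurable_Pair2']) auto
      then show "(\<integral>\<^sup>+y. ennreal ((?k (y, z) - h (y, z))\<^sup>2) * indicator A z \<partial>M) = col z * indicator A z"
        by (simp add: col_def nn_integral_multc)
    qed
    also have "\<dots> \<le> ennreal (1/10000 * a)" by (rule col_A)
    finally have "1/10 * measure M ?B \<le> 1/10000 * a"
      using a by (simp add: emeasure_eq_measure ennreal_mult'[symmetric])
    moreover have "measure M (ball (17/125) x) \<le> measure M (A \<union> ?B)"
      by (intro finite_measure_mono) auto
    moreover have "measure M (A \<union> ?B) \<le> a + measure M ?B" unfolding a_def by (rule measure_Un_le) auto
    ultimately show ?thesis using a by simp
  qed
  have "AE x in M. x \<in> {x \<in> space M. 9/10 * a \<le> measure M (ball (1/250) x) \<and> measure M (ball (17/125) x) \<le> 11/10 * a}"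
    (is "AE x in M. x \<in> ?T")
  proof (rule ergodic_AE[OF erg])
    show "?T \<in> sets M" by measurable
    then have "measure M S \<le> measure M ?T"
      using small large A_b by (intro finite_measure_mono) (auto simp: S_def)
    then show "measure M ?T > 0" using S_large a by (auto simp: algebra_simps)
  qed (auto simp: ball_act act_space)
  then have good: "AE x in M. x \<in> space M \<and> 9/10 * a \<le> measure M (ball (1/250) x) \<and>
      measure M (ball (17/125) x) \<le> 11/10 * a" by simp
  have e_add: "2 * ennreal s + 2 * ennreal t = ennreal (2 * s + 2 * t)" if "0 \<le> s" "0 \<le> t" for s t
    using that by (simp add: ennreal_mult'')
  have tri: "?D x z \<le> ennreal (2 * s + 2 * t)"
    if "x \<in> space M" "y \<in> space M" "z \<in> space M" "?D x y \<le> ennreal s" "?D y z \<le> ennreal t" "0 \<le> s" "0 \<le> t"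
    for x y z s t
  proof -
    have "?D x z \<le> 2 * ?D x y + 2 * ?D y z" by (rule kernel_dist_triangle[OF h that(1-3)])
    also have "\<dots> \<le> 2 * ennreal s + 2 * ennreal t" using that by (intro add_mono mult_left_mono) auto
    finally show ?thesis using that by (simp add: e_add)
  qed
  show thesis
  proof (rule that[of "9/10 * a"])
    show "0 < 9/10 * a" using a by simp
    show "AE x in M. regular_point M h (9/10 * a) x"
      using good
    proof eventually_elim
      case (elim x)
      then have xM: "x \<in> space M" and x1: "9/10 * a \<le> measure M (ball (1/250) x)"
        and x2: "measure M (ball (17/125) x) \<le> 11/10 * a" by auto
      have "measure M (ball (1/250) x) \<le> measure M (ball (2/125) x)"
        using xM by (intro finite_measure_mono ball_meas) (auto simp: ball_def elim!: order_trans intro!: ennreal_leI)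
      then have 1: "9/10 * a \<le> measure M {y \<in> space M. kernel_dist M h x y \<le> ennreal (2/125)}"
        using x1 by (simp add: ball_def)
      have "?D x z \<le> ennreal (2/125)"
        if yM: "y \<in> space M" and zM: "z \<in> space M" and z1: "9/10 * a \<le> measure M (ball (1/250) z)"
          and xy: "?D x y \<le> ennreal (2/125)" and yz: "?D y z \<le> ennreal (2/125)" for y z
      proof -
        \<comment> \<open>The radii 8/125 = 2 * 2/125 + 2 * 2/125 and 17/125 = 2 * 8/125 + 2 * 1/250
          result from two triangle inequalities; the latter is the radius of the large ball.\<close>
        have xz: "?D x z \<le> ennreal (8/125)" using tri[OF xM yM zM xy yz] by simp
        have "ball (1/250) z \<subseteq> ball (17/125) x"
        proof
          fix w assume "w \<in> ball (1/250) z"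
          then have w: "w \<in> space M" "?D z w \<le> ennreal (1/250)" by (auto simp: ball_def)
          have "?D x w \<le> ennreal (2 * (8/125) + 2 * (1/250))"
            using tri[OF xM zM w(1) xz w(2)] by simp
          then show "w \<in> ball (17/125) x" using w(1) by (simp add: ball_def)
        qed
        moreover have "ball (1/250) x \<subseteq> ball (17/125) x"
          by (auto simp: ball_def elim!: order_trans intro!: ennreal_leI)
        ultimately have sub: "ball (1/250) x \<union> ball (1/250) z \<subseteq> ball (17/125) x" by blast
        \<comment> \<open>Two disjoint sets of measure at least 9/10 of \<open>a\<close> do not fit
          into 11/10 of \<open>a\<close>. A common point brings the centres within 2 * 1/250 + 2 *
          1/250 = 2/125, the bound from which the argument started.\<close>
        have "ball (1/250) x \<inter> ball (1/250) z \<noteq> {}"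
        proof
          assume "ball (1/250) x \<inter> ball (1/250) z = {}"
          then have "measure M (ball (1/250) x \<union> ball (1/250) z) = measure M (ball (1/250) x) + measure M (ball (1/250) z)"
            using xM zM by (intro finite_measure_Union ball_meas) auto
          moreover have "measure M (ball (1/250) x \<union> ball (1/250) z) \<le> measure M (ball (17/125) x)"
            using sub xM by (intro finite_measure_mono ball_meas)
          ultimately show False using x1 x2 z1 a by simp
        qed
        then obtain w where w: "w \<in> space M" "?D x w \<le> ennreal (1/250)" "?D z w \<le> ennreal (1/250)"
          by (auto simp: ball_def)
        have "?D w z \<le> ennreal (1/250)" using w(3) by (simp add: kernel_dist_commute)
        from tri[OF xM w(1) zM w(2) this] show ?thesis by simp
      qed
      then show ?case using 1 x1 unfolding regular_point_def by (auto simp: ball_def)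
    qed
  qed
qed

end

section \<open>Invariant finite partitions\<close>

lemma (in finite_measure) finite_disjoint_large_sets:
  assumes "disjoint \<A>" "\<A> \<subseteq> sets M" "0 < c" "\<And>A. A \<in> \<A> \<Longrightarrow> c \<le> measure M A"
  shows "finite \<A>"
proof -
  have "card \<B> \<le> nat \<lceil>measure M (space M) / c\<rceil>" if B: "\<B> \<subseteq> \<A>" "finite \<B>" for \<B>
  proof -
    have "real (card \<B>) * c = (\<Sum>A\<in>\<B>. c)" by simp
    also have "\<dots> \<le> (\<Sum>A\<in>\<B>. measure M A)" using assms(4) B by (intro sum_mono) auto
    also have "\<dots> = measure M (\<Union>A\<in>\<B>. A)"
      using B assms(1,2)
      by (intro finite_measure_finite_Union[symmetric])
         (auto simp: disjoint_family_on_def disjoint_def)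
    also have "\<dots> \<le> measure M (space M)"
      by (rule bounded_measure)
    finally have "real (card \<B>) \<le> measure M (space M) / c" using assms(3) by (simp add: field_simps)
    then show ?thesis by linarith
  qed
  then show ?thesis using finite_if_finite_subsets_card_bdd by metis
qed

text \<open>A Borel-Cantelli argument: the integrals are summable, so the series of the
  \<open>u k\<close> is finite almost everywhere and its terms tend to 0.\<close>

lemma (in prob_space) AE_eventually_small:
  fixes u :: "nat \<Rightarrow> 'a \<Rightarrow> ennreal"
  assumes [measurable]: "\<And>k. u k \<in> borel_measurable M"
    and le: "\<And>k. (\<integral>\<^sup>+x. u k x \<partial>M) \<le> ennreal (C * (1/2) ^ k)" and "0 < e"
  shows "AE x in M. \<forall>\<^sub>F k in sequentially. u k x \<le> ennreal e"
proof -
  have "(\<integral>\<^sup>+x. (\<Sum>k. u k x) \<partial>M) = (\<Sum>k. \<integral>\<^sup>+x. u k x \<partial>M)"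
    by (rule nn_integral_suminf) measurable
  also have "\<dots> \<le> (\<Sum>k. ennreal (\<bar>C\<bar> * (1/2) ^ k))"
    using le by (intro suminf_le summableI) (auto intro!: order_trans[OF le] ennreal_leI mult_right_mono)
  also have "\<dots> = ennreal (\<Sum>k. \<bar>C\<bar> * (1/2) ^ k)"
    by (intro suminf_ennreal2 summable_mult summable_geometric) auto
  also have "\<dots> < \<infinity>" by simp
  finally have "AE x in M. (\<Sum>k. u k x) \<noteq> \<infinity>"
    by (intro nn_integral_PInf_AE) auto
  then show ?thesis
  proof eventually_elim
    case (elim x)
    have "(\<Sum>k. u k x) < \<infinity>" using elim by (simp add: less_top)
    then have fin: "u k x < \<infinity>" for k
      using sum_le_suminf[OF summableI, of "{k}" "\<lambda>k. u k x"] by (auto intro: le_less_trans)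
    have eq: "u k x = ennreal (enn2real (u k x))" for k using fin[of k] by simp
    have "(\<Sum>k. ennreal (enn2real (u k x))) \<noteq> \<infinity>" using elim eq by simp
    then have "summable (\<lambda>k. enn2real (u k x))" by (intro summable_suminf_not_top) (auto simp: infinity_ennreal_def)
    then have "(\<lambda>k. enn2real (u k x)) \<longlonglongrightarrow> 0" by (rule summable_LIMSEQ_zero)
    then have "\<forall>\<^sub>F k in sequentially. enn2real (u k x) < e" using \<open>0 < e\<close> by (rule order_tendstoD)
    then show ?case
    proof eventually_elim
      case (elim k)
      then show ?case by (subst eq) (intro ennreal_leI less_imp_le)
    qed
  qed
qed

section \<open>Partitions into classes of close points\<close>

context mp_action begin

lemma separating_invariant_partitions_dist:
  fixes h :: "nat \<Rightarrow> 'a \<times> 'a \<Rightarrow> real" and c :: "nat \<Rightarrow> real" and t :: ennreal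
  assumes h [measurable]: "\<And>k. h k \<in> borel_measurable (M \<Otimes>\<^sub>M M)"
    and inv: "\<And>k g x y. \<lbrakk>g \<in> carrier G; x \<in> space M; y \<in> space M\<rbrakk> \<Longrightarrow> h k (\<phi> g x, \<phi> g y) = h k (x, y)"
    and X0: "X0 \<in> sets M" "AE x in M. x \<in> X0" "\<And>g x. \<lbrakk>g \<in> carrier G; x \<in> X0\<rbrakk> \<Longrightarrow> \<phi> g x \<in> X0"
    and trans: "\<And>k x y z. \<lbrakk>x \<in> X0; y \<in> X0; z \<in> X0; kernel_dist M (h k) x y \<le> t; kernel_dist M (h k) y z \<le> t\<rbrakk>
      \<Longrightarrow> kernel_dist M (h k) x z \<le> t"
    and c: "\<And>k. 0 < c k" "\<And>k x. x \<in> X0 \<Longrightarrow> c k \<le> measure M {y \<in> space M. kernel_dist M (h k) x y \<le> t}"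
    and sep: "\<And>x y. \<lbrakk>x \<in> X0; y \<in> X0; \<And>k. kernel_dist M (h k) x y \<le> t\<rbrakk> \<Longrightarrow> x = y"
  obtains P where "separating_invariant_partitions G X0 \<phi> P" "\<And>n. finite (P n)" "\<And>n. P n \<subseteq> sets M"
proof -
  have X0M: "X0 \<subseteq> space M" using X0(1) by (rule sets.sets_into_space)
  define cls where "cls k x = {y \<in> X0. kernel_dist M (h k) x y \<le> t}" for k x
  define P where "P k = cls k ` X0" for k
  have self: "x \<in> cls k x" if "x \<in> X0" for k x using that by (simp add: cls_def)
  have cls_eq: "cls k x = cls k y" if xy: "x \<in> X0" "y \<in> X0" "z \<in> cls k x" "z \<in> cls k y" for k x y z
  proof -
    have z: "z \<in> X0" "kernel_dist M (h k) x z \<le> t" "kernel_dist M (h k) y z \<le> t"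
      using xy by (auto simp: cls_def)
    have d: "kernel_dist M (h k) x y \<le> t"
      using trans[OF xy(1) z(1) xy(2) z(2)] z(3) by (simp add: kernel_dist_commute)
    have "w \<in> cls k x \<longleftrightarrow> w \<in> cls k y" for w
      using trans[OF xy(1,2) _ d] trans[OF xy(2,1)] d
      by (auto simp: cls_def kernel_dist_commute)
    then show ?thesis by blast
  qed
  have disj: "disjoint (P k)" for k
    unfolding disjoint_def
  proof (intro ballI impI)
    fix p q assume pq: "p \<in> P k" "q \<in> P k" "p \<noteq> q"
    then obtain x y where "x \<in> X0" "p = cls k x" "y \<in> X0" "q = cls k y" by (auto simp: P_def)
    then show "p \<inter> q = {}" using cls_eq[of x y _ k] pq(3) by blast
  qed
  have dist_meas: "(\<lambda>y. kernel_dist M (h k) x y) \<in> borel_measurable M" if "x \<in> space M" for k x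
  proof -
    have "(\<lambda>y. kernel_dist M (h k) x y) = (\<lambda>p. kernel_dist M (h k) (fst p) (snd p)) \<circ> Pair x" by auto
    also have "\<dots> \<in> borel_measurable M"
      using that by (intro measurable_comp[OF measurable_Pair1'] kernel_dist_measurable) auto
    finally show ?thesis .
  qed
  have ball_meas: "{y \<in> space M. kernel_dist M (h k) x y \<le> t} \<in> sets M" if "x \<in> space M" for k x
  proof -
    note [measurable] = dist_meas[OF that]
    show ?thesis by measurable
  qed
  have cls_meas: "cls k x \<in> sets M" if "x \<in> X0" for k x
  proof -
    have "cls k x = X0 \<inter> {y \<in> space M. kernel_dist M (h k) x y \<le> t}"
      using X0M by (auto simp: cls_def)
    then show ?thesis using X0(1) ball_meas that X0M by auto
  qed
  have cls_size: "c k \<le> measure M (cls k x)" if "x \<in> X0" for k x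
  proof -
    \<comment> \<open>The lower bound \<open>c\<close> concerns balls in the whole space, the
      classes live in \<open>X0\<close>; the difference is null.\<close>
    have "measure M (cls k x) = measure M {y \<in> space M. kernel_dist M (h k) x y \<le> t}"
    proof (rule finite_measure_eq_AE)
      show "AE y in M. y \<in> cls k x \<longleftrightarrow> y \<in> {y \<in> space M. kernel_dist M (h k) x y \<le> t}"
        using X0(2) by eventually_elim (use X0M in \<open>auto simp: cls_def\<close>)
    qed (use that X0M in \<open>auto intro: cls_meas ball_meas\<close>)
    then show ?thesis using c(2)[OF that] by simp
  qed
  have cls_act: "\<phi> g ` cls k x = cls k (\<phi> g x)" if g: "g \<in> carrier G" and x: "x \<in> X0" for g k x
  proof (intro equalityI subsetI)
    fix y assume "y \<in> \<phi> g ` cls k x"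
    then show "y \<in> cls k (\<phi> g x)"
      using g x X0M X0(3) kernel_dist_act[OF h inv g] by (auto simp: cls_def subset_iff)
  next
    fix y assume y: "y \<in> cls k (\<phi> g x)"
    define y' where "y' = \<phi> (inv g) y"
    have y': "y' \<in> X0" "\<phi> g y' = y"
      using y g X0(3)[of "inv g" y] X0M act_inv' by (auto simp: y'_def cls_def)
    have "x \<in> space M" "y' \<in> space M" using x y'(1) X0M by auto
    from kernel_dist_act[OF h inv g this, of k] have "kernel_dist M (h k) x y' \<le> t"
      using y y'(2) by (simp add: cls_def)
    then show "y \<in> \<phi> g ` cls k x" using y' by (auto simp: cls_def)
  qed
  show thesis
  proof (rule that[of P])
    show "finite (P k)" for k
      by (rule finite_disjoint_large_sets[OF disj _ c(1)[of k]])
         (use cls_meas cls_size in \<open>auto simp: P_def\<close>)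
    show "P k \<subseteq> sets M" for k using cls_meas by (auto simp: P_def)
    show "separating_invariant_partitions G X0 \<phi> P"
      unfolding separating_invariant_partitions_def
    proof (intro conjI allI ballI impI)
      fix k
      show "partition_on X0 (P k)"
      proof (rule partition_onI)
        show "\<Union> (P k) = X0" using self by (auto simp: P_def cls_def)
        show "disjnt p q" if "p \<in> P k" "q \<in> P k" "p \<noteq> q" for p q
          using disj[of k] that by (auto simp: disjoint_def disjnt_def)
        show "{} \<notin> P k" using self by (auto simp: P_def)
      qed
    next
      fix x y assume xy: "x \<in> X0" "y \<in> X0" "x \<noteq> y"
      then obtain k where "\<not> kernel_dist M (h k) x y \<le> t" using sep by blast
      then have "cls k x \<in> P k" "x \<in> cls k x" "y \<notin> cls k x" using xy self by (auto simp: P_def cls_def)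
      then show "\<exists>n. \<exists>A\<in>P n. x \<in> A \<and> y \<notin> A" by blast
    next
      fix k g assume g: "g \<in> carrier G"
      show "bij_betw ((`) (\<phi> g)) (P k) (P k)"
        unfolding bij_betw_def
      proof
        have "inj_on (\<phi> g) X0" by (rule inj_on_inverseI[of _ "\<phi> (inv g)"]) (use act_inv g X0M in auto)
        then show "inj_on ((`) (\<phi> g)) (P k)"
          by (intro inj_on_subset[OF inj_on_image_Pow]) (auto simp: P_def cls_def)
        show "(`) (\<phi> g) ` P k = P k"
        proof (intro equalityI subsetI)
          fix p assume "p \<in> (`) (\<phi> g) ` P k"
          then show "p \<in> P k" using cls_act[OF g] X0(3)[OF g] by (auto simp: P_def)
        next
          fix p assume "p \<in> P k"
          then obtain x where x: "x \<in> X0" "p = cls k x" by (auto simp: P_def)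
          have "\<phi> (inv g) x \<in> X0" "\<phi> g (\<phi> (inv g) x) = x" using x g X0(3) X0M act_inv' by auto
          then have "p = \<phi> g ` cls k (\<phi> (inv g) x)" "cls k (\<phi> (inv g) x) \<in> P k"
            using cls_act[OF g] x(2) by (auto simp: P_def)
          then show "p \<in> (`) (\<phi> g) ` P k" by blast
        qed
      qed
    qed
  qed
qed

text \<open>Separation of points needs pointwise errors, not means. Along a subsequence with
  summable errors almost every point has small error in the end, and two points that are close for
  all \<open>k\<close> then share their codes at arbitrarily fine levels.\<close>

lemma profinite_of_codes:
  fixes b :: "nat \<Rightarrow> 'a \<Rightarrow> nat"
  assumes pmp: "pmp_action G M \<phi>" and erg: "ergodic_action G M \<phi>"
    and gap: "has_spectral_gap G
           (l2_orthogonal (M \<Otimes>\<^sub>M M) (koopman_invariants G (M \<Otimes>\<^sub>M M) (diagonal_action \<phi>)))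
           (l2_norm (M \<Otimes>\<^sub>M M)) (koopman G (diagonal_action \<phi>))"
    and b [measurable]: "\<And>n. b n \<in> measurable M (count_space UNIV)"
    and refine: "\<And>n x y. b (Suc n) x = b (Suc n) y \<Longrightarrow> b n x = b n y"
    and X1: "AE x in M. x \<in> X1"
    and inj: "\<And>x y. \<lbrakk>x \<in> X1; y \<in> X1; \<And>n. b n x = b n y\<rbrakk> \<Longrightarrow> x = y"
    and equivariant: "\<And>g. g \<in> carrier G \<Longrightarrow> \<exists>W::'a \<Rightarrow> nat. W \<in> measurable M (count_space UNIV) \<and>
      (\<forall>x\<in>space M. \<forall>y\<in>space M. W x = W y \<longrightarrow> (\<forall>n. b n x = b n y \<longleftrightarrow> b n (\<phi> g x) = b n (\<phi> g y)))"
  shows "profinite_action G M \<phi>"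
proof -
  interpret D: mp_action "M \<Otimes>\<^sub>M M" G "diagonal_action \<phi>" by (rule mp_action_diagonal)
  have sb: "standard_borel_space M" using pmp by (simp add: pmp_action_def borel_action_def)
  have refine': "b n x = b n y" if "b m x = b m y" "n \<le> m" for n m x y
    using that(2,1) by (induction rule: dec_induct) (auto dest: refine)
  have almost: "(\<lambda>n. \<integral>z. (pair_kernel M (b n) (diagonal_action \<phi> g z) - pair_kernel M (b n) z)\<^sup>2 \<partial>(M \<Otimes>\<^sub>M M)) \<longlonglongrightarrow> 0"
    if g: "g \<in> carrier G" for g
  proof -
    obtain W :: "'a \<Rightarrow> nat" where W: "W \<in> measurable M (count_space UNIV)"
      "\<forall>x\<in>space M. \<forall>y\<in>space M. W x = W y \<longrightarrow> (\<forall>n. b n x = b n y \<longleftrightarrow> b n (\<phi> g x) = b n (\<phi> g y))"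
      using equivariant[OF g] by blast
    show ?thesis
    proof (rule pair_kernel_almost_invariant[OF sb b refine X1 inj W(1) g])
      fix n x y assume "x \<in> space M" "y \<in> space M" "W x = W y"
      then show "b n x = b n y \<longleftrightarrow> b n (\<phi> g x) = b n (\<phi> g y)" using W(2) by blast
    qed
  qed
  obtain H where H_meas: "\<And>n. H n \<in> borel_measurable (M \<Otimes>\<^sub>M M)"
    and H_inv: "\<And>n g z. \<lbrakk>g \<in> carrier G; z \<in> space (M \<Otimes>\<^sub>M M)\<rbrakk> \<Longrightarrow> H n (diagonal_action \<phi> g z) = H n z"
    and H_int: "\<And>n. integrable (M \<Otimes>\<^sub>M M) (\<lambda>z. (pair_kernel M (b n) z - H n z)\<^sup>2)"
    and H_lim: "(\<lambda>n. \<integral>z. (pair_kernel M (b n) z - H n z)\<^sup>2 \<partial>(M \<Otimes>\<^sub>M M)) \<longlonglongrightarrow> 0"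
    by (rule D.spectral_gap_approx[OF gap, where F = "\<lambda>n. pair_kernel M (b n)"])
       (use pair_kernel_sq_integral almost in auto)
  \<comment> \<open>The factor 1/40000 is what \<open>kernel_equivalence\<close> asks for at every
    \<open>k\<close>, the geometric factor makes the errors summable, and \<open>n \<ge> k\<close>
    lets the selected codes become arbitrarily fine.\<close>
  have "\<exists>n\<ge>k. (\<integral>z. (pair_kernel M (b n) z - H n z)\<^sup>2 \<partial>(M \<Otimes>\<^sub>M M)) < 1/40000 * (1/2) ^ k" for k :: nat
  proof -
    have "\<forall>\<^sub>F n in sequentially. (\<integral>z. (pair_kernel M (b n) z - H n z)\<^sup>2 \<partial>(M \<Otimes>\<^sub>M M)) < 1/40000 * (1/2) ^ k"
      by (rule order_tendstoD(2)[OF H_lim]) simp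
    with eventually_ge_at_top[of k]
    have "\<forall>\<^sub>F n in sequentially. n \<ge> k \<and> (\<integral>z. (pair_kernel M (b n) z - H n z)\<^sup>2 \<partial>(M \<Otimes>\<^sub>M M)) < 1/40000 * (1/2) ^ k"
      by eventually_elim simp
    then show ?thesis by (rule eventually_happens'[OF sequentially_bot])
  qed
  then obtain r where r: "\<And>k. k \<le> r k"
    "\<And>k. (\<integral>z. (pair_kernel M (b (r k)) z - H (r k) z)\<^sup>2 \<partial>(M \<Otimes>\<^sub>M M)) < 1/40000 * (1/2) ^ k" by metis
  define h where "h k = H (r k)" for k
  have h_meas [measurable]: "h k \<in> borel_measurable (M \<Otimes>\<^sub>M M)" for k unfolding h_def by (rule H_meas)
  have h_inv: "h k (\<phi> g x, \<phi> g y) = h k (x, y)" if "g \<in> carrier G" "x \<in> space M" "y \<in> space M" for k g x y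
    using H_inv[OF that(1), of "(x, y)" "r k"] that by (simp add: h_def diagonal_action_def space_pair_measure)
  have h_close: "sq_dist (M \<Otimes>\<^sub>M M) (pair_kernel M (b (r k))) (h k) \<le> ennreal (1/40000 * (1/2) ^ k)" for k
    unfolding sq_dist_def h_def using r(2)[of k] H_int[of "r k"]
    by (subst nn_integral_eq_integral) (auto intro!: ennreal_leI)
  have "\<exists>c>0. AE x in M. regular_point M (h k) c x" for k
  proof -
    have "ennreal (1/40000 * (1/2) ^ k) \<le> ennreal (1/40000)"
      by (intro ennreal_leI) (simp add: power_le_one)
    then have le: "sq_dist (M \<Otimes>\<^sub>M M) (pair_kernel M (b (r k))) (h k) \<le> ennreal (1/40000)"
      using h_close[of k] by (rule order_trans[rotated])
    obtain c where "c > 0" "AE x in M. regular_point M (h k) c x"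
      by (rule kernel_equivalence[where h = "h k" and b = "b (r k)", OF erg b h_meas h_inv le])
    then show ?thesis by blast
  qed
  then obtain c where c: "\<And>k. 0 < c k" and AE1: "\<And>k. AE x in M. regular_point M (h k) (c k) x"
    by metis
  have "(\<integral>\<^sup>+x. kernel_error M (b (r k)) (h k) x \<partial>M) \<le> ennreal (1/40000 * (1/2) ^ k)" for k
  proof -
    have "(\<integral>\<^sup>+x. kernel_error M (b (r k)) (h k) x \<partial>M) = sq_dist (M \<Otimes>\<^sub>M M) (pair_kernel M (b (r k))) (h k)"
      unfolding kernel_error_def sq_dist_def by (rule nn_integral_fst) measurable
    then show ?thesis using h_close[of k] by simp
  qed
  then have AE3: "AE x in M. \<forall>\<^sub>F k in sequentially. kernel_error M (b (r k)) (h k) x \<le> ennreal (1/1000)"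
    by (intro AE_eventually_small[where C = "1/40000"]) auto
  have AE4: "AE x in M. \<forall>k. class_measure M (b (r k)) x > 0"
    unfolding AE_all_countable using AE_class_measure_pos[OF b] by blast
  define Q where "Q x \<longleftrightarrow> x \<in> X1 \<and> (\<forall>\<^sub>F k in sequentially. kernel_error M (b (r k)) (h k) x \<le> ennreal (1/1000)) \<and>
     (\<forall>k. class_measure M (b (r k)) x > 0) \<and>
     (\<forall>k. regular_point M (h k) (c k) x)" for x
  have "AE x in M. Q x"
    unfolding Q_def using X1 AE3 AE4 AE1 by (simp add: AE_conj_iff AE_all_countable)
  from invariant_conull_subset[OF this] obtain X0 where X0: "X0 \<in> sets M" "AE x in M. x \<in> X0"
    and X0_Q: "\<And>x. x \<in> X0 \<Longrightarrow> Q x"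
    and X0_inv: "\<And>g x. \<lbrakk>g \<in> carrier G; x \<in> X0\<rbrakk> \<Longrightarrow> \<phi> g x \<in> X0" by metis
  have Q_X1: "x \<in> X1" and Q_error: "\<forall>\<^sub>F k in sequentially. kernel_error M (b (r k)) (h k) x \<le> ennreal (1/1000)"
    and Q_pos: "class_measure M (b (r k)) x > 0" and Q_regular: "regular_point M (h k) (c k) x"
    if "x \<in> X0" for k x
    using X0_Q[OF that] by (simp_all add: Q_def)
  have X0M: "X0 \<subseteq> space M" using X0(1) by (rule sets.sets_into_space)
  have "\<exists>P. separating_invariant_partitions G X0 \<phi> P \<and> (\<forall>n. finite (P n) \<and> P n \<subseteq> sets M)"
  proof (rule separating_invariant_partitions_dist[where h = h and c = c and t = "ennreal (2/125)"])
    fix k x y z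
    assume xyz: "x \<in> X0" "y \<in> X0" "z \<in> X0" "kernel_dist M (h k) x y \<le> ennreal (2/125)"
      "kernel_dist M (h k) y z \<le> ennreal (2/125)"
    have "y \<in> space M" "z \<in> space M" using xyz X0M by auto
    then show "kernel_dist M (h k) x z \<le> ennreal (2/125)"
      by (rule regular_point_trans[OF Q_regular[OF xyz(1)] Q_regular[OF xyz(3)] _ _ xyz(4,5)])
  next
    fix k x assume "x \<in> X0"
    then show "c k \<le> measure M {y \<in> space M. kernel_dist M (h k) x y \<le> ennreal (2/125)}"
      using Q_regular[of x k] by (simp add: regular_point_def)
  next
    fix x y assume xy: "x \<in> X0" "y \<in> X0" and d: "\<And>k. kernel_dist M (h k) x y \<le> ennreal (2/125)"
    have xyM: "x \<in> space M" "y \<in> space M" using xy X0M by auto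
    from Q_error[OF xy(1)] Q_error[OF xy(2)]
    have ev: "\<forall>\<^sub>F k in sequentially. b (r k) x = b (r k) y"
    proof eventually_elim
      case (elim k)
      show ?case
      proof (rule ccontr)
        assume ne: "b (r k) x \<noteq> b (r k) y"
        \<comment> \<open>The right-hand side is at most 7/100, so the threshold 2/125 leaves ample
          room to keep different classes apart.\<close>
        have "1 \<le> 4 * kernel_error M (b (r k)) (h k) x + 4 * kernel_dist M (h k) x y + 2 * kernel_error M (b (r k)) (h k) y"
          by (rule kernel_dist_different_class[OF b h_meas xyM ne Q_pos[OF xy(1)]])
        also have "\<dots> \<le> 4 * ennreal (1/1000) + 4 * ennreal (2/125) + 2 * ennreal (1/1000)"
          using elim d[of k] by (intro add_mono mult_left_mono) auto
        also have "\<dots> = ennreal (4 * (1/1000) + 4 * (2/125) + 2 * (1/1000))"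
          by (simp add: ennreal_plus[symmetric] ennreal_mult''[symmetric] ennreal_numeral[symmetric]
              del: ennreal_plus ennreal_numeral)
        finally have "ennreal 1 \<le> ennreal (4 * (1/1000) + 4 * (2/125) + 2 * (1/1000))" by simp
        then show False by (subst (asm) ennreal_le_iff) auto
      qed
    qed
    have "b n x = b n y" for n
    proof -
      have "\<forall>\<^sub>F k in sequentially. b n x = b n y"
        using ev eventually_ge_at_top[of n]
      proof eventually_elim
        case (elim k)
        then show ?case using refine'[OF elim(1)] r(1)[of k] by simp
      qed
      then show ?thesis by simp
    qed
    then show "x = y" by (rule inj[OF Q_X1[OF xy(1)] Q_X1[OF xy(2)]])
  next
    fix P :: "nat \<Rightarrow> 'a set set"
    assume "separating_invariant_partitions G X0 \<phi> P" "\<And>n. finite (P n)" "\<And>n. P n \<subseteq> sets M"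
    then show "\<exists>P. separating_invariant_partitions G X0 \<phi> P \<and> (\<forall>n. finite (P n) \<and> P n \<subseteq> sets M)"
      by blast
  qed (use h_meas h_inv X0 X0_inv c in auto)
  moreover have "emeasure M X0 = 1" using X0 by (simp add: emeasure_eq_1_AE)
  ultimately show ?thesis unfolding profinite_action_def using pmp X0(1) by blast
qed

end

section \<open>Codes from modular actions\<close>

lemma pred_nat_eq:
  fixes f g :: "'a \<Rightarrow> nat"
  assumes [measurable]: "f \<in> measurable M (count_space UNIV)" "g \<in> measurable M (count_space UNIV)"
  shows "Measurable.pred M (\<lambda>x. f x = g x)"
proof -
  have [measurable]: "(\<lambda>x. real (f x)) \<in> borel_measurable M" "(\<lambda>x. real (g x)) \<in> borel_measurable M"
    by measurable
  have "Measurable.pred M (\<lambda>x. real (f x) = real (g x))" by measurable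
  then show ?thesis by simp
qed

text \<open>Pairing accumulates the codes, so that equality at one level forces equality at all
  lower levels.\<close>

lemma refine_codes:
  fixes c :: "nat \<Rightarrow> 'a \<Rightarrow> nat"
  assumes c [measurable]: "\<And>n. c n \<in> measurable M (count_space UNIV)"
  shows "\<exists>a :: nat \<Rightarrow> 'a \<Rightarrow> nat. (\<forall>n. a n \<in> measurable M (count_space UNIV)) \<and>
    (\<forall>n x y. a n x = a n y \<longleftrightarrow> (\<forall>j\<le>n. c j x = c j y))"
proof -
  define a where "a = rec_nat (c 0) (\<lambda>n u x. prod_encode (u x, c (Suc n) x))"
  have a0: "a 0 = c 0" and aS: "a (Suc n) = (\<lambda>x. prod_encode (a n x, c (Suc n) x))" for n
    by (simp_all add: a_def)
  show ?thesis
  proof (intro exI[of _ a] conjI allI)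
    fix n
    show "a n \<in> measurable M (count_space UNIV)"
    proof (induction n)
      case (Suc n)
      note Suc [measurable]
      have "(\<lambda>x. (\<lambda>i j. prod_encode (i, j)) (a n x) (c (Suc n) x)) \<in> measurable M (count_space UNIV)"
        by measurable
      then show ?case by (simp add: aS)
    qed (simp add: a0)
    show "a n x = a n y \<longleftrightarrow> (\<forall>j\<le>n. c j x = c j y)" for n x y
      by (induction n) (auto simp: a0 aS prod_encode_eq le_Suc_eq)
  qed
qed

text \<open>Once the pieces are numbered, the code of \<open>\<psi> h y\<close> is a function of the
  code of \<open>y\<close> because pieces go to pieces; the converse implication holds because they
  are permuted injectively.\<close>

lemma modular_action_codes:
  assumes "modular_action H Y \<psi>"
  shows "\<exists>e :: nat \<Rightarrow> 'b \<Rightarrow> nat. (\<forall>n. e n \<in> measurable Y (count_space UNIV)) \<and>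
    (\<forall>y\<in>space Y. \<forall>y'\<in>space Y. (\<forall>n. e n y = e n y') \<longrightarrow> y = y') \<and>
    (\<forall>n. \<forall>h\<in>carrier H. \<forall>y\<in>space Y. \<forall>y'\<in>space Y. e n (\<psi> h y) = e n (\<psi> h y') \<longleftrightarrow> e n y = e n y')"
proof -
  obtain P where "separating_invariant_partitions H (space Y) \<psi> P \<and> (\<forall>n. countable (P n) \<and> P n \<subseteq> sets Y)"
    using assms unfolding modular_action_def by (elim conjE exE) (rule that, rule conjI)
  then have cnt: "\<And>n. countable (P n)" and PY: "\<And>n. P n \<subseteq> sets Y"
    and part: "\<And>n. partition_on (space Y) (P n)"
    and sep: "\<forall>x\<in>space Y. \<forall>y\<in>space Y. x \<noteq> y \<longrightarrow> (\<exists>n. \<exists>A\<in>P n. x \<in> A \<and> y \<notin> A)"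
    and bij: "\<And>n g. g \<in> carrier H \<Longrightarrow> bij_betw (image (\<psi> g)) (P n) (P n)"
    by (simp_all add: separating_invariant_partitions_def)
  interpret group_action H "space Y" \<psi>
    using assms by (simp add: modular_action_def borel_action_def)
  define piece where "piece n y = (THE A. A \<in> P n \<and> y \<in> A)" for n y
  have piece_eq: "piece n y = A" if "A \<in> P n" "y \<in> A" for n y A
    unfolding piece_def using partition_onD2[OF part, of n] that by (intro the_equality) (auto simp: disjoint_def)
  have piece: "piece n y \<in> P n" "y \<in> piece n y" if "y \<in> space Y" for n y
  proof -
    have "y \<in> \<Union>(P n)" using that by (subst (asm) partition_onD1[OF part, of n])
    then obtain A where A: "A \<in> P n" "y \<in> A" by (rule UnionE)
    then show "piece n y \<in> P n" "y \<in> piece n y" using piece_eq[OF A] by simp_all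
  qed
  define e where "e n y = to_nat_on (P n) (piece n y)" for n y
  have e_eq: "e n y = e n y' \<longleftrightarrow> piece n y = piece n y'" if "y \<in> space Y" "y' \<in> space Y" for n y y'
    unfolding e_def using piece that cnt by (intro to_nat_on_inj) auto
  show ?thesis
  proof (intro exI[of _ e] conjI allI ballI impI)
    fix n
    show "e n \<in> measurable Y (count_space UNIV)"
    proof (rule measurable_count_space_eq2_countable[THEN iffD2, rotated], intro conjI ballI)
      fix m :: nat
      have "e n -` {m} \<inter> space Y = \<Union>{A \<in> P n. to_nat_on (P n) A = m}"
      proof (intro equalityI subsetI)
        fix y assume "y \<in> e n -` {m} \<inter> space Y"
        then show "y \<in> \<Union>{A \<in> P n. to_nat_on (P n) A = m}" using piece[of y n] by (auto simp: e_def)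
      next
        fix y assume "y \<in> \<Union>{A \<in> P n. to_nat_on (P n) A = m}"
        then obtain A where A: "A \<in> P n" "to_nat_on (P n) A = m" "y \<in> A" by auto
        then have "y \<in> space Y" using PY sets.sets_into_space by blast
        then show "y \<in> e n -` {m} \<inter> space Y" using piece_eq[OF A(1,3)] A(2) by (simp add: e_def)
      qed
      also have "\<dots> \<in> sets Y"
        using cnt[of n] PY[of n] by (intro sets.countable_Union) auto
      finally show "e n -` {m} \<inter> space Y \<in> sets Y" .
    qed auto
  next
    fix y y' assume y: "y \<in> space Y" "y' \<in> space Y" and eq: "\<forall>n. e n y = e n y'"
    show "y = y'"
    proof (rule ccontr)
      assume "y \<noteq> y'"
      then obtain n A where A: "A \<in> P n" "y \<in> A" "y' \<notin> A" using sep y by metis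
      then show False using piece_eq[OF A(1,2)] piece(2)[OF y(2), of n] eq e_eq[OF y] by simp
    qed
  next
    fix n h y y' assume h: "h \<in> carrier H" and y: "y \<in> space Y" "y' \<in> space Y"
    show "e n (\<psi> h y) = e n (\<psi> h y') \<longleftrightarrow> e n y = e n y'"
    proof -
      have hy: "\<psi> h y \<in> space Y" "\<psi> h y' \<in> space Y" using element_image[OF h] y by auto
      have img: "piece n (\<psi> h z) = \<psi> h ` piece n z" if "z \<in> space Y" for z
        using piece[OF that, of n] bij[OF h, of n] by (intro piece_eq) (auto simp: bij_betw_def)
      show ?thesis
        unfolding e_eq[OF hy] e_eq[OF y] img[OF y(1)] img[OF y(2)]
        by (rule inj_on_eq_iff[OF bij_betw_imp_inj_on[OF bij[OF h]] piece(1)[OF y(1)] piece(1)[OF y(2)]])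
    qed
  qed
qed

lemma mp_action_pmp:
  assumes "pmp_action G M \<phi>"
  shows "mp_action M G \<phi>"
proof -
  interpret group_action G "space M" \<phi>
    using assms by (simp add: pmp_action_def borel_action_def)
  interpret group G using group_hom group_hom.axioms(1) by auto
  interpret prob_space M using assms by (simp add: pmp_action_def)
  show ?thesis
    by unfold_locales
       (use assms id_eq_one in \<open>auto simp: pmp_action_def borel_action_def orbit_sym_aux composition_rule
          dest: fun_cong simp flip: id_eq_one\<close>)
qed

lemma (in group_action) orbit_act:
  assumes g: "g \<in> carrier G" and x: "x \<in> E"
  shows "orbit G \<phi> (\<phi> g x) = orbit G \<phi> x"
proof -
  have gx: "\<phi> g x \<in> E" using element_image[OF g x refl] .
  have 1: "\<phi> g x \<in> orbit G \<phi> x" using g by (auto simp: orbit_def)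
  have 2: "x \<in> orbit G \<phi> (\<phi> g x)" by (rule orbit_sym[OF x gx 1])
  have sub: "y \<in> E" if "y \<in> orbit G \<phi> z" "z \<in> E" for y z
    using that element_image[OF _ that(2)] by (auto simp: orbit_def)
  show ?thesis
    using orbit_trans[OF x gx sub[OF _ gx] 1] orbit_trans[OF gx x sub[OF _ x] 2] by blast
qed

theorem theorem1:
  fixes \<Gamma> :: "('g, 'r) monoid_scheme" and \<mu> :: "'a measure" and \<phi> :: "'g \<Rightarrow> 'a \<Rightarrow> 'a"
    and \<Delta> :: "('h, 's) monoid_scheme" and Y :: "'b measure" and \<psi> :: "'h \<Rightarrow> 'b \<Rightarrow> 'b"
    and D :: "'a set" and \<alpha> :: "'a \<Rightarrow> 'b"
  assumes "pmp_action \<Gamma> \<mu> \<phi>"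
    and "ergodic_action \<Gamma> \<mu> \<phi>"
    and "has_spectral_gap \<Gamma>
           (l2_orthogonal (\<mu> \<Otimes>\<^sub>M \<mu>)
              (koopman_invariants \<Gamma> (\<mu> \<Otimes>\<^sub>M \<mu>) (diagonal_action \<phi>)))
           (l2_norm (\<mu> \<Otimes>\<^sub>M \<mu>))
           (koopman \<Gamma> (diagonal_action \<phi>))"
    and "D \<in> sets (completion \<mu>)" and "emeasure (completion \<mu>) D = 1"
    and "modular_action \<Delta> Y \<psi>"
    and "\<alpha> \<in> measurable (restrict_space \<mu> D) Y"
    and "rel_homomorphism D (restrict_rel (orbit_equiv_rel \<Gamma> (space \<mu>) \<phi>) D)
           (space Y) (orbit_equiv_rel \<Delta> (space Y) \<psi>) \<alpha>"
    and "countable_to_one D (space Y) \<alpha>"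
  shows "profinite_action \<Gamma> \<mu> \<phi>"
proof -
  interpret mp_action \<mu> \<Gamma> \<phi> by (rule mp_action_pmp[OF assms(1)])
  interpret X: group_action \<Gamma> "space \<mu>" \<phi>
    using assms(1) by (simp add: pmp_action_def borel_action_def)
  interpret Y: group_action \<Delta> "space Y" \<psi>
    using assms(6) by (simp add: modular_action_def borel_action_def)
  have sb: "standard_borel_space \<mu>" using assms(1) by (simp add: pmp_action_def borel_action_def)
  have \<psi>_meas: "\<psi> d \<in> Y \<rightarrow>\<^sub>M Y" if "d \<in> carrier \<Delta>" for d
    using assms(6) that by (simp add: modular_action_def borel_action_def)
  \<comment> \<open>\<open>D\<close> is measurable only for the completion. Its main part lies in
    \<open>sets \<mu>\<close> and is still conull.\<close>
  have "emeasure \<mu> (main_part \<mu> D) = 1" using assms(4,5) by simp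
  then have "AE x in \<mu>. x \<in> main_part \<mu> D"
    using main_part_sets[OF assms(4)] by (simp add: prob_eq_1[symmetric] measure_def)
  moreover have "main_part \<mu> D \<subseteq> D" using main_part_null_part_Un[OF assms(4)] by blast
  ultimately have "AE x in \<mu>. x \<in> D" by (auto elim: AE_mp)
  from invariant_conull_subset[OF this] obtain X0 where X0 [measurable]: "X0 \<in> sets \<mu>"
    and X0_AE: "AE x in \<mu>. x \<in> X0" and X0_D: "\<And>x. x \<in> X0 \<Longrightarrow> x \<in> D"
    and X0_act: "\<And>g x. \<lbrakk>g \<in> carrier \<Gamma>; x \<in> X0\<rbrakk> \<Longrightarrow> \<phi> g x \<in> X0" by metis
  have X0M: "X0 \<subseteq> space \<mu>" using X0 by (rule sets.sets_into_space)
  have X0_iff: "\<phi> g x \<in> X0 \<longleftrightarrow> x \<in> X0" if "g \<in> carrier \<Gamma>" "x \<in> space \<mu>" for g x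
    using X0_act[of g x] X0_act[of "inv\<^bsub>\<Gamma>\<^esub> g" "\<phi> g x"] that act_inv by auto
  have \<alpha>_Y: "\<alpha> x \<in> space Y" if "x \<in> X0" for x
    using assms(8) X0_D[OF that] by (auto simp: rel_homomorphism_def)
  obtain e :: "nat \<Rightarrow> 'b \<Rightarrow> nat" where
    E: "(\<forall>n. e n \<in> measurable Y (count_space UNIV)) \<and>
    (\<forall>y\<in>space Y. \<forall>y'\<in>space Y. (\<forall>n. e n y = e n y') \<longrightarrow> y = y') \<and>
    (\<forall>n. \<forall>h\<in>carrier \<Delta>. \<forall>y\<in>space Y. \<forall>y'\<in>space Y. e n (\<psi> h y) = e n (\<psi> h y') \<longleftrightarrow> e n y = e n y')"
    using modular_action_codes[OF assms(6)] by (rule exE)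
  then have e: "\<And>n. e n \<in> measurable Y (count_space UNIV)"
    and e_sep: "\<And>y y'. \<lbrakk>y \<in> space Y; y' \<in> space Y; \<forall>n. e n y = e n y'\<rbrakk> \<Longrightarrow> y = y'"
    and e_act: "\<And>n h y y'. \<lbrakk>h \<in> carrier \<Delta>; y \<in> space Y; y' \<in> space Y\<rbrakk>
        \<Longrightarrow> e n (\<psi> h y) = e n (\<psi> h y') \<longleftrightarrow> e n y = e n y'"
    by simp_all
  \<comment> \<open>Measurability of \<alpha> refers to the trace on \<open>D\<close>, which need
    not lie in \<open>sets \<mu>\<close>. Passing to \<open>X0\<close>, which does, permits an
    extension by a constant.\<close>
  have code_meas: "(\<lambda>x. if x \<in> X0 then Suc (f (\<alpha> x)) else 0) \<in> measurable \<mu> (count_space UNIV)"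
    if f: "f \<in> measurable Y (count_space UNIV)" for f :: "'b \<Rightarrow> nat"
  proof -
    have f\<alpha>: "(\<lambda>x. f (\<alpha> x)) \<in> measurable (restrict_space \<mu> D) (count_space UNIV)"
      using measurable_comp[OF assms(7) f] by (simp add: comp_def)
    have "(\<lambda>x. f (\<alpha> x)) \<in> measurable (restrict_space \<mu> X0) (count_space UNIV)"
    proof (rule measurableI)
      fix A :: "nat set"
      have "(\<lambda>x. f (\<alpha> x)) -` A \<inter> (D \<inter> space \<mu>) \<in> sets (restrict_space \<mu> D)"
        using measurable_sets[OF f\<alpha>, of A] by (simp add: space_restrict_space)
      then obtain B where B: "B \<in> sets \<mu>" "(\<lambda>x. f (\<alpha> x)) -` A \<inter> (D \<inter> space \<mu>) = D \<inter> B"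
        by (auto simp: sets_restrict_space)
      have "(\<lambda>x. f (\<alpha> x)) -` A \<inter> X0 = X0 \<inter> B" using B(2) X0_D X0M by blast
      then show "(\<lambda>x. f (\<alpha> x)) -` A \<inter> space (restrict_space \<mu> X0) \<in> sets (restrict_space \<mu> X0)"
        using B(1) X0M by (auto simp: sets_restrict_space space_restrict_space Int_absorb2)
    qed simp
    then have "(\<lambda>x. Suc (f (\<alpha> x))) \<in> measurable (restrict_space \<mu> X0) (count_space UNIV)" by measurable
    then show ?thesis by (intro measurable_If_restrict_space_iff[THEN iffD2]) auto
  qed
  \<comment> \<open>\<open>Suc\<close> reserves the value 0 for points off \<open>X0\<close>. As
    \<open>X0\<close> is invariant, comparing codes before and after applying \<open>g\<close> works
    there as well.\<close>
  define a' where "a' n x = (if x \<in> X0 then Suc (e n (\<alpha> x)) else 0)" for n x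
  have a'_meas [measurable]: "a' n \<in> measurable \<mu> (count_space UNIV)" for n
    unfolding a'_def[abs_def] by (rule code_meas[OF e])
  obtain a :: "nat \<Rightarrow> 'a \<Rightarrow> nat" where "(\<forall>n. a n \<in> measurable \<mu> (count_space UNIV)) \<and>
    (\<forall>n x y. a n x = a n y \<longleftrightarrow> (\<forall>j\<le>n. a' j x = a' j y))"
    using refine_codes[of a', OF a'_meas] by (rule exE)
  then have a [measurable]: "\<And>n. a n \<in> measurable \<mu> (count_space UNIV)"
    and a_eq: "\<And>n x y. a n x = a n y \<longleftrightarrow> (\<forall>j\<le>n. a' j x = a' j y)"
    by simp_all
  have fibres: "countable {y \<in> X0. \<forall>n. a n y = a n x}" if x: "x \<in> X0" for x
  proof (rule countable_subset)
    show "countable {y \<in> D. \<alpha> y = \<alpha> x}"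
      using assms(9) \<alpha>_Y[OF x] by (simp add: countable_to_one_def)
    show "{y \<in> X0. \<forall>n. a n y = a n x} \<subseteq> {y \<in> D. \<alpha> y = \<alpha> x}"
    proof safe
      fix y assume y: "y \<in> X0" "\<forall>n. a n y = a n x"
      then show "y \<in> D" using X0_D by blast
      have "e n (\<alpha> y) = e n (\<alpha> x)" for n
        using y x a_eq[of n y x] by (auto simp: a'_def)
      then show "\<alpha> y = \<alpha> x" using y(1) x \<alpha>_Y by (intro e_sep) auto
    qed
  qed
  have "\<exists>(i :: 'a \<Rightarrow> nat) X1. i \<in> measurable \<mu> (count_space UNIV) \<and> (AE x in \<mu>. x \<in> X1) \<and>
    (\<forall>x\<in>X1. \<forall>y\<in>X1. (\<forall>n. a n x = a n y) \<longrightarrow> i x = i y \<longrightarrow> x = y)"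
  proof (rule index_injective[OF prob_space_axioms sb a _ X0_AE fibres])
    fix n x y assume "a (Suc n) x = a (Suc n) y"
    then show "a n x = a n y" by (simp add: a_eq)
  next
    fix i :: "'a \<Rightarrow> nat" and X1
    assume "i \<in> measurable \<mu> (count_space UNIV)" "AE x in \<mu>. x \<in> X1"
      "\<And>x y. \<lbrakk>x \<in> X1; y \<in> X1; \<And>n. a n x = a n y; i x = i y\<rbrakk> \<Longrightarrow> x = y"
    then show "\<exists>(i :: 'a \<Rightarrow> nat) X1. i \<in> measurable \<mu> (count_space UNIV) \<and> (AE x in \<mu>. x \<in> X1) \<and>
      (\<forall>x\<in>X1. \<forall>y\<in>X1. (\<forall>n. a n x = a n y) \<longrightarrow> i x = i y \<longrightarrow> x = y)"
      by (intro exI[of _ i] exI[of _ X1]) simp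
  qed
  then obtain i :: "'a \<Rightarrow> nat" and X1 where i [measurable]: "i \<in> measurable \<mu> (count_space UNIV)"
    and X1: "AE x in \<mu>. x \<in> X1"
    and X1_inj: "\<forall>x\<in>X1. \<forall>y\<in>X1. (\<forall>n. a n x = a n y) \<longrightarrow> i x = i y \<longrightarrow> x = y"
    by (elim exE conjE)
  \<comment> \<open>The same index is added at every level, so that refinement is inherited from
    \<open>a\<close>.\<close>
  define b where "b n x = prod_encode (a n x, i x)" for n x
  have b_eq: "b n x = b n y \<longleftrightarrow> a n x = a n y \<and> i x = i y" for n x y
    by (simp add: b_def prod_encode_eq)
  show ?thesis
  proof (rule profinite_of_codes[where b = b, OF assms(1,2,3)])
    show "b n \<in> measurable \<mu> (count_space UNIV)" for n
    proof -
      have "(\<lambda>x. (\<lambda>j k. prod_encode (j, k)) (a n x) (i x)) \<in> measurable \<mu> (count_space UNIV)"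
        by measurable
      then show ?thesis by (simp add: b_def[abs_def])
    qed
    show "b n x = b n y" if "b (Suc n) x = b (Suc n) y" for n x y
      using that by (simp add: b_eq a_eq)
    show "AE x in \<mu>. x \<in> X1" by (rule X1)
    show "x = y" if "x \<in> X1" "y \<in> X1" "\<And>n. b n x = b n y" for x y
      using X1_inj that by (simp add: b_eq)
    fix g assume g: "g \<in> carrier \<Gamma>"
    note [measurable] = act_measurable[OF g]
    define d where "d = from_nat_into (carrier \<Delta>)"
    have \<Delta>_ne: "carrier \<Delta> \<noteq> {}" using Y.group_hom group_hom.axioms(1) group.is_monoid monoid.one_closed by blast
    have "countable (carrier \<Delta>)" using assms(6) by (simp add: modular_action_def borel_action_def)
    then have d: "range d = carrier \<Delta>" unfolding d_def using \<Delta>_ne by (intro range_from_nat_into)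
    have dk: "d k \<in> carrier \<Delta>" for k using d by blast
    define v where "v n k x = (if x \<in> X0 then Suc (e n (\<psi> (d k) (\<alpha> x))) else 0)" for n k x
    have v_meas [measurable]: "v n k \<in> measurable \<mu> (count_space UNIV)" for n k
      unfolding v_def[abs_def] by (rule code_meas[OF measurable_compose[OF \<psi>_meas[OF dk] e]])
    \<comment> \<open>On \<open>X0\<close> this says that \<open>\<alpha> (\<phi> g x)\<close> is
      \<open>\<psi> (d k) (\<alpha> x)\<close>, tested through the separating codes so that
      measurability is immediate. The least such \<open>k\<close> is a measurable choice of an
      element of \<Delta>.\<close>
    define Q where "Q k x \<longleftrightarrow> (\<forall>n. a' n (\<phi> g x) = v n k x)" for k x
    have Q_meas [measurable]: "Measurable.pred \<mu> (Q k)" for k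
    proof -
      have [measurable]: "Measurable.pred \<mu> (\<lambda>x. a' n (\<phi> g x) = v n k x)" for n
        by (rule pred_nat_eq) measurable
      show ?thesis unfolding Q_def[abs_def] by measurable
    qed
    define w where "w x = (LEAST k. Q k x)" for x
    have w_meas [measurable]: "w \<in> measurable \<mu> (count_space UNIV)"
      unfolding w_def[abs_def] by measurable
    text \<open>The indices \<open>i\<close> at \<open>x\<close> and \<open>g x\<close> are included because \<open>b\<close> refines \<open>a\<close> by \<open>i\<close>.\<close>
    define W where "W x = prod_encode (if x \<in> X0 then Suc (w x) else 0, prod_encode (i x, i (\<phi> g x)))" for x
    have W_meas: "W \<in> measurable \<mu> (count_space UNIV)"
    proof -
      have "(\<lambda>x. (\<lambda>j k l. prod_encode (j, prod_encode (k, l))) (if x \<in> X0 then Suc (w x) else 0) (i x) (i (\<phi> g x)))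
        \<in> measurable \<mu> (count_space UNIV)" by measurable
      then show ?thesis by (simp add: W_def[abs_def])
    qed
    have Q_w: "Q (w x) x" if x: "x \<in> X0" for x
    proof -
      have gx: "\<phi> g x \<in> X0" using X0_act[OF g x] .
      have "orbit \<Gamma> \<phi> x = orbit \<Gamma> \<phi> (\<phi> g x)"
        using X.orbit_act[OF g] x X0M by blast
      then have "(x, \<phi> g x) \<in> restrict_rel (orbit_equiv_rel \<Gamma> (space \<mu>) \<phi>) D"
        using x gx X0M X0_D by (auto simp: restrict_rel_def orbit_equiv_rel_def)
      then have "(\<alpha> x, \<alpha> (\<phi> g x)) \<in> orbit_equiv_rel \<Delta> (space Y) \<psi>"
        using assms(8) unfolding rel_homomorphism_def by force
      then have "\<alpha> (\<phi> g x) \<in> orbit \<Delta> \<psi> (\<alpha> x)"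
        using Y.orbit_refl[OF \<alpha>_Y[OF gx]] by (simp add: orbit_equiv_rel_def)
      then obtain h where "h \<in> carrier \<Delta>" "\<alpha> (\<phi> g x) = \<psi> h (\<alpha> x)" by (auto simp: orbit_def)
      then obtain k where "\<alpha> (\<phi> g x) = \<psi> (d k) (\<alpha> x)" using d by (metis imageE)
      then have "Q k x" using x gx by (simp add: Q_def a'_def v_def)
      then show ?thesis unfolding w_def by (rule LeastI)
    qed
    have "b n x = b n y \<longleftrightarrow> b n (\<phi> g x) = b n (\<phi> g y)"
      if x: "x \<in> space \<mu>" and y: "y \<in> space \<mu>" and "W x = W y" for n x y
    proof -
      have code: "(if x \<in> X0 then Suc (w x) else 0) = (if y \<in> X0 then Suc (w y) else 0)"
        and ii: "i x = i y" "i (\<phi> g x) = i (\<phi> g y)"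
        using \<open>W x = W y\<close> by (simp_all add: W_def prod_encode_eq)
      have "a' j x = a' j y \<longleftrightarrow> a' j (\<phi> g x) = a' j (\<phi> g y)" for j
      proof (cases "x \<in> X0")
        case True
        then have yX: "y \<in> X0" and ww: "w x = w y" using code by (auto split: if_splits)
        have "a' j (\<phi> g x) = Suc (e j (\<psi> (d (w x)) (\<alpha> x)))" "a' j (\<phi> g y) = Suc (e j (\<psi> (d (w x)) (\<alpha> y)))"
          using Q_w[OF True] Q_w[OF yX] True yX ww by (simp_all add: Q_def v_def)
        then show ?thesis
          using e_act[OF dk \<alpha>_Y[OF True] \<alpha>_Y[OF yX]] True yX by (simp add: a'_def)
      next
        case False
        then have "y \<notin> X0" using code by (auto split: if_splits)
        then show ?thesis using False X0_iff[OF g x] X0_iff[OF g y] by (simp add: a'_def)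
      qed
      then show ?thesis using ii by (simp add: b_eq a_eq)
    qed
    then show "\<exists>W::'a \<Rightarrow> nat. W \<in> measurable \<mu> (count_space UNIV) \<and>
      (\<forall>x\<in>space \<mu>. \<forall>y\<in>space \<mu>. W x = W y \<longrightarrow> (\<forall>n. b n x = b n y \<longleftrightarrow> b n (\<phi> g x) = b n (\<phi> g y)))"
      using W_meas by blast
  qed
qed

end
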